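(* Let $n\ge 3$. Let $U\subset \mathcal S^{n\times n}$ be an open set such that (i) $O^{-1}UO=U$ for all $O\in O(n)$; (ii) $U\cap\{M+tN \mid 0<t<\infty\}$ is convex for all $M\in\mathcal S^{n\times n}$ and $N\in\mathcal S^{n\times n}_+$; (iii) $\Gamma_U:=\{\lambda(M)\mid M\in U\}\subset\Gamma_k$ for some integer $k$ with $\frac{n+1}{2}<k\le n$. Let $F\in C^2(U)$ be a real-valued function such that, with $F_{ij}(M):=\frac{\partial F}{\partial M_{ij}}(M)$, (iv) $F(O^{-1}MO)=F(M)$ for all $M\in U$, $O\in O(n)$; (v) the zero matrix does not belong to $F^{-1}(1)$; (vi) the matrix $(F_{ij}(M))$ is positive definite for all $M\in U$; (vii) $F$ is locally concave in $U$; (viii) for some $0<\gamma\le 1$, $\sum_{i,j=1}^n F_{ij}(M)M_{ij}\le \frac1\gamma |M|^{1-\gamma}\sum_{i=1}^n F_{ii}(M)$ for all $M\in U$ with $F(M)=1$ and $|M|\ge 1$. Let $u\in C^4(\mathbb R^n)$ be a positive solution of $$F(A^u)=1,\quad A^u\in U,\quad\text{on }\mathbb R^n.$$ Then there exist $\bar x\in\mathbb R^n$ and positive constants $a$ and $b$ satisfying $2b^2a^{-2}I\in U$ and $F(2b^2a^{-2}I)=1$ such that $$u(x)=\left(\frac{a}{1+b^2|x-\bar x|^2}\right)^{\frac{n-2}{2}}\qquad\text{for all }x\in\mathbb R^n.$$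
   Context: $\mathcal S^{n\times n}$ is the set of $n\times n$ real symmetric matrices, $\mathcal S^{n\times n}_+$ the subset of positive definite ones, $O(n)$ the set of $n\times n$ real orthogonal matrices, $I$ the $n\times n$ identity matrix, and $\lambda(M)=(\lambda_1,\dots,\lambda_n)$ denotes the eigenvalues of $M\in\mathcal S^{n\times n}$. For $1\le k\le n$ and $\lambda\in\mathbb R^n$, $\sigma_k(\lambda)=\sum_{1\le i_1<\cdots<i_k\le n}\lambda_{i_1}\cdots\lambda_{i_k}$, and $\Gamma_k$ is the connected component of $\{\lambda\in\mathbb R^n\mid\sigma_k(\lambda)>0\}$ containing the positive cone $\{\lambda\mid\lambda_1,\dots,\lambda_n>0\}$; equivalently $\Gamma_k=\{\lambda\mid\sigma_1(\lambda)>0,\dots,\sigma_k(\lambda)>0\}$. It is symmetric in the $\lambda_i$, so the ordering of eigenvalues is irrelevant. For a positive $C^2$ function $u$, $$A^u:=-\frac{2}{n-2}u^{-\frac{n+2}{n-2}}\nabla^2u+\frac{2n}{(n-2)^2}u^{-\frac{2n}{n-2}}\nabla u\otimes\nabla u-\frac{2}{(n-2)^2}u^{-\frac{2n}{n-2}}|\nabla u|^2I.$$ *)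

theory Defs
  imports "HOL-Analysis.Analysis"
begin

definition sym_mats :: "(real^'n^'n) set" where
  "sym_mats = {M. transpose M = M}"

definition pos_def_mats :: "(real^'n^'n) set" where
  "pos_def_mats = {M \<in> sym_mats. \<forall>x. x \<noteq> 0 \<longrightarrow> 0 < x \<bullet> (M *v x)}"

text \<open>
  The vector \<open>l\<close> lists the eigenvalues of \<open>M\<close> with algebraic multiplicity, in some order.
  All orderings are admitted; the sets they are compared with are symmetric in the coordinates.
\<close>
definition eigenvalue_vector :: "real^'n^'n \<Rightarrow> real^'n \<Rightarrow> bool" where
  "eigenvalue_vector M l \<longleftrightarrow> (\<forall>t. det (t *\<^sub>R mat 1 - M) = (\<Prod>i\<in>UNIV. t - l $ i))"

definition eigenvalue_set :: "(real^'n^'n) set \<Rightarrow> (real^'n) set" where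
  "eigenvalue_set U = {l. \<exists>M\<in>U. eigenvalue_vector M l}"

definition sigma :: "nat \<Rightarrow> real^'n \<Rightarrow> real" where
  "sigma k l = (\<Sum>I | I \<subseteq> UNIV \<and> card I = k. \<Prod>i\<in>I. l $ i)"

definition positive_cone :: "(real^'n) set" where
  "positive_cone = {l. \<forall>i. 0 < l $ i}"

text \<open>
  The component is taken at the point \<open>(1,\<dots>,1)\<close>; by \<open>Gamma_cone_component\<close> below, for
  \<open>k \<le> n\<close> this is the connected component that contains the positive cone.
\<close>
definition Gamma_cone :: "nat \<Rightarrow> (real^'n) set" where
  "Gamma_cone k = connected_component_set {l. 0 < sigma k l} (\<chi> i. 1)"

lemma sigma_pos:
  fixes l :: "real^'n"
  assumes "k \<le> CARD('n)" and "l \<in> positive_cone"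
  shows "0 < sigma k l"
proof -
  obtain I :: "'n set" where "card I = k"
    using obtain_subset_with_card_n[OF assms(1)] by blast
  then have "{I :: 'n set. I \<subseteq> UNIV \<and> card I = k} \<noteq> {}"
    by auto
  then show ?thesis
    unfolding sigma_def using assms(2)
    by (intro sum_pos prod_pos) (auto simp: positive_cone_def)
qed

lemma convex_combination_pos: "0 < x \<Longrightarrow> 0 < y \<Longrightarrow> 0 \<le> u \<Longrightarrow> u \<le> 1 \<Longrightarrow> 0 < (1 - u) * x + u * (y::real)"
  by (cases "u = 0") (auto intro: add_nonneg_pos)

lemma Gamma_cone_component:
  assumes "k \<le> CARD('n)"
  shows "Gamma_cone k \<in> components {l :: real^'n. 0 < sigma k l}"
    and "(positive_cone :: (real^'n) set) \<subseteq> Gamma_cone k"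
proof -
  have one: "(\<chi> i. 1) \<in> (positive_cone :: (real^'n) set)"
    by (simp add: positive_cone_def)
  show "Gamma_cone k \<in> components {l :: real^'n. 0 < sigma k l}"
    unfolding Gamma_cone_def using sigma_pos[OF assms one] by (auto intro: componentsI)
  have "convex (positive_cone :: (real^'n) set)"
    unfolding convex_alt positive_cone_def
    by (auto intro!: convex_combination_pos)
  then show "(positive_cone :: (real^'n) set) \<subseteq> Gamma_cone k"
    unfolding Gamma_cone_def using one sigma_pos[OF assms]
    by (intro connected_component_maximal convex_connected) auto
qed

text \<open>
  \<open>f\<close> is of class \<open>C\<^sup>k\<close> on \<open>U\<close>, where \<open>U\<close> is a relatively open subset of the linear subspace \<open>W\<close>.
  Only derivatives in directions of \<open>W\<close> are used, and these are determined by the values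
  of \<open>f\<close> on \<open>U\<close>.
\<close>
primrec Ck_on :: "nat \<Rightarrow> 'a::real_normed_vector set \<Rightarrow> 'a set \<Rightarrow> ('a \<Rightarrow> real) \<Rightarrow> bool" where
  "Ck_on 0 W U f \<longleftrightarrow> continuous_on U f"
| "Ck_on (Suc k) W U f \<longleftrightarrow>
     (\<forall>x\<in>U. f differentiable (at x within U)) \<and>
     (\<forall>v\<in>W. Ck_on k W U (\<lambda>x. frechet_derivative f (at x within U) v))"

definition locally_concave_on :: "'a::real_normed_vector set \<Rightarrow> 'a set \<Rightarrow> ('a \<Rightarrow> real) \<Rightarrow> bool" where
  "locally_concave_on W U f \<longleftrightarrow>
     (\<forall>x\<in>U. \<exists>V. openin (top_of_set W) V \<and> x \<in> V \<and> V \<subseteq> U \<and> concave_on V f)"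

text \<open>
  The matrix \<open>(\<partial>F/\<partial>M\<^sub>i\<^sub>j)\<close> of a function of a symmetric matrix. The convention is the one under which
  \<open>dF(M)[N] = \<Sum>\<^sub>i\<^sub>j F\<^sub>i\<^sub>j(M) N\<^sub>i\<^sub>j\<close> for symmetric \<open>N\<close> and \<open>(F\<^sub>i\<^sub>j)\<close> is symmetric
  (see \<open>matrix_deriv_expansion\<close>), i.e. \<open>F\<^sub>i\<^sub>j\<close> is the derivative in the direction
  \<open>(E\<^sub>i\<^sub>j + E\<^sub>j\<^sub>i)/2\<close>, where \<open>E\<^sub>i\<^sub>j = axis i (axis j 1)\<close>.
\<close>
definition matrix_deriv ::
  "(real^'n^'n) set \<Rightarrow> (real^'n^'n \<Rightarrow> real) \<Rightarrow> real^'n^'n \<Rightarrow> real^'n^'n" where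
  "matrix_deriv U F M = (\<chi> i j. frechet_derivative F (at M within U)
     ((1/2) *\<^sub>R (axis i (axis j 1) + axis j (axis i 1))))"

lemma matrix_deriv_sym: "matrix_deriv U F M \<in> sym_mats"
  by (simp add: matrix_deriv_def sym_mats_def transpose_def add.commute)

lemma has_derivative_unique_on_sym_mats:
  fixes F :: "real^'n^'n \<Rightarrow> real"
  assumes "openin (top_of_set sym_mats) U" and "M \<in> U" and "N \<in> sym_mats"
    and D: "(F has_derivative D) (at M within U)" "(F has_derivative D') (at M within U)"
  shows "D N = D' N"
proof -
  obtain T where T: "open T" "U = sym_mats \<inter> T"
    using assms(1) by (auto simp: openin_open)
  define S where "S = {t::real. M + t *\<^sub>R N \<in> T}"
  have "S = (\<lambda>t. M + t *\<^sub>R N) -` T" by (auto simp: S_def)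
  then have S: "open S" "0 \<in> S"
    using T assms(2) by (auto intro!: open_vimage continuous_intros)
  have sub: "(\<lambda>t. M + t *\<^sub>R N) ` S \<subseteq> U"
    using T assms(2,3) by (auto simp: S_def sym_mats_def transpose_def vec_eq_iff)
  have *: "((\<lambda>t. F (M + t *\<^sub>R N)) has_derivative (\<lambda>t. E (t *\<^sub>R N))) (at 0)"
    if "(F has_derivative E) (at M within U)" for E
  proof -
    have "((\<lambda>t. M + t *\<^sub>R N) has_derivative (\<lambda>t. t *\<^sub>R N)) (at 0 within S)"
      by (auto intro!: derivative_eq_intros)
    moreover have "(F has_derivative E) (at (M + 0 *\<^sub>R N) within (\<lambda>t. M + t *\<^sub>R N) ` S)"
      using has_derivative_subset[OF that sub] by simp
    ultimately show ?thesis
      using has_derivative_in_compose[of "\<lambda>t. M + t *\<^sub>R N" _ 0 S F E] at_within_open[OF S(2,1)]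
      by simp
  qed
  have "(\<lambda>t. D (t *\<^sub>R N)) = (\<lambda>t. D' (t *\<^sub>R N))"
    using has_derivative_unique[OF *[OF D(1)] *[OF D(2)]] .
  from fun_cong[OF this, of 1] show ?thesis by simp
qed

lemma matrix_deriv_expansion:
  fixes F :: "real^'n^'n \<Rightarrow> real"
  assumes "openin (top_of_set sym_mats) U" and "M \<in> U" and N: "N \<in> sym_mats"
    and D: "(F has_derivative D) (at M within U)"
  shows "D N = (\<Sum>i\<in>UNIV. \<Sum>j\<in>UNIV. matrix_deriv U F M $ i $ j * N $ i $ j)"
proof -
  let ?E = "\<lambda>i j. (1/2) *\<^sub>R (axis i (axis j 1) + axis j (axis i 1)) :: real^'n^'n"
  have D': "(F has_derivative frechet_derivative F (at M within U)) (at M within U)"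
    using D by (auto simp: differentiable_def simp flip: frechet_derivative_works)
  have E: "?E i j \<in> sym_mats" for i j
    by (auto simp: sym_mats_def transpose_def vec_eq_iff axis_def)
  have m: "matrix_deriv U F M $ i $ j = D (?E i j)" for i j
    using has_derivative_unique_on_sym_mats[OF assms(1,2) E D' D]
    by (simp add: matrix_deriv_def)
  interpret D: linear D using D has_derivative_linear by blast
  have e: "(\<Sum>i\<in>UNIV. \<Sum>j\<in>UNIV. N $ i $ j *\<^sub>R (axis i (axis j 1) :: real^'n^'n)) = N"
  proof -
    have "(\<Sum>i\<in>UNIV. \<Sum>j\<in>UNIV. N $ i $ j * (axis i (axis j 1) :: real^'n^'n) $ a $ b) = N $ a $ b" for a b
    proof -
      have "N $ i $ j * (axis i (axis j 1) :: real^'n^'n) $ a $ b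
          = (if i = a then if j = b then N $ i $ j else 0 else 0)" for i j
        by (simp add: axis_def)
      moreover have "(\<Sum>j\<in>UNIV. if i = a then if j = b then N $ i $ j else 0 else 0)
          = (if i = a then N $ i $ b else 0)" for i
        by (cases "i = a") simp_all
      ultimately show ?thesis by simp
    qed
    then show ?thesis by (simp add: vec_eq_iff)
  qed
  have t: "N $ j $ i = N $ i $ j" for i j
    using N by (simp add: sym_mats_def transpose_def vec_eq_iff)
  have e': "(\<Sum>i\<in>UNIV. \<Sum>j\<in>UNIV. N $ i $ j *\<^sub>R (axis j (axis i 1) :: real^'n^'n)) = N"
    by (subst sum.swap) (simp add: t e)
  have "(\<Sum>i\<in>UNIV. \<Sum>j\<in>UNIV. N $ i $ j *\<^sub>R ?E i j) = (1/2) *\<^sub>R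
      ((\<Sum>i\<in>UNIV. \<Sum>j\<in>UNIV. N $ i $ j *\<^sub>R (axis i (axis j 1) :: real^'n^'n)) +
       (\<Sum>i\<in>UNIV. \<Sum>j\<in>UNIV. N $ i $ j *\<^sub>R (axis j (axis i 1) :: real^'n^'n)))"
    by (simp add: sum.distrib scaleR_right_distrib scaleR_sum_right scaleR_left_commute mult.commute)
  also have "\<dots> = N" unfolding e e' by (simp add: scaleR_2[symmetric])
  finally have "D N = D (\<Sum>i\<in>UNIV. \<Sum>j\<in>UNIV. N $ i $ j *\<^sub>R ?E i j)" by simp
  also have "\<dots> = (\<Sum>i\<in>UNIV. \<Sum>j\<in>UNIV. N $ i $ j * D (?E i j))"
    by (simp only: D.sum D.scaleR real_scaleR_def)
  finally show ?thesis by (simp add: m mult.commute)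
qed

definition partial_deriv :: "'n \<Rightarrow> (real^'n \<Rightarrow> real) \<Rightarrow> real^'n \<Rightarrow> real" where
  "partial_deriv i u x = frechet_derivative u (at x) (axis i 1)"

definition grad :: "(real^'n \<Rightarrow> real) \<Rightarrow> real^'n \<Rightarrow> real^'n" where
  "grad u x = (\<chi> i. partial_deriv i u x)"

definition hess :: "(real^'n \<Rightarrow> real) \<Rightarrow> real^'n \<Rightarrow> real^'n^'n" where
  "hess u x = (\<chi> i j. partial_deriv i (partial_deriv j u) x)"

definition outer :: "real^'n \<Rightarrow> real^'n \<Rightarrow> real^'n^'n" where
  "outer v w = (\<chi> i j. v $ i * w $ j)"

definition conf_hess :: "(real^'n \<Rightarrow> real) \<Rightarrow> real^'n \<Rightarrow> real^'n^'n" where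
  "conf_hess u x = (let n = real CARD('n) in
      (- (2 / (n - 2)) * u x powr (- ((n + 2) / (n - 2)))) *\<^sub>R hess u x
    + (2 * n / (n - 2)\<^sup>2 * u x powr (- (2 * n / (n - 2)))) *\<^sub>R outer (grad u x) (grad u x)
    - (2 / (n - 2)\<^sup>2 * u x powr (- (2 * n / (n - 2))) * (norm (grad u x))\<^sup>2) *\<^sub>R mat 1)"

end

theory Submission
  imports Defs "HOL-Computational_Algebra.Fundamental_Theorem_Algebra"
begin

text \<open>
  Put \<open>v = u powr (- 2 / (n - 2))\<close>. Then \<open>A\<^sup>u = v \<nabla>\<^sup>2v - \<bar>\<nabla>v\<bar>\<^sup>2/2 I\<close>, and the Kelvin transforms
  \<open>v\<^sub>x\<^sub>,\<^sub>\<mu> y = \<bar>y - x\<bar>\<^sup>2/\<mu>\<^sup>2 v (x + \<mu>\<^sup>2 (y - x)/\<bar>y - x\<bar>\<^sup>2)\<close> solve the same equation. For every \<open>x\<close> one has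
  \<open>v \<le> v\<^sub>x\<^sub>,\<^sub>\<mu>\<close> outside the ball of radius \<open>\<mu>\<close> about \<open>x\<close> if \<open>\<mu>\<close> is small; let \<open>\<lambda>(x)\<close> be the largest radius up to which
  this persists. If \<open>\<lambda>(x)\<close> is finite, then the strong maximum principle and Hopf's lemma show that the two functions
  touch at infinity, \<open>limsup v(y)/\<bar>y\<bar>\<^sup>2 = v(x)/\<lambda>(x)\<^sup>2\<close>; otherwise the limit is \<open>0\<close>. If all \<open>\<lambda>(x)\<close> are infinite, then
  \<open>v\<close> is constant and \<open>A\<^sup>u = 0\<close>, which is excluded. Hence all \<open>\<lambda>(x)\<close> are finite, and all \<open>v\<^sub>x\<^sub>,\<^sub>\<lambda>\<^sub>(\<^sub>x\<^sub>)\<close>, inverted to a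
  neighbourhood of the origin, touch there one and the same strictly subharmonic function from above. So their
  gradients at the origin agree, which says that \<open>\<nabla>v(x) - 2 \<beta> x\<close> does not depend on \<open>x\<close>, where \<open>\<beta> = v(x)/\<lambda>(x)\<^sup>2\<close>.
  Thus \<open>v\<close> is a quadratic polynomial. Subharmonicity comes from \<open>\<Gamma>\<^sub>k \<subseteq> \<Gamma>\<^sub>1\<close>, which makes the trace positive on \<open>U\<close>.
\<close>

subsection \<open>Elementary symmetric functions and the cone \<open>Gamma_cone\<close>\<close>

text \<open>The set \<open>U\<close> need not be convex: condition (ii) gives convexity only along
  positive definite directions, so \<open>F\<close> cannot be linearised between two arbitrary
  solutions. Where one solution touches another from above, however, the two matrices differ by a
  positive semidefinite one; the segment between them stays in \<open>U\<close>, \<open>F\<close>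
  increases strictly along it, and so the matrices coincide. Near such a point both matrices lie in
  a small ball of uniform ellipticity, which is enough for Hopf's lemma. Contact at infinity is
  examined after inversion, through \<open>kelvin 0 1 v\<close> near the origin. Nothing is known
  about a limit at the puncture, so touching is expressed by the failure of
  \<open>strict_at_infinity\<close>. If two smooth majorants had the same value but different
  gradients there, subharmonicity would push the function below that value by a fixed amount. The
  spheres can start because \<open>u\<close> is superharmonic: it decays no faster than the
  fundamental solution, which bounds \<open>v\<close> by a multiple of the squared distance.\<close>

definition real_rooted :: "real poly \<Rightarrow> bool" where
  "real_rooted p \<longleftrightarrow> (\<exists>c rs. c \<noteq> 0 \<and> p = smult c (\<Prod>r\<leftarrow>rs. [:-r, 1:]))"

abbreviation cpoly :: "real poly \<Rightarrow> complex poly" where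
  "cpoly \<equiv> map_poly of_real"

lemma cpoly_mult: "cpoly (p * q) = cpoly p * cpoly q"
  by (rule poly_eqI) (simp add: coeff_map_poly coeff_mult)

lemma cpoly_pderiv: "cpoly (pderiv p) = pderiv (cpoly p)"
  by (rule poly_eqI) (simp add: coeff_map_poly coeff_pderiv)

lemma cpoly_lin: "poly (cpoly [:-r, 1:]) z = z - of_real r"
  by (simp add: map_poly_pCons)

lemma cpoly_of_real: "poly (cpoly p) (of_real x) = of_real (poly p x)"
  by (induction p) (simp_all add: map_poly_pCons)

text \<open>Over the complex numbers \<open>p\<close> has a zero, which is real by assumption, so a
  real linear factor splits off; induction on the degree does the rest.\<close>

lemma real_rootedI:
  assumes "p \<noteq> 0" and "\<And>z. poly (cpoly p) z = 0 \<Longrightarrow> Im z = 0"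
  shows "real_rooted p"
  using assms
proof (induction "degree p" arbitrary: p)
  case 0
  then obtain c where "p = [:c:]" by (metis degree_eq_zeroE)
  with 0 show ?case unfolding real_rooted_def
    by (intro exI[of _ c] exI[of _ "[]"]) (auto simp: one_pCons)
next
  case (Suc m)
  have "degree (cpoly p) = Suc m" using Suc(2) by (simp add: degree_map_poly)
  then have "\<not> constant (poly (cpoly p))" by (simp add: constant_degree)
  then obtain z where z: "poly (cpoly p) z = 0"
    using fundamental_theorem_of_algebra by blast
  then have "Im z = 0" using Suc.prems(2) by blast
  then have zr: "z = of_real (Re z)" by (simp add: complex_eq_iff)
  then have "poly p (Re z) = 0" using z cpoly_of_real[of p "Re z"] by simp
  then obtain q where q: "p = [:- Re z, 1:] * q" by (auto simp: poly_eq_0_iff_dvd elim: dvdE)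
  have q0: "q \<noteq> 0" using q Suc.prems(1) by auto
  have "degree p = Suc (degree q)" unfolding q using q0 by (subst degree_mult_eq) auto
  moreover have "Im w = 0" if "poly (cpoly q) w = 0" for w
    using that Suc.prems(2)[of w] by (simp only: q cpoly_mult poly_mult) simp
  ultimately obtain c rs where "c \<noteq> 0" "q = smult c (\<Prod>r\<leftarrow>rs. [:-r, 1:])"
    using Suc(1)[of q] Suc(2) q0 unfolding real_rooted_def by auto
  then show ?case unfolding real_rooted_def
    by (intro exI[of _ c] exI[of _ "Re z # rs"]) (simp add: q)
qed

text \<open>This is the Gauss--Lucas theorem for the upper and the lower half-plane.\<close>

lemma Im_log_deriv:
  assumes "Im z \<noteq> 0"
  defines "P \<equiv> \<lambda>rs. cpoly (\<Prod>r\<leftarrow>rs. [:-r, 1:])"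
  shows "poly (P rs) z \<noteq> 0 \<and> Im (poly (pderiv (P rs)) z / poly (P rs) z) * Im z \<le> 0
     \<and> (rs \<noteq> [] \<longrightarrow> Im (poly (pderiv (P rs)) z / poly (P rs) z) * Im z < 0)"
proof (induction rs)
  case Nil
  then show ?case by (simp add: P_def)
next
  case (Cons r rs)
  have nz: "z - of_real r \<noteq> 0" using assms by (auto simp: complex_eq_iff)
  let ?Q = "poly (P rs) z" and ?Q' = "poly (pderiv (P rs)) z"
  have P: "P (r # rs) = cpoly [:-r, 1:] * P rs" by (simp add: P_def cpoly_mult del: mult_pCons_left)
  have p: "poly (P (r # rs)) z = (z - of_real r) * ?Q"
    unfolding P poly_mult cpoly_lin ..
  have "pderiv (cpoly [:-r, 1:]) = 1" by (simp add: map_poly_pCons pderiv_pCons)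
  then have p': "poly (pderiv (P (r # rs))) z = ?Q + (z - of_real r) * ?Q'"
    unfolding P pderiv_mult poly_add poly_mult cpoly_lin by simp
  \<comment> \<open>The logarithmic derivative is the sum of the \<open>1 / (z - r)\<close> over the
    roots. Each summand has imaginary part of sign opposite to that of \<open>Im z\<close>, so
    nothing can cancel.\<close>
  have e: "poly (pderiv (P (r # rs))) z / poly (P (r # rs)) z = 1 / (z - of_real r) + ?Q' / ?Q"
    unfolding p p' using nz Cons by (simp add: field_simps)
  have "Im (1 / (z - of_real r)) * Im z < 0"
  proof -
    have "Im (1 / (z - of_real r)) = - Im z / (cmod (z - of_real r))\<^sup>2"
      by (simp add: Im_divide cmod_power2)
    then have "Im (1 / (z - of_real r)) * Im z = - (Im z)\<^sup>2 / (cmod (z - of_real r))\<^sup>2"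
      by (simp add: power2_eq_square)
    also have "\<dots> < 0" using assms(1) nz by simp
    finally show ?thesis .
  qed
  then show ?case unfolding e using Cons nz p by (auto simp: distrib_right)
qed

lemma real_rooted_pderiv:
  assumes "real_rooted p" and "degree p \<ge> 1"
  shows "real_rooted (pderiv p)"
proof (rule real_rootedI)
  show "pderiv p \<noteq> 0" using assms(2) by (simp add: pderiv_eq_0_iff)
  fix z assume z: "poly (cpoly (pderiv p)) z = 0"
  obtain c rs where c: "c \<noteq> 0" "p = smult c (\<Prod>r\<leftarrow>rs. [:-r, 1:])"
    using assms(1) unfolding real_rooted_def by blast
  have "rs \<noteq> []" using assms(2) c by auto
  have "cpoly p = smult (of_real c) (cpoly (\<Prod>r\<leftarrow>rs. [:-r, 1:]))"
    unfolding c by (rule poly_eqI) (simp add: coeff_map_poly)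
  then have "poly (pderiv (cpoly (\<Prod>r\<leftarrow>rs. [:-r, 1:]))) z = 0"
    using z c(1) by (simp add: cpoly_pderiv pderiv_smult)
  then show "Im z = 0" using Im_log_deriv[of z rs] \<open>rs \<noteq> []\<close> by auto
qed

text \<open>Away from the roots, \<open>P'\<^sup>2 - P P''\<close> equals \<open>P\<^sup>2\<close>
  times the sum of the \<open>1 / (x - r)\<^sup>2\<close>. It is evaluated at 0 because the
  derivatives there are coefficients up to factorials.\<close>

lemma log_concave_at_0:
  fixes rs :: "real list"
  defines "P \<equiv> \<lambda>rs. (\<Prod>r\<leftarrow>rs. [:-r, 1:])"
  assumes "poly (P rs) 0 \<noteq> 0"
  shows "(poly (pderiv (P rs)) 0)\<^sup>2 \<ge> poly (P rs) 0 * poly (pderiv (pderiv (P rs))) 0 \<and>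
    (rs \<noteq> [] \<longrightarrow> (poly (pderiv (P rs)) 0)\<^sup>2 > poly (P rs) 0 * poly (pderiv (pderiv (P rs))) 0)"
  using assms(2)
proof (induction rs)
  case Nil
  then show ?case by (simp add: P_def)
next
  case (Cons r rs)
  have P: "P (r # rs) = [:-r, 1:] * P rs" by (simp add: P_def)
  let ?a = "poly (P rs) 0" and ?b = "poly (pderiv (P rs)) 0" and ?c = "poly (pderiv (pderiv (P rs))) 0"
  have 1: "poly (P (r # rs)) 0 = - r * ?a" unfolding P poly_mult by simp
  have 2: "poly (pderiv (P (r # rs))) 0 = ?a - r * ?b"
    unfolding P pderiv_mult by (simp add: pderiv_pCons)
  have 3: "poly (pderiv (pderiv (P (r # rs)))) 0 = 2 * ?b - r * ?c"
    unfolding P pderiv_mult pderiv_add by (simp add: pderiv_pCons)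
  have nz: "?a \<noteq> 0" using Cons.prems 1 by auto
  have "(?a - r * ?b)\<^sup>2 - (- r * ?a) * (2 * ?b - r * ?c) = ?a\<^sup>2 + r\<^sup>2 * (?b\<^sup>2 - ?a * ?c)"
    by (simp add: power2_eq_square algebra_simps)
  moreover have "?a\<^sup>2 > 0" using nz by simp
  moreover have "r\<^sup>2 * (?b\<^sup>2 - ?a * ?c) \<ge> 0" using Cons.IH nz by simp
  ultimately show ?case unfolding 1 2 3 by (smt (verit))
qed

text \<open>Vieta's formulas for the monic polynomial with roots \<open>- l $ i\<close>; this choice
  of roots removes the alternating signs.\<close>

lemma coeff_prod_sigma:
  fixes l :: "real^'n"
  assumes "j \<le> CARD('n)"
  shows "coeff (\<Prod>i\<in>UNIV. [:l $ i, 1:]) (CARD('n) - j) = sigma j l"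
proof -
  have "(\<Prod>i\<in>UNIV. [:l $ i, 1:]) = (\<Prod>i\<in>UNIV. [:l $ i:] + [:0, 1:])" by simp
  also have "\<dots> = (\<Sum>X\<in>Pow UNIV. (\<Prod>i\<in>X. [:l $ i:]) * (\<Prod>i\<in>UNIV-X. [:0, 1:]))"
    by (rule prod_add) simp
  also have "\<dots> = (\<Sum>X\<in>UNIV. monom (\<Prod>i\<in>X. l $ i) (CARD('n) - card X))"
  proof (rule sum.cong)
    fix X :: "'n set"
    have "(\<Prod>i\<in>X. [:l $ i:]) = [:\<Prod>i\<in>X. l $ i:]"
      by (induction X rule: infinite_finite_induct) (simp_all add: one_pCons)
    moreover have "(\<Prod>i\<in>UNIV-X. [:0, 1:]) = monom (1::real) (CARD('n) - card X)"
      by (simp add: card_Diff_subset monom_altdef)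
    ultimately show "(\<Prod>i\<in>X. [:l $ i:]) * (\<Prod>i\<in>UNIV-X. [:0, 1:]) = monom (\<Prod>i\<in>X. l $ i) (CARD('n) - card X)"
      by (simp add: smult_monom)
  qed simp
  finally have "coeff (\<Prod>i\<in>UNIV. [:l $ i, 1:]) (CARD('n) - j)
      = (\<Sum>X\<in>UNIV. if CARD('n) - card X = CARD('n) - j then \<Prod>i\<in>X. l $ i else 0)"
    by (simp add: coeff_sum if_distrib cong: if_cong)
  also have "\<dots> = (\<Sum>X\<in>UNIV. if card X = j then \<Prod>i\<in>X. l $ i else 0)"
  proof (rule sum.cong)
    fix X :: "'n set"
    \<comment> \<open>Neither \<open>card X\<close> nor \<open>j\<close> exceeds
      \<open>CARD('n)\<close>, so the truncated subtractions can be compared.\<close>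
    have "card X \<le> CARD('n)" by (simp add: card_mono)
    then show "(if CARD('n) - card X = CARD('n) - j then \<Prod>i\<in>X. l $ i else 0) = (if card X = j then \<Prod>i\<in>X. l $ i else 0)"
      using assms by auto
  qed simp
  also have "\<dots> = sigma j l" unfolding sigma_def
    by (subst sum.inter_filter[symmetric]) simp_all
  finally show ?thesis .
qed

text \<open>The case of Newton's inequality with vanishing middle term. Differentiating the product
  of the \<open>X + l $ i\<close> exactly \<open>m\<close> times keeps it real-rooted and leaves
  degree \<open>j + 1\<close>, with lowest coefficients positive multiples of
  \<open>sigma (j + 1) l\<close>, \<open>sigma j l\<close> and \<open>sigma (j - 1) l\<close>.
  Strict log-concavity at 0 then gives the sign.\<close>

lemma newton_zero:
  fixes l :: "real^'n"
  assumes "1 \<le> j" "j + 1 \<le> CARD('n)" "sigma j l = 0" "sigma (j + 1) l \<noteq> 0"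
  shows "sigma (j - 1) l * sigma (j + 1) l < 0"
proof -
  let ?P = "\<Prod>i\<in>UNIV. [:l $ i, 1:]"
  define m where "m = CARD('n) - (j + 1)"
  define q where "q = (pderiv ^^ m) ?P"
  obtain xs :: "'n list" where xs: "set xs = UNIV" "distinct xs"
    using finite_distinct_list[of "UNIV :: 'n set"] by auto
  have "?P = (\<Prod>i\<leftarrow>xs. [:l $ i, 1:])"
    using xs prod.distinct_set_conv_list[of xs "\<lambda>i. [:l $ i, 1:]"] by simp
  then have "real_rooted ?P" unfolding real_rooted_def
    by (intro exI[of _ 1] exI[of _ "map (\<lambda>i. - l $ i) xs"]) (simp add: comp_def)
  have deg: "degree ?P = CARD('n)"
    by (subst degree_prod_eq_sum_degree) auto
  have "real_rooted ((pderiv ^^ k) ?P)" if "k \<le> CARD('n)" for k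
    using that
  proof (induction k)
    case (Suc k)
    have "degree ((pderiv ^^ k) ?P) = CARD('n) - k" by (simp add: degree_higher_pderiv deg)
    then show ?case using Suc by (auto intro!: real_rooted_pderiv)
  qed (use \<open>real_rooted ?P\<close> in simp)
  then have "real_rooted q" unfolding q_def m_def by simp
  then obtain c rs where c: "c \<noteq> 0" "q = smult c (\<Prod>r\<leftarrow>rs. [:-r, 1:])"
    unfolding real_rooted_def by blast
  have "degree q = j + 1" unfolding q_def using assms by (simp add: degree_higher_pderiv deg m_def)
  then have "rs \<noteq> []" using c by auto
  let ?R = "\<Prod>r\<leftarrow>rs. [:-r, 1:]"
  have co: "coeff q i = pochhammer (of_nat (Suc i)) m * coeff ?P (i + m)" for i
    unfolding q_def by (rule coeff_higher_pderiv)
  have poch: "pochhammer (of_nat (Suc i)) m > (0::real)" for i by (intro pochhammer_pos) simp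
  have m1: "CARD('n) - j = Suc m" and m2: "CARD('n) - (j - 1) = Suc (Suc m)"
    using assms(1,2) by (simp_all add: m_def)
  have s: "coeff ?P m = sigma (j+1) l" "coeff ?P (Suc m) = sigma j l" "coeff ?P (Suc (Suc m)) = sigma (j - 1) l"
    using coeff_prod_sigma[of "j+1" l] coeff_prod_sigma[of j l] coeff_prod_sigma[of "j-1" l] assms(1,2)
      m1 m2 by (simp_all add: m_def)
  have q0: "poly q 0 = pochhammer 1 m * sigma (j+1) l" using co[of 0] s by (simp add: poly_0_coeff_0)
  have q1: "poly (pderiv q) 0 = 0" using co[of 1] s assms by (simp add: poly_0_coeff_0 coeff_pderiv)
  have q2: "poly (pderiv (pderiv q)) 0 = 2 * pochhammer 3 m * sigma (j-1) l"
    using co[of 2] s by (simp add: poly_0_coeff_0 coeff_pderiv numeral_2_eq_2 numeral_3_eq_3)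
  have "poly q 0 \<noteq> 0" unfolding q0 using poch[of 0] assms by simp
  then have "(poly (pderiv ?R) 0)\<^sup>2 > poly ?R 0 * poly (pderiv (pderiv ?R)) 0"
    using log_concave_at_0[of rs] c \<open>rs \<noteq> []\<close> by simp
  moreover have "poly (pderiv ?R) 0 = 0" using q1 c by (simp add: pderiv_smult)
  ultimately have "poly ?R 0 * poly (pderiv (pderiv ?R)) 0 < 0" by simp
  then have "c\<^sup>2 * (poly ?R 0 * poly (pderiv (pderiv ?R)) 0) < 0" using c(1) by (simp add: mult_pos_neg)
  then have "poly q 0 * poly (pderiv (pderiv q)) 0 < 0"
    by (simp add: c pderiv_smult power2_eq_square mult_ac)
  then have "(pochhammer 1 m * pochhammer 3 m * 2) * (sigma (j - 1) l * sigma (j + 1) l) < 0"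
    unfolding q0 q2 by (simp add: mult_ac)
  moreover have "(pochhammer 1 m * pochhammer 3 m * 2) > (0::real)"
    using poch[of 0] poch[of 2] by simp
  ultimately show ?thesis by (metis mult_less_cancel_left_pos mult_zero_right)
qed

section \<open>Positivity of the lower symmetric functions on the component\<close>

lemma continuous_sigma: "continuous_on S (sigma k)"
  unfolding sigma_def[abs_def] by (intro continuous_intros)

lemma sigma_0: "sigma 0 l = 1"
proof -
  have "{I. I \<subseteq> UNIV \<and> card I = 0} = {{} :: 'a set}" by auto
  then show ?thesis unfolding sigma_def by simp
qed

lemma sigma_1: "sigma 1 l = (\<Sum>i\<in>UNIV. l $ i)"
proof -
  have "{I. I \<subseteq> UNIV \<and> card I = 1} = (\<lambda>i. {i}) ` (UNIV :: 'a set)" by (auto simp: card_1_singleton_iff)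
  then show ?thesis unfolding sigma_def by (simp add: sum.reindex)
qed

text \<open>Downward induction from \<open>k\<close>: if \<open>sigma i l\<close> vanished while
  \<open>sigma (i + 1) l\<close> is positive, \<open>newton_zero\<close> would make
  \<open>sigma (i - 1) l\<close> negative. The index 0 is separate, since \<open>sigma 0\<close> is
  1.\<close>

lemma sigma_nonneg_imp_pos:
  fixes l :: "real^'n"
  assumes "k \<le> CARD('n)" "\<And>j. j \<le> k \<Longrightarrow> sigma j l \<ge> 0" "sigma k l > 0" "j \<le> k"
  shows "sigma j l > 0"
  using assms(4)
proof (induction rule: inc_induct)
  case base
  then show ?case by fact
next
  case (step i)
  show ?case
  proof (cases "i = 0")
    case True
    then show ?thesis by (simp add: sigma_0)
  next
    case False
    have "sigma i l \<noteq> 0"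
    proof
      assume "sigma i l = 0"
      then have "sigma (i - 1) l * sigma (i + 1) l < 0"
        using newton_zero[of i l] step False assms(1) by auto
      moreover have "sigma (i - 1) l \<ge> 0" using assms(2) step by simp
      ultimately show False using step by (auto simp: mult_less_0_iff)
    qed
    then show ?thesis using assms(2)[of i] step by linarith
  qed
qed

text \<open>The component is cut out by \<open>sigma k\<close> alone. Inside it, positivity of all
  lower \<open>sigma j\<close> is equivalent to their nonnegativity, so this condition is both open
  and closed; it holds at the vector of ones, hence on the whole connected set.\<close>

lemma Gamma_cone_sigma_pos:
  fixes l :: "real^'n"
  assumes "k \<le> CARD('n)" "j \<le> k" "l \<in> Gamma_cone k"
  shows "sigma j l > 0"
proof -
  let ?C = "Gamma_cone k :: (real^'n) set"
  define T where "T = ?C \<inter> (\<Inter>j\<in>{..k}. {l. sigma j l > 0})"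
  have pos: "sigma k l > 0" if "l \<in> ?C" for l
    using that connected_component_subset unfolding Gamma_cone_def by fastforce
  have "l \<in> (\<Inter>j\<in>{..k}. {l. sigma j l > 0}) \<longleftrightarrow> l \<in> (\<Inter>j\<in>{..k}. {l. sigma j l \<ge> 0})" if "l \<in> ?C" for l
  proof
    assume "l \<in> (\<Inter>j\<in>{..k}. {l. sigma j l \<ge> 0})"
    then have "sigma j l > 0" if "j \<le> k" for j
      by (intro sigma_nonneg_imp_pos[OF assms(1) _ pos[OF \<open>l \<in> ?C\<close>] that]) auto
    then show "l \<in> (\<Inter>j\<in>{..k}. {l. sigma j l > 0})" by simp
  qed (auto intro: less_imp_le)
  then have "T = ?C \<inter> (\<Inter>j\<in>{..k}. {l. sigma j l \<ge> 0})" unfolding T_def by blast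
  moreover have "closed (\<Inter>j\<in>{..k}. {l :: real^'n. sigma j l \<ge> 0})"
    by (intro closed_INT ballI closed_Collect_le continuous_sigma continuous_intros)
  ultimately have "closedin (top_of_set ?C) T" by (auto simp: closedin_closed)
  moreover have "open (\<Inter>j\<in>{..k}. {l :: real^'n. sigma j l > 0})"
    by (intro open_INT ballI open_Collect_less continuous_sigma continuous_intros) auto
  then have "openin (top_of_set ?C) T" unfolding T_def by (auto simp: openin_open)
  moreover have "connected ?C" unfolding Gamma_cone_def by simp
  moreover have "(\<chi> i. 1) \<in> T"
  proof -
    have "(\<chi> i. 1) \<in> (positive_cone :: (real^'n) set)" by (simp add: positive_cone_def)
    then show ?thesis unfolding T_def
      using sigma_pos Gamma_cone_component(2)[OF assms(1)] assms(1) by (auto intro: order_trans)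
  qed
  ultimately have "T = ?C" unfolding connected_clopen by blast
  then show ?thesis using assms unfolding T_def by auto
qed

subsection \<open>Symmetric matrices\<close>

lemma outer_mult_vector: "outer p q *v x = (q \<bullet> x) *\<^sub>R p"
  by (simp add: vec_eq_iff outer_def matrix_vector_mult_def inner_vec_def sum_distrib_left mult_ac)

lemma inner_outer: "A \<bullet> outer p q = p \<bullet> (A *v q)"
  by (simp add: outer_def matrix_vector_mult_def inner_vec_def sum_distrib_left mult_ac)

lemma trace_outer: "trace (outer p q) = p \<bullet> q"
  by (simp add: trace_def outer_def inner_vec_def)

lemma trace_scaleR: "trace (c *\<^sub>R A) = c * trace A"
  by (simp add: trace_def sum_distrib_left)

lemma trace_mat_1: "trace (mat 1 :: real^'n^'n) = real CARD('n)"
  by (simp add: trace_def mat_def)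

lemma sym_mats_inner: "M \<in> sym_mats \<Longrightarrow> x \<bullet> (M *v y) = (M *v x) \<bullet> y"
  by (metis (mono_tags, lifting) dot_lmul_matrix mem_Collect_eq sym_mats_def transpose_matrix_vector)

text \<open>The linear term dominates for small \<open>t\<close>; the single value
  \<open>t = b / d\<close>, with a positive bound \<open>d\<close> of \<open>c\<close>, already
  shows this.\<close>

lemma linear_le_quadratic:
  fixes b c :: real
  assumes "\<And>t. 2 * t * b \<le> t\<^sup>2 * c"
  shows "b = 0"
proof -
  define d where "d = \<bar>c\<bar> + 1"
  have d: "d > 0" "c \<le> d" unfolding d_def by linarith+
  have "2 * (b / d) * b \<le> (b / d)\<^sup>2 * c" by (rule assms)
  also have "\<dots> \<le> (b / d)\<^sup>2 * d" using d by (intro mult_left_mono) auto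
  also have "\<dots> = (b / d) * b" using d by (simp add: power2_eq_square)
  finally have "b * b / d \<le> 0" by simp
  then show ?thesis using d by (auto simp: divide_le_0_iff mult_le_0_iff)
qed

text \<open>A maximiser of the quadratic form on the unit sphere of \<open>S\<close> is an
  eigenvector, and its orthogonal complement in \<open>S\<close> is again invariant by symmetry of
  \<open>M\<close>. Admitting every invariant \<open>S\<close> makes the induction on the dimension
  possible.\<close>

lemma symmetric_invariant_eigenbasis:
  fixes M :: "real^'n^'n"
  assumes M: "M \<in> sym_mats"
  shows "subspace S \<Longrightarrow> (\<And>x. x \<in> S \<Longrightarrow> M *v x \<in> S) \<Longrightarrow>
    \<exists>B. finite B \<and> B \<subseteq> S \<and> card B = dim S \<and> pairwise orthogonal B \<and> (\<forall>b\<in>B. norm b = 1 \<and> (\<exists>c. M *v b = c *\<^sub>R b))"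
proof (induction "dim S" arbitrary: S)
  case 0
  then show ?case by (intro exI[of _ "{}"]) auto
next
  case (Suc m)
  have "S \<noteq> {0}" using Suc(2) by auto
  then obtain s where s: "s \<in> S" "s \<noteq> 0" using Suc.prems(1) subspace_0 by blast
  let ?K = "S \<inter> sphere 0 1"
  have "(1 / norm s) *\<^sub>R s \<in> ?K" using s Suc.prems(1) by (simp add: subspace_scale)
  then have ne: "?K \<noteq> {}" by blast
  have co: "compact ?K" using Suc.prems(1) by (intro closed_Int_compact closed_subspace) auto
  have "continuous_on ?K (\<lambda>x. x \<bullet> (M *v x))"
    by (intro continuous_intros matrix_vector_mult_linear_continuous_on)
  from continuous_attains_sup[OF co ne this]
  obtain x where x: "x \<in> ?K" and mx: "\<And>y. y \<in> ?K \<Longrightarrow> y \<bullet> (M *v y) \<le> x \<bullet> (M *v x)"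
    by blast
  define mu where "mu = x \<bullet> (M *v x)"
  have x1: "x \<bullet> x = 1" using x by (simp add: dot_square_norm)
  have xS: "x \<in> S" using x by simp
  have le: "y \<bullet> (M *v y) \<le> mu * (y \<bullet> y)" if "y \<in> S" for y
  proof (cases "y = 0")
    case False
    have "(1 / norm y) *\<^sub>R y \<in> ?K" using False that Suc.prems(1) by (simp add: subspace_scale)
    from mx[OF this] have "(1 / norm y)\<^sup>2 * (y \<bullet> (M *v y)) \<le> mu"
      by (simp add: mu_def matrix_vector_mult_scaleR power2_eq_square mult_ac)
    then show ?thesis using False by (simp add: dot_square_norm field_simps)
  qed simp
  \<comment> \<open>First-order condition at the maximiser: along \<open>x + t *\<^sub>R y\<close>
    the term linear in \<open>t\<close> has to vanish.\<close>
  have orth: "y \<bullet> (M *v x - mu *\<^sub>R x) = 0" if "y \<in> S" for y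
  proof (rule ccontr)
    let ?b = "y \<bullet> (M *v x - mu *\<^sub>R x)"
    let ?c = "mu * (y \<bullet> y) - y \<bullet> (M *v y)"
    assume nz: "?b \<noteq> 0"
    have "2 * t * ?b \<le> t\<^sup>2 * ?c" for t
    proof -
      have "x + t *\<^sub>R y \<in> S" using xS that Suc.prems(1) by (simp add: subspace_add subspace_scale)
      from le[OF this] show ?thesis using x1 sym_mats_inner[OF M, of x y]
        by (simp add: matrix_vector_right_distrib matrix_vector_mult_scaleR inner_add_left inner_add_right
            inner_diff_right mu_def[symmetric] algebra_simps power2_eq_square inner_commute)
    qed
    then show False using linear_le_quadratic nz by blast
  qed
  have "M *v x - mu *\<^sub>R x \<in> S" using xS Suc.prems by (simp add: subspace_diff subspace_scale)
  from orth[OF this] have ev: "M *v x = mu *\<^sub>R x" by simp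
  define T where "T = {y \<in> S. \<forall>z \<in> span {x}. orthogonal z y}"
  have T: "T = {y \<in> S. x \<bullet> y = 0}"
    unfolding T_def by (auto simp: span_singleton orthogonal_def)
  have "dim T + dim (span {x}) = dim S" unfolding T_def
    using xS Suc.prems(1) span_minimal[of "{x}" S]
    by (intro dim_subspace_orthogonal_to_vectors) auto
  moreover have "dim (span {x}) = 1" using x1 by (subst dim_span) (auto simp: dim_singleton)
  ultimately have dT: "dim T = m" using Suc(2) by simp
  have "subspace T" unfolding T
    using Suc.prems(1) by (auto simp: subspace_def inner_add_right)
  moreover have "M *v y \<in> T" if "y \<in> T" for y
    using that Suc.prems(2) sym_mats_inner[OF M, of x y] ev by (auto simp: T)
  ultimately obtain B where B: "finite B" "B \<subseteq> T" "card B = dim T" "pairwise orthogonal B"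
      "\<forall>b\<in>B. norm b = 1 \<and> (\<exists>c. M *v b = c *\<^sub>R b)"
    using Suc(1)[of T] dT by auto
  have xB: "x \<notin> B" using B(2) x1 by (auto simp: T)
  show ?case
  proof (intro exI[of _ "insert x B"] conjI)
    show "card (insert x B) = dim S" using B xB dT Suc(2) by simp
    show "pairwise orthogonal (insert x B)"
      using B(2,4) by (auto simp: pairwise_insert T orthogonal_def inner_commute)
    show "\<forall>b\<in>insert x B. norm b = 1 \<and> (\<exists>c. M *v b = c *\<^sub>R b)"
      using B(5) x ev by auto
  qed (use B xS T in auto)
qed

lemma spectral_theorem:
  fixes M :: "real^'n^'n"
  assumes M: "M \<in> sym_mats"
  obtains Q :: "real^'n^'n" and d :: "real^'n"
  where "orthogonal_matrix Q" and "M = transpose Q ** (\<chi> i j. if i = j then d $ i else 0) ** Q"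
proof -
  obtain B :: "(real^'n) set" where B: "finite B" "card B = CARD('n)" "pairwise orthogonal B"
      "\<And>b. b \<in> B \<Longrightarrow> norm b = 1 \<and> (\<exists>c. M *v b = c *\<^sub>R b)"
    using symmetric_invariant_eigenbasis[OF M, of UNIV] by (auto simp: subspace_UNIV)
  obtain q where q: "bij_betw q (UNIV :: 'n set) B"
    using B finite_same_card_bij[of "UNIV :: 'n set" B] by auto
  then have qB: "q i \<in> B" for i by (auto simp: bij_betw_def)
  obtain d where d: "\<And>i. M *v q i = d i *\<^sub>R q i" using B(4)[OF qB] by metis
  define Q :: "real^'n^'n" where "Q = (\<chi> i. q i)"
  have row: "row i Q = q i" for i by (simp add: Q_def row_def vec_lambda_eta)
  have "orthogonal (q i) (q j)" if "i \<noteq> j" for i j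
    using pairwiseD[OF B(3) qB qB] q that by (auto simp: bij_betw_def inj_eq)
  then have Q: "orthogonal_matrix Q"
    unfolding orthogonal_matrix_orthonormal_rows row using B(4)[OF qB] by auto
  let ?D = "(\<chi> i j. if i = j then (\<chi> i. d i) $ i else 0) :: real^'n^'n"
  have "M ** transpose Q = transpose Q ** ?D"
  proof -
    have "(M ** transpose Q) $ a $ b = (transpose Q ** ?D) $ a $ b" for a b
    proof -
      have "(M ** transpose Q) $ a $ b = (M *v q b) $ a"
        by (simp add: matrix_matrix_mult_def matrix_vector_mult_def transpose_def Q_def)
      also have "\<dots> = (transpose Q ** ?D) $ a $ b"
        by (simp add: d matrix_matrix_mult_def transpose_def Q_def if_distrib mult.commute cong: if_cong)
      finally show ?thesis .
    qed
    then show ?thesis by (simp add: vec_eq_iff)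
  qed
  then have "M ** (transpose Q ** Q) = transpose Q ** ?D ** Q" by (simp add: matrix_mul_assoc)
  then have "M = transpose Q ** ?D ** Q" using Q by (simp add: orthogonal_matrix_def)
  with Q show ?thesis using that by blast
qed

lemma spectral_outer:
  fixes M :: "real^'n^'n"
  assumes M: "M \<in> sym_mats"
  obtains q :: "'n \<Rightarrow> real^'n" and d where "\<And>i j. q i \<bullet> q j = (if i = j then 1 else 0)"
    and "M = (\<Sum>i\<in>UNIV. d i *\<^sub>R outer (q i) (q i))" and "\<And>i. M *v q i = d i *\<^sub>R q i"
proof -
  obtain Q :: "real^'n^'n" and d where Q: "orthogonal_matrix Q"
    and MQ: "M = transpose Q ** (\<chi> i j. if i = j then d $ i else 0) ** Q"
    using spectral_theorem[OF M] by blast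
  have r: "row i Q = Q $ i" for i by (simp add: row_def vec_lambda_eta)
  have on: "Q $ i \<bullet> Q $ j = (if i = j then 1 else 0)" for i j
    using Q unfolding orthogonal_matrix_orthonormal_rows r by (auto simp: orthogonal_def dot_square_norm)
  have "M $ a $ b = (\<Sum>i\<in>UNIV. d $ i *\<^sub>R outer (Q $ i) (Q $ i)) $ a $ b" for a b
  proof -
    have "(\<Sum>k\<in>UNIV. Q $ k $ a * (if k = j then d $ k else 0)) = Q $ j $ a * d $ j" for j
      by (simp add: if_distrib cong: if_cong)
    then have "M $ a $ b = (\<Sum>k\<in>UNIV. Q $ k $ a * d $ k * Q $ k $ b)"
      unfolding MQ matrix_matrix_mult_def transpose_def by simp
    also have "\<dots> = (\<Sum>i\<in>UNIV. d $ i *\<^sub>R outer (Q $ i) (Q $ i)) $ a $ b"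
      by (simp add: outer_def mult_ac)
    finally show ?thesis .
  qed
  then have e: "M = (\<Sum>i\<in>UNIV. d $ i *\<^sub>R outer (Q $ i) (Q $ i))" by (simp add: vec_eq_iff)
  have "M *v (Q $ i) = d $ i *\<^sub>R (Q $ i)" for i
  proof -
    have "(\<Sum>j\<in>A. d $ j *\<^sub>R outer (Q $ j) (Q $ j)) *v x = (\<Sum>j\<in>A. d $ j *\<^sub>R (outer (Q $ j) (Q $ j) *v x))"
      for A :: "'n set" and x
      by (induction A rule: infinite_finite_induct)
        (simp_all add: matrix_vector_mult_add_rdistrib scaleR_matrix_vector_assoc)
    from this[of UNIV "Q $ i", folded e]
    have "M *v (Q $ i) = (\<Sum>j\<in>UNIV. d $ j *\<^sub>R ((Q $ j \<bullet> Q $ i) *\<^sub>R Q $ j))"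
      by (simp only: outer_mult_vector)
    also have "\<dots> = (\<Sum>j\<in>UNIV. if j = i then d $ i *\<^sub>R Q $ i else 0)"
      by (rule sum.cong) (auto simp: on)
    also have "\<dots> = d $ i *\<^sub>R (Q $ i)" by simp
    finally show ?thesis .
  qed
  with on e show ?thesis by (rule that[of "\<lambda>i. Q $ i" "\<lambda>i. d $ i"])
qed

text \<open>In an orthonormal eigenbasis \<open>q\<close> of \<open>N\<close> with eigenvalues
  \<open>d\<close>, the pairing \<open>A \<bullet> N\<close> is the sum of the
  \<open>d i * (q i \<bullet> (A *v q i))\<close>, where the \<open>d i\<close> are nonnegative and
  the other factors positive.\<close>

lemma pos_def_inner_psd:
  fixes A N :: "real^'n^'n"
  assumes A: "A \<in> pos_def_mats" and N: "N \<in> sym_mats" and psd: "\<And>x. 0 \<le> x \<bullet> (N *v x)"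
  shows "0 \<le> A \<bullet> N" and "N \<noteq> 0 \<Longrightarrow> 0 < A \<bullet> N"
proof -
  obtain q :: "'n \<Rightarrow> real^'n" and d where q: "\<And>i j. q i \<bullet> q j = (if i = j then 1 else 0)"
    and e: "N = (\<Sum>i\<in>UNIV. d i *\<^sub>R outer (q i) (q i))" and ev: "\<And>i. N *v q i = d i *\<^sub>R q i"
    using spectral_outer[OF N] by blast
  have d: "d i \<ge> 0" for i using psd[of "q i"] q[of i i] ev[of i] by simp
  have "q i \<noteq> 0" for i using q[of i i] by auto
  then have p: "q i \<bullet> (A *v q i) > 0" for i using A by (simp add: pos_def_mats_def)
  have s: "A \<bullet> N = (\<Sum>i\<in>UNIV. d i * (q i \<bullet> (A *v q i)))"
    unfolding e by (simp add: inner_sum_right inner_outer)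
  show "0 \<le> A \<bullet> N" unfolding s using d p by (intro sum_nonneg mult_nonneg_nonneg) (auto intro: less_imp_le)
  assume "N \<noteq> 0"
  then obtain i where "d i \<noteq> 0" using e by (metis (no_types, lifting) scaleR_eq_0_iff sum.neutral)
  then have "0 < d i * (q i \<bullet> (A *v q i))" using d[of i] p by (simp add: zero_less_mult_iff)
  then show "0 < A \<bullet> N" unfolding s using d p
    by (intro sum_pos2[of _ i]) (auto intro: less_imp_le mult_nonneg_nonneg)
qed

text \<open>Eigenvalue vector and trace are read off from the same diagonalisation, so
  \<open>sigma 1\<close> of the eigenvalues can be replaced by the trace.\<close>

lemma eigenvalue_vector_exists:
  fixes M :: "real^'n^'n"
  assumes M: "M \<in> sym_mats"
  obtains l where "eigenvalue_vector M l" and "trace M = (\<Sum>i\<in>UNIV. l $ i)"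
proof -
  obtain Q :: "real^'n^'n" and d where Q: "orthogonal_matrix Q"
    and MQ: "M = transpose Q ** (\<chi> i j. if i = j then d $ i else 0) ** Q"
    using spectral_theorem[OF M] by blast
  let ?D = "(\<chi> i j. if i = j then d $ i else 0) :: real^'n^'n"
  have QQ: "transpose Q ** Q = mat 1" "Q ** transpose Q = mat 1" using Q by (auto simp: orthogonal_matrix_def)
  have Q1: "transpose Q *v (Q *v x) = x" for x
    by (simp only: matrix_vector_mul_assoc QQ matrix_vector_mul_lid)
  have "eigenvalue_vector M d" unfolding eigenvalue_vector_def
  proof
    fix t
    have eq: "t *\<^sub>R mat 1 - M = transpose Q ** (t *\<^sub>R mat 1 - ?D) ** Q"
      unfolding MQ matrix_eq
      by (simp add: matrix_vector_mul_assoc[symmetric] matrix_vector_mult_diff_rdistrib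
          matrix_vector_mult_diff_distrib scaleR_matrix_vector_assoc[symmetric]
          matrix_vector_mult_scaleR Q1 del: transpose_matrix_vector)
    have 1: "det (transpose Q) * det Q = 1" using QQ(1) by (metis det_I det_mul)
    have "det (t *\<^sub>R mat 1 - M) = det (transpose Q) * det (t *\<^sub>R mat 1 - ?D) * det Q"
      by (rule trans[OF arg_cong[of _ _ det, OF eq]], subst det_mul, subst det_mul, rule refl)
    also have "\<dots> = (det (transpose Q) * det Q) * det (t *\<^sub>R mat 1 - ?D)"
      by (subst mult.assoc, subst mult.commute[of _ "det Q"], subst mult.assoc[symmetric], rule refl)
    also have "\<dots> = det (t *\<^sub>R mat 1 - ?D)" unfolding 1 by (rule mult_1)
    also have "\<dots> = (\<Prod>i\<in>UNIV. (t *\<^sub>R mat 1 - ?D) $ i $ i)"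
      by (rule det_diagonal) (simp add: mat_def)
    also have "\<dots> = (\<Prod>i\<in>UNIV. t - d $ i)" by (simp add: mat_def)
    finally show "det (t *\<^sub>R mat 1 - M) = (\<Prod>i\<in>UNIV. t - d $ i)" .
  qed
  moreover have "trace M = trace (Q ** (transpose Q ** ?D))"
    by (rule trans[OF arg_cong[of _ _ trace, OF MQ] trace_mul_sym])
  then have "trace M = trace ((Q ** transpose Q) ** ?D)" by (simp only: matrix_mul_assoc)
  then have "trace M = (\<Sum>i\<in>UNIV. d $ i)" unfolding QQ by (simp add: trace_def)
  ultimately show ?thesis by (rule that)
qed

lemma trace_pos_if_eigenvalues_Gamma:
  fixes U :: "(real^'n^'n) set"
  assumes "1 \<le> k" "k \<le> CARD('n)" "eigenvalue_set U \<subseteq> Gamma_cone k" "M \<in> U" "M \<in> sym_mats"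
  shows "0 < trace M"
proof -
  obtain l where l: "eigenvalue_vector M l" and t: "trace M = (\<Sum>i\<in>UNIV. l $ i)"
    using eigenvalue_vector_exists[OF assms(5)] by blast
  then have "l \<in> Gamma_cone k" using assms by (auto simp: eigenvalue_set_def)
  then show ?thesis using Gamma_cone_sigma_pos[OF assms(2,1)] by (simp add: t sigma_1[symmetric] flip: One_nat_def)
qed

text \<open>The Householder reflection in the hyperplane orthogonal to \<open>e\<close>; up to a
  scalar it is the differential of an inversion. For \<open>e = 0\<close> the quotient is 0 and the
  matrix is the identity, so it is orthogonal for every \<open>e\<close>.\<close>

definition refl_mat :: "real^'n \<Rightarrow> real^'n^'n" where
  "refl_mat e = mat 1 - (2 / (e \<bullet> e)) *\<^sub>R outer e e"

lemma refl_mat_mult: "refl_mat e *v x = x - (2 * (e \<bullet> x) / (e \<bullet> e)) *\<^sub>R e"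
  by (simp add: refl_mat_def matrix_vector_mult_diff_rdistrib scaleR_matrix_vector_assoc[symmetric] outer_mult_vector)

lemma refl_mat_sym: "transpose (refl_mat e) = refl_mat e"
  by (simp add: refl_mat_def vec_eq_iff transpose_def outer_def mat_def mult_ac)

lemma refl_mat_orthogonal: "orthogonal_matrix (refl_mat e)"
proof -
  have "refl_mat e *v (refl_mat e *v x) = x" for x
  proof (cases "e = 0")
    case False
    define c where "c = 2 * (e \<bullet> x) / (e \<bullet> e)"
    have "2 * (e \<bullet> (x - c *\<^sub>R e)) / (e \<bullet> e) = - c"
      using False by (simp add: c_def inner_diff_right)
    then show ?thesis by (simp add: refl_mat_mult c_def[symmetric])
  qed (simp add: refl_mat_mult)
  then have "refl_mat e ** refl_mat e = mat 1"
    by (simp add: matrix_eq matrix_vector_mul_assoc[symmetric])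
  then show ?thesis by (simp add: orthogonal_matrix_def refl_mat_sym)
qed

subsection \<open>Calculus of twice differentiable functions\<close>

text \<open>Gradient and Hessian are explicit arguments, so that closure rules produce the Hessian
  of a barrier as a term whose trace can be evaluated.\<close>

definition C2_on :: "(real^'n) set \<Rightarrow> (real^'n \<Rightarrow> real) \<Rightarrow> (real^'n \<Rightarrow> real^'n) \<Rightarrow> (real^'n \<Rightarrow> real^'n^'n) \<Rightarrow> bool" where
  "C2_on S f g H \<longleftrightarrow> (\<forall>x\<in>S. (f has_derivative (\<lambda>h. g x \<bullet> h)) (at x) \<and>
     (g has_derivative (\<lambda>h. H x *v h)) (at x)) \<and> continuous_on S H"

lemma C2_onD:
  assumes "C2_on S f g H" "x \<in> S"
  shows "(f has_derivative (\<lambda>h. g x \<bullet> h)) (at x)" "(g has_derivative (\<lambda>h. H x *v h)) (at x)"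
  using assms by (auto simp: C2_on_def)

lemma C2_on_subset: "C2_on S f g H \<Longrightarrow> T \<subseteq> S \<Longrightarrow> C2_on T f g H"
  by (auto simp: C2_on_def intro: continuous_on_subset)

lemma C2_on_continuous:
  assumes "C2_on S f g H"
  shows "continuous_on S f" "continuous_on S g" "continuous_on S H"
  using assms has_derivative_continuous continuous_at_imp_continuous_on
  unfolding C2_on_def by blast+

lemma C2_on_linear: "C2_on S (\<lambda>y. c + p \<bullet> y) (\<lambda>y. p) (\<lambda>y. 0)"
  unfolding C2_on_def by (auto intro!: derivative_eq_intros)

lemma C2_on_norm_sq: "C2_on S (\<lambda>y. (norm (y - c))\<^sup>2) (\<lambda>y. 2 *\<^sub>R (y - c)) (\<lambda>y. 2 *\<^sub>R mat 1)"
  unfolding C2_on_def power2_norm_eq_inner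
  by (auto intro!: derivative_eq_intros simp: inner_commute scaleR_matrix_vector_assoc[symmetric])

lemma C2_on_add:
  assumes "C2_on S f g H" "C2_on S f' g' H'"
  shows "C2_on S (\<lambda>y. f y + f' y) (\<lambda>y. g y + g' y) (\<lambda>y. H y + H' y)"
  using assms unfolding C2_on_def
  by (auto intro!: derivative_eq_intros continuous_intros simp: inner_add_left matrix_vector_mult_add_rdistrib)

lemma C2_on_scaleR:
  assumes "C2_on S f g H"
  shows "C2_on S (\<lambda>y. c * f y) (\<lambda>y. c *\<^sub>R g y) (\<lambda>y. c *\<^sub>R H y)"
  using assms unfolding C2_on_def
  by (auto intro!: derivative_eq_intros continuous_intros simp: scaleR_matrix_vector_assoc[symmetric])

lemma C2_on_diff:
  assumes "C2_on S f g H" "C2_on S f' g' H'"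
  shows "C2_on S (\<lambda>y. f y - f' y) (\<lambda>y. g y - g' y) (\<lambda>y. H y - H' y)"
  using C2_on_add[OF assms(1) C2_on_scaleR[OF assms(2), of "-1"]] by simp

lemma continuous_on_outer [continuous_intros]:
  assumes "continuous_on S f" "continuous_on S g"
  shows "continuous_on S (\<lambda>x. outer (f x) (g x))"
  unfolding outer_def by (intro continuous_intros assms)

lemma C2_on_compose:
  assumes f: "C2_on S f g H"
    and d1: "\<And>x. x \<in> S \<Longrightarrow> (\<phi> has_real_derivative \<phi>' (f x)) (at (f x))"
    and d2: "\<And>x. x \<in> S \<Longrightarrow> (\<phi>' has_real_derivative \<phi>'' (f x)) (at (f x))"
    and c: "continuous_on (f ` S) \<phi>''"
  shows "C2_on S (\<lambda>x. \<phi> (f x)) (\<lambda>x. \<phi>' (f x) *\<^sub>R g x) (\<lambda>x. \<phi>' (f x) *\<^sub>R H x + \<phi>'' (f x) *\<^sub>R outer (g x) (g x))"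
  unfolding C2_on_def
proof (intro conjI ballI)
  fix x assume x: "x \<in> S"
  have 0: "(f has_derivative (\<lambda>h. g x \<bullet> h)) (at x)" "(g has_derivative (\<lambda>h. H x *v h)) (at x)"
    using C2_onD[OF f x] .
  have 1: "((\<lambda>x. \<phi> (f x)) has_derivative (\<lambda>h. \<phi>' (f x) * (g x \<bullet> h))) (at x)"
    using has_derivative_compose[OF 0(1) has_field_derivative_imp_has_derivative[OF d1[OF x]]] by simp
  then show "((\<lambda>x. \<phi> (f x)) has_derivative (\<lambda>h. (\<phi>' (f x) *\<^sub>R g x) \<bullet> h)) (at x)" by simp
  have 2: "((\<lambda>x. \<phi>' (f x)) has_derivative (\<lambda>h. \<phi>'' (f x) * (g x \<bullet> h))) (at x)"
    using has_derivative_compose[OF 0(1) has_field_derivative_imp_has_derivative[OF d2[OF x]]] by simp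
  show "((\<lambda>x. \<phi>' (f x) *\<^sub>R g x) has_derivative
     (\<lambda>h. (\<phi>' (f x) *\<^sub>R H x + \<phi>'' (f x) *\<^sub>R outer (g x) (g x)) *v h)) (at x)"
    using has_derivative_scaleR[OF 2 0(2)]
    by (simp add: matrix_vector_mult_add_rdistrib scaleR_matrix_vector_assoc[symmetric] outer_mult_vector)
next
  have "continuous_on S f" "continuous_on S g" "continuous_on S H" using C2_on_continuous[OF f] .
  moreover have "continuous_on S (\<lambda>x. \<phi>'' (f x))"
    using continuous_on_compose2[OF c \<open>continuous_on S f\<close>] by simp
  moreover have "continuous_on S (\<lambda>x. \<phi>' (f x))"
  proof (rule continuous_at_imp_continuous_on, rule ballI)
    fix x assume "x \<in> S"
    then show "isCont (\<lambda>x. \<phi>' (f x)) x"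
      using isCont_o2[OF has_derivative_continuous[OF C2_onD(1)[OF f]] DERIV_isCont[OF d2]] by blast
  qed
  ultimately show "continuous_on S (\<lambda>x. \<phi>' (f x) *\<^sub>R H x + \<phi>'' (f x) *\<^sub>R outer (g x) (g x))"
    by (intro continuous_intros)
qed

section \<open>Minimum principles and decay of superharmonic functions\<close>

lemma second_derivative_test:
  fixes f :: "real^'n \<Rightarrow> real"
  assumes f: "C2_on S f g H" and S: "open S" "x \<in> S" and min: "\<And>y. y \<in> S \<Longrightarrow> f x \<le> f y"
  shows "g x = 0" and "0 \<le> h \<bullet> (H x *v h)"
proof -
  have "(\<lambda>h. g x \<bullet> h) = (\<lambda>h. 0)"
    using differential_zero_maxmin[OF S(2,1) C2_onD(1)[OF f S(2)]] min by blast
  then have "g x \<bullet> g x = 0" by (rule fun_cong)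
  then show g0: "g x = 0" by simp
  define \<phi> where "\<phi> = (\<lambda>t. f (x + t *\<^sub>R h))"
  define \<phi>' where "\<phi>' = (\<lambda>t. g (x + t *\<^sub>R h) \<bullet> h)"
  have "open ((\<lambda>t. x + t *\<^sub>R h) -` S)" by (intro open_vimage S continuous_intros)
  moreover have "0 \<in> (\<lambda>t. x + t *\<^sub>R h) -` S" using S(2) by simp
  ultimately obtain \<delta> where d0: "\<delta> > 0" "ball 0 \<delta> \<subseteq> (\<lambda>t. x + t *\<^sub>R h) -` S"
    by (rule openE)
  have dS: "x + t *\<^sub>R h \<in> S" if "\<bar>t\<bar> < \<delta>" for t
    using d0 that by (auto simp: subset_iff)
  have line: "((\<lambda>t. x + t *\<^sub>R h) has_derivative (\<lambda>s. s *\<^sub>R h)) (at t)" for t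
    by (auto intro!: derivative_eq_intros)
  have d1: "(\<phi> has_real_derivative \<phi>' t) (at t)" if "\<bar>t\<bar> < \<delta>" for t
    using has_derivative_compose[OF line C2_onD(1)[OF f dS[OF that]]]
    unfolding \<phi>_def \<phi>'_def has_field_derivative_def by (simp add: mult_commute_abs)
  have "((\<lambda>t. g (x + t *\<^sub>R h)) has_derivative (\<lambda>s. H (x + 0 *\<^sub>R h) *v (s *\<^sub>R h))) (at 0)"
    using has_derivative_compose[OF line[of 0], of g "\<lambda>h. H (x + 0 *\<^sub>R h) *v h"]
      C2_onD(2)[OF f S(2)] by simp
  from has_derivative_inner_left[OF this, of h]
  have d2: "(\<phi>' has_real_derivative h \<bullet> (H x *v h)) (at 0)"
    unfolding \<phi>'_def has_field_derivative_def
    by (simp add: mult_commute_abs matrix_vector_mult_scaleR inner_commute)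
  \<comment> \<open>If the second derivative along the line were negative, the first derivative,
    which vanishes at 0, would be negative just after 0, and \<open>f\<close> would drop below its
    minimum.\<close>
  show "0 \<le> h \<bullet> (H x *v h)"
  proof (rule ccontr)
    assume "\<not> 0 \<le> h \<bullet> (H x *v h)"
    then obtain e where e: "e > 0" "\<And>t. 0 < t \<Longrightarrow> t < e \<Longrightarrow> \<phi>' (0 + t) < \<phi>' 0"
      using DERIV_neg_dec_right[OF d2] by auto
    define t where "t = min e \<delta> / 2"
    have t: "0 < t" "t < e" "t < \<delta>" using e d0 by (auto simp: t_def)
    obtain s where s: "0 < s" "s < t" "\<phi> t - \<phi> 0 = (t - 0) * \<phi>' s"
      using MVT2[of 0 t \<phi> \<phi>'] d1 t by force
    have "\<phi>' s < 0" using e(2)[of s] s t g0 by (simp add: \<phi>'_def)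
    then have "\<phi> t < \<phi> 0" using s t by (simp add: mult_pos_neg algebra_simps)
    moreover have "\<phi> 0 \<le> \<phi> t" using min[OF dS[of t]] t by (simp add: \<phi>_def)
    ultimately show False by simp
  qed
qed

lemma trace_nonneg_psd:
  fixes M :: "real^'n^'n"
  assumes "\<And>h. 0 \<le> h \<bullet> (M *v h)"
  shows "0 \<le> trace M"
proof -
  have "axis i 1 \<bullet> (M *v axis i 1) = M $ i $ i" for i
    by (simp add: inner_axis' matrix_vector_mult_basis column_def)
  then have "0 \<le> M $ i $ i" for i using assms[of "axis i 1"] by simp
  then show ?thesis unfolding trace_def by (rule sum_nonneg)
qed

text \<open>At a negative minimum the Hessian would be positive semidefinite, against its negative
  trace. Boundary values and differential inequality enter as one condition: wherever
  \<open>f\<close> is negative, the point is interior and the trace negative.\<close>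

lemma minimum_principle:
  fixes f :: "real^'n \<Rightarrow> real"
  assumes "compact K" and f: "C2_on S f g H" and "K \<subseteq> S"
    and neg: "\<And>x. x \<in> K \<Longrightarrow> f x < 0 \<Longrightarrow> x \<in> interior K \<and> trace (H x) < 0"
    and "x \<in> K"
  shows "0 \<le> f x"
proof (rule ccontr)
  assume "\<not> 0 \<le> f x"
  have "continuous_on K f" using C2_on_continuous(1)[OF f] assms(3) continuous_on_subset by blast
  then obtain y where y: "y \<in> K" "\<And>z. z \<in> K \<Longrightarrow> f y \<le> f z"
    using continuous_attains_inf[of K f] assms(1,5) by blast
  then have "f y < 0" using \<open>\<not> 0 \<le> f x\<close> assms(5) by force
  then have n: "y \<in> interior K" "trace (H y) < 0" using neg y(1) by auto
  have "C2_on (interior K) f g H" using f assms(3) interior_subset by (metis C2_on_subset order_trans)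
  from second_derivative_test(2)[OF this open_interior n(1)]
  have "0 \<le> h \<bullet> (H y *v h)" for h using y(2) interior_subset by blast
  then show False using trace_nonneg_psd n(2) by (metis not_less)
qed

lemma interior_annulus:
  fixes x c :: "'a::euclidean_space"
  assumes "r < dist c x" "dist c x < R"
  shows "x \<in> interior (cball c R - ball c r)"
  by (rule interiorI[of "ball c R - cball c r"]) (use assms in auto)

text \<open>Comparison with a multiple of the fundamental solution, the power 2 - n of the distance,
  written here as a power of the squared norm. This lower bound for \<open>u\<close> becomes the
  quadratic growth bound for \<open>v\<close>.\<close>

lemma superharmonic_decay:
  fixes u :: "real^'n \<Rightarrow> real" and x :: "real^'n"
  assumes N: "CARD('n) \<ge> 3" and u: "C2_on UNIV u g H" and pos: "\<And>y. 0 < u y"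
    and sh: "\<And>y. trace (H y) < 0" and r: "r > 0"
  obtains c where "c > 0" "\<And>y. norm (y - x) \<ge> r \<Longrightarrow> c * ((norm (y - x))\<^sup>2) powr (- ((real CARD('n) - 2) / 2)) \<le> u y"
proof -
  define \<nu> where "\<nu> = (real CARD('n) - 2) / 2"
  have nu: "\<nu> > 0" "2 * \<nu> + 2 = real CARD('n)" using N by (auto simp: \<nu>_def field_simps)
  have "sphere x r \<noteq> {}" using r by simp
  then obtain z where z: "z \<in> sphere x r" "\<And>y. y \<in> sphere x r \<Longrightarrow> u z \<le> u y"
    using continuous_attains_inf[of "sphere x r" u] C2_on_continuous(1)[OF u] continuous_on_subset
    by (metis compact_sphere subset_UNIV)
  \<comment> \<open>With this factor \<open>c * b\<close> equals the minimum \<open>u z\<close> of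
    \<open>u\<close> on the inner sphere.\<close>
  define c where "c = u z * (r\<^sup>2) powr \<nu>"
  have c: "c > 0" using pos r by (simp add: c_def)
  define b where "b = (\<lambda>y. ((norm (y - x))\<^sup>2) powr (-\<nu>))"
  \<comment> \<open>Subtracting the outer boundary value makes the barrier vanish on the sphere of
    radius \<open>R\<close>, where \<open>u\<close> is positive; \<open>R\<close> tends to infinity
    afterwards.\<close>
  have ge: "c * b y - c * (R\<^sup>2) powr (-\<nu>) \<le> u y" if y: "norm (y - x) \<ge> r" "norm (y - x) \<le> R" for y R
  proof -
    let ?K = "cball x R - ball x r"
    define \<phi> where "\<phi> = (\<lambda>s::real. s powr (-\<nu>))"
    define \<phi>' where "\<phi>' = (\<lambda>s::real. (-\<nu>) * s powr (-\<nu> - 1))"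
    define \<phi>'' where "\<phi>'' = (\<lambda>s::real. (-\<nu>) * ((-\<nu> - 1) * s powr (-\<nu> - 1 - 1)))"
    have K0: "?K \<subseteq> - {x}" using r by auto
    have s0: "(norm (y - x))\<^sup>2 > 0" if "y \<in> - {x}" for y using that by simp
    have B: "C2_on (-{x}) (\<lambda>y. \<phi> ((norm (y - x))\<^sup>2)) (\<lambda>y. \<phi>' ((norm (y - x))\<^sup>2) *\<^sub>R (2 *\<^sub>R (y - x)))
        (\<lambda>y. \<phi>' ((norm (y - x))\<^sup>2) *\<^sub>R (2 *\<^sub>R mat 1) + \<phi>'' ((norm (y - x))\<^sup>2) *\<^sub>R outer (2 *\<^sub>R (y - x)) (2 *\<^sub>R (y - x)))"
    proof (rule C2_on_compose[OF C2_on_norm_sq])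
      fix y assume y: "y \<in> - {x}"
      show "(\<phi> has_real_derivative \<phi>' ((norm (y - x))\<^sup>2)) (at ((norm (y - x))\<^sup>2))"
        unfolding \<phi>_def \<phi>'_def using s0[OF y] by (auto intro!: derivative_eq_intros)
      show "(\<phi>' has_real_derivative \<phi>'' ((norm (y - x))\<^sup>2)) (at ((norm (y - x))\<^sup>2))"
        unfolding \<phi>'_def \<phi>''_def using s0[OF y] by (auto intro!: derivative_eq_intros)
    next
      show "continuous_on ((\<lambda>y. (norm (y - x))\<^sup>2) ` (-{x})) \<phi>''"
        unfolding \<phi>''_def by (intro continuous_intros) auto
    qed
    let ?f = "\<lambda>y. u y - (c * \<phi> ((norm (y - x))\<^sup>2) - (c * (R\<^sup>2) powr (-\<nu>) + 0 \<bullet> y))"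
    note F = C2_on_diff[OF C2_on_subset[OF u subset_UNIV] C2_on_diff[OF C2_on_scaleR[OF B, of c] C2_on_linear[of _ "c * (R\<^sup>2) powr (-\<nu>)" 0]]]
    have "0 \<le> ?f y"
    proof (rule minimum_principle[OF _ F K0])
      fix y assume y: "y \<in> ?K" and neg: "?f y < 0"
      have "norm (y - x) \<noteq> r"
      proof
        assume e: "norm (y - x) = r"
        then have "u z \<le> u y" using z(2)[of y] by (simp add: dist_norm norm_minus_commute)
        moreover have "c * \<phi> ((norm (y - x))\<^sup>2) = u z" unfolding e \<phi>_def c_def using r
          by (simp add: powr_minus)
        moreover have "0 \<le> c * (R\<^sup>2) powr (-\<nu>)" using c by simp
        ultimately show False using neg by simp
      qed
      moreover have "norm (y - x) \<noteq> R"
      proof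
        assume e: "norm (y - x) = R"
        then show False using neg pos[of y] by (simp add: \<phi>_def)
      qed
      ultimately have "r < dist x y" "dist x y < R" using y by (auto simp: dist_norm norm_minus_commute)
      then have int: "y \<in> interior ?K" by (rule interior_annulus)
      let ?s = "(norm (y - x))\<^sup>2"
      have s: "?s > 0" using s0 y K0 by blast
      have "1 + (-\<nu> - 1 - 1) = -\<nu> - 1" by simp
      then have pb: "?s powr (-\<nu> - 1 - 1) * ?s = ?s powr (-\<nu> - 1)"
        using powr_mult_base[of ?s "-\<nu> - 1 - 1"] s by (simp only: mult.commute[of _ ?s] less_imp_le)
      have "trace (\<phi>' ?s *\<^sub>R (2 *\<^sub>R mat 1) + \<phi>'' ?s *\<^sub>R outer (2 *\<^sub>R (y - x)) (2 *\<^sub>R (y - x)))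
          = 2 * real CARD('n) * \<phi>' ?s + 4 * (\<phi>'' ?s * ?s)"
        by (simp add: trace_add trace_scaleR trace_mat_1 trace_outer power2_norm_eq_inner)
      also have "\<phi>'' ?s * ?s = (-\<nu>) * ((-\<nu> - 1) * ?s powr (-\<nu> - 1))"
        unfolding \<phi>''_def pb[symmetric] by (simp only: mult.assoc)
      \<comment> \<open>The barrier is harmonic precisely because \<open>2 * \<nu> + 2\<close> is
        the dimension.\<close>
      also have "2 * real CARD('n) * \<phi>' ?s + 4 * ((-\<nu>) * ((-\<nu> - 1) * ?s powr (-\<nu> - 1))) = 0"
        unfolding nu(2)[symmetric] \<phi>'_def by (simp add: algebra_simps)
      finally have "trace (H y - (c *\<^sub>R (\<phi>' ?s *\<^sub>R (2 *\<^sub>R mat 1) + \<phi>'' ?s *\<^sub>R outer (2 *\<^sub>R (y - x)) (2 *\<^sub>R (y - x))) - 0)) < 0"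
        using sh by (simp add: trace_sub trace_scaleR)
      with int show "y \<in> interior ?K \<and> trace (H y - (c *\<^sub>R (\<phi>' ?s *\<^sub>R (2 *\<^sub>R mat 1) + \<phi>'' ?s *\<^sub>R outer (2 *\<^sub>R (y - x)) (2 *\<^sub>R (y - x))) - 0)) < 0"
        by blast
    qed (use y in \<open>auto simp: dist_norm norm_minus_commute intro: compact_diff\<close>)
    then show ?thesis by (simp add: b_def \<phi>_def)
  qed
  have "c * b y \<le> u y" if y: "norm (y - x) \<ge> r" for y
  proof (rule tendsto_upperbound)
    have "((\<lambda>R. (R\<^sup>2) powr (-\<nu>)) \<longlongrightarrow> 0) at_top"
      using nu(1) by (intro tendsto_neg_powr filterlim_pow_at_top filterlim_ident) auto
    then have "((\<lambda>R. c * b y - c * (R\<^sup>2) powr (-\<nu>)) \<longlongrightarrow> c * b y - c * 0) at_top" by (intro tendsto_intros)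
    then show "((\<lambda>R. c * b y - c * (R\<^sup>2) powr (-\<nu>)) \<longlongrightarrow> c * b y) at_top" by simp
    show "\<forall>\<^sub>F R in at_top. c * b y - c * (R\<^sup>2) powr (-\<nu>) \<le> u y"
      using ge[OF y] by (auto intro: eventually_at_top_linorderI[of "norm (y - x)"])
  qed simp
  then show ?thesis using that[OF c] unfolding b_def \<nu>_def by blast
qed

subsection \<open>Functions touching a subharmonic function at a puncture\<close>

lemma has_derivative_linear_bound:
  fixes w :: "real^'n \<Rightarrow> real"
  assumes "(w has_derivative (\<lambda>h. p \<bullet> h)) (at 0)" "e > 0"
  obtains d where "d > 0" "\<And>y. norm y < d \<Longrightarrow> w y \<le> w 0 + p \<bullet> y + e * norm y"
proof -
  obtain d where d: "d > 0" "\<And>y. norm (y - 0) < d \<Longrightarrow> norm (w y - w 0 - p \<bullet> (y - 0)) \<le> e * norm (y - 0)"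
    using assms unfolding has_derivative_at_alt by blast
  have "w y \<le> w 0 + p \<bullet> y + e * norm y" if "norm y < d" for y
    using d(2)[of y] that by (simp add: abs_le_iff)
  with d(1) show ?thesis by (rule that)
qed

lemma C2_on_inner_sq:
  "C2_on S (\<lambda>y. (d \<bullet> y)\<^sup>2) (\<lambda>y. (2 * (d \<bullet> y)) *\<^sub>R d) (\<lambda>y. 2 *\<^sub>R outer d d)"
proof -
  have "C2_on S (\<lambda>y. (0 + d \<bullet> y)\<^sup>2) (\<lambda>y. (2 * (0 + d \<bullet> y)) *\<^sub>R d)
     (\<lambda>y. (2 * (0 + d \<bullet> y)) *\<^sub>R 0 + 2 *\<^sub>R outer d d)"
    by (rule C2_on_compose[OF C2_on_linear, where \<phi> = "\<lambda>t. t\<^sup>2" and \<phi>' = "\<lambda>t. 2 * t" and \<phi>'' = "\<lambda>t. 2"])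
       (auto intro!: derivative_eq_intros)
  then show ?thesis by simp
qed

lemma C2_on_log_norm:
  "C2_on (- {0}) (\<lambda>y. ln ((norm (y - 0))\<^sup>2)) (\<lambda>y. (1 / (norm (y - 0))\<^sup>2) *\<^sub>R (2 *\<^sub>R (y - 0)))
     (\<lambda>y. (1 / (norm (y - 0))\<^sup>2) *\<^sub>R (2 *\<^sub>R mat 1) + (- 1 / ((norm (y - 0))\<^sup>2)\<^sup>2) *\<^sub>R outer (2 *\<^sub>R (y - 0)) (2 *\<^sub>R (y - 0)))"
  by (rule C2_on_compose[OF C2_on_norm_sq, where \<phi> = ln and \<phi>' = "\<lambda>t. 1 / t" and \<phi>'' = "\<lambda>t. - 1 / t\<^sup>2"])
     (auto intro!: derivative_eq_intros continuous_intros simp: power2_eq_square divide_simps)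

text \<open>
  Where the minimum of the two touching functions has a corner, its minimum exceeds a harmonic
  quadratic polynomial on small spheres, and the latter is strictly larger at the centre.
\<close>

lemma touching_gradients:
  fixes f w1 w2 :: "real^'n \<Rightarrow> real"
  assumes N: "CARD('n) \<ge> 2" and f: "C2_on (ball 0 \<rho> - {0}) f g H" and \<rho>: "\<rho> > 0"
    and sub: "\<And>y. y \<in> ball 0 \<rho> - {0} \<Longrightarrow> 0 < trace (H y)"
    and w1: "(w1 has_derivative (\<lambda>h. p1 \<bullet> h)) (at 0)" "w1 0 = \<beta>"
    and w2: "(w2 has_derivative (\<lambda>h. p2 \<bullet> h)) (at 0)" "w2 0 = \<beta>"
    and le: "\<And>y. y \<in> ball 0 \<rho> - {0} \<Longrightarrow> f y \<le> w1 y" "\<And>y. y \<in> ball 0 \<rho> - {0} \<Longrightarrow> f y \<le> w2 y"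
    and ne: "p1 \<noteq> p2"
  obtains \<epsilon> \<delta> where "\<epsilon> > 0" "\<delta> > 0" "\<And>y. 0 < norm y \<Longrightarrow> norm y < \<delta> \<Longrightarrow> f y \<le> \<beta> - \<epsilon>"
proof -
  define n where "n = real CARD('n)"
  have n: "n \<ge> 2" using N by (simp add: n_def)
  define d where "d = (1/2) *\<^sub>R (p1 - p2)"
  define p where "p = (1/2) *\<^sub>R (p1 + p2)"
  define D where "D = norm d"
  have D: "D > 0" using ne by (simp add: D_def d_def)
  \<comment> \<open>This value makes the quadratic polynomial \<open>q\<close> below
    harmonic.\<close>
  define \<epsilon> where "\<epsilon> = D / (2 * n)"
  have eps: "\<epsilon> > 0" "D = 2 * n * \<epsilon>" using D n by (auto simp: \<epsilon>_def)
  have p12: "p1 = p + d" "p2 = p - d" by (auto simp: p_def d_def algebra_simps simp flip: scaleR_add_left)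
  obtain r1 where r1: "r1 > 0" "\<And>y. norm y < r1 \<Longrightarrow> w1 y \<le> \<beta> + p1 \<bullet> y + \<epsilon> * norm y"
    using has_derivative_linear_bound[OF w1(1) eps(1)] w1(2) by auto
  obtain r2 where r2: "r2 > 0" "\<And>y. norm y < r2 \<Longrightarrow> w2 y \<le> \<beta> + p2 \<bullet> y + \<epsilon> * norm y"
    using has_derivative_linear_bound[OF w2(1) eps(1)] w2(2) by auto
  define r where "r = min \<rho> (min r1 r2) / 2"
  have r: "r > 0" "r < \<rho>" "r < r1" "r < r2" using \<rho> r1 r2 by (auto simp: r_def min_def)
  \<comment> \<open>The smaller of the two linear bounds with slopes \<open>p + d\<close> and
    \<open>p - d\<close> produces the corner \<open>- \<bar>d \<bullet> y\<bar>\<close>.\<close>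
  have ub: "f y \<le> \<beta> + p \<bullet> y - \<bar>d \<bullet> y\<bar> + \<epsilon> * norm y" if "y \<noteq> 0" "norm y \<le> r" for y
  proof -
    have "y \<in> ball 0 \<rho> - {0}" using that r by simp
    then have "f y \<le> \<beta> + p1 \<bullet> y + \<epsilon> * norm y" "f y \<le> \<beta> + p2 \<bullet> y + \<epsilon> * norm y"
      using le r1(2)[of y] r2(2)[of y] that r by force+
    then show ?thesis unfolding p12 inner_add_left inner_diff_left by linarith
  qed
  \<comment> \<open>On the sphere of radius \<open>r\<close> the first summand is at most
    \<open>\<bar>d \<bullet> y\<bar>\<close> and the bracket vanishes, while
    \<open>q 0 = 2 * \<epsilon> * r\<close>. This outweighs the error \<open>\<epsilon> * r\<close>
    and leaves a gain of \<open>\<epsilon> * r\<close> at the centre.\<close>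
  define q where "q = (\<lambda>y. (1 / (r * D)) * (d \<bullet> y)\<^sup>2 + (2 * \<epsilon> * r - (2 * \<epsilon> / r) * (norm (y - 0))\<^sup>2))"
  have q_le: "q y \<le> \<bar>d \<bullet> y\<bar> + (2 * \<epsilon> * r - (2 * \<epsilon> / r) * (norm y)\<^sup>2)" if "norm y \<le> r" for y
  proof -
    have "\<bar>d \<bullet> y\<bar> \<le> D * r"
      using order_trans[OF Cauchy_Schwarz_ineq2[of d y] mult_left_mono[OF that, of "norm d"]] by (simp add: D_def)
    then have "(d \<bullet> y)\<^sup>2 \<le> (r * D) * \<bar>d \<bullet> y\<bar>"
      using mult_right_mono[of "\<bar>d \<bullet> y\<bar>" "D * r" "\<bar>d \<bullet> y\<bar>"] by (simp add: power2_eq_square mult_ac flip: abs_mult)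
    then have "(1 / (r * D)) * (d \<bullet> y)\<^sup>2 \<le> \<bar>d \<bullet> y\<bar>" using r D by (simp add: divide_simps mult_ac)
    then show ?thesis by (simp add: q_def)
  qed
  \<comment> \<open>The logarithmic term is superharmonic in dimension at least 2 and vanishes at
    radius \<open>r\<close>; it compensates for the missing boundary value at the puncture.\<close>
  have key: "f y \<le> \<beta> + \<epsilon> * r + p \<bullet> y - q y + (t * ln (r\<^sup>2) - t * ln ((norm (y - 0))\<^sup>2))"
    if t: "t > 0" and y: "y \<noteq> 0" "norm y \<le> r" for t y
  proof -
    \<comment> \<open>At radius \<open>s\<close> the logarithmic term equals
      \<open>2 * \<epsilon> * r\<close>, a bound for the excess of \<open>q\<close> over
      \<open>\<bar>d \<bullet> y\<bar>\<close>.\<close>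
    define s where "s = r * exp (- \<epsilon> * r / t)"
    have s: "s > 0" "s < r" using r t eps by (auto simp: s_def mult_less_cancel_left2)
    have inner_case: "f y \<le> \<beta> + \<epsilon> * r + p \<bullet> y - q y + (t * ln (r\<^sup>2) - t * ln ((norm (y - 0))\<^sup>2))"
      if y: "y \<noteq> 0" "norm y \<le> s" for y
    proof -
      have yr: "norm y \<le> r" using y s by linarith
      have "ln (norm y) \<le> ln s" using y s by (simp add: ln_le_cancel_iff)
      also have "ln s = ln r - \<epsilon> * r / t" using r by (simp add: s_def ln_mult)
      finally have "t * ln (norm y) \<le> t * (ln r - \<epsilon> * r / t)" using t by (intro mult_left_mono) auto
      then have "t * ln (norm y) \<le> t * ln r - \<epsilon> * r" using t by (simp add: right_diff_distrib)
      moreover have "ln ((norm y)\<^sup>2) = 2 * ln (norm y)" "ln (r\<^sup>2) = 2 * ln r"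
        using y r by (auto simp: ln_realpow)
      ultimately have "t * ln (r\<^sup>2) - t * ln ((norm y)\<^sup>2) \<ge> 2 * \<epsilon> * r" by simp
      moreover have "q y \<le> \<bar>d \<bullet> y\<bar> + 2 * \<epsilon> * r"
      proof -
        have "0 \<le> (2 * \<epsilon> / r) * (norm y)\<^sup>2" using r eps by simp
        then show ?thesis using q_le[OF yr] by linarith
      qed
      moreover have "f y \<le> \<beta> + p \<bullet> y - \<bar>d \<bullet> y\<bar> + \<epsilon> * r"
        using ub[OF y(1) yr] mult_left_mono[OF yr, of \<epsilon>] eps by linarith
      ultimately show ?thesis by simp
    qed
    show ?thesis
    proof (cases "norm y \<le> s")
      case True
      then show ?thesis using inner_case y by blast
    next
      case False
      let ?K = "cball 0 r - ball (0 :: real^'n) s"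
      let ?S = "ball 0 \<rho> - {0 :: real^'n}"
      have KS: "?K \<subseteq> ?S" using r s by auto
      have S0: "?S \<subseteq> - {0}" by auto
      let ?F = "\<lambda>y. ((\<beta> + \<epsilon> * r + t * ln (r\<^sup>2) + p \<bullet> y) -
          ((1 / (r * D)) * (d \<bullet> y)\<^sup>2 + ((2 * \<epsilon> * r + 0 \<bullet> y) - (2 * \<epsilon> / r) * (norm (y - 0))\<^sup>2)) - f y)
          - t * ln ((norm (y - 0))\<^sup>2)"
      note C2 = C2_on_diff[OF C2_on_diff[OF C2_on_diff[OF C2_on_linear[of ?S "\<beta> + \<epsilon> * r + t * ln (r\<^sup>2)" p]
              C2_on_add[OF C2_on_scaleR[OF C2_on_inner_sq[of ?S d], of "1 / (r * D)"]
                C2_on_diff[OF C2_on_linear[of ?S "2 * \<epsilon> * r" 0] C2_on_scaleR[OF C2_on_norm_sq[of ?S 0], of "2 * \<epsilon> / r"]]]]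
            f] C2_on_scaleR[OF C2_on_subset[OF C2_on_log_norm S0], of t]]
      have "0 \<le> ?F y"
      proof (rule minimum_principle[OF _ C2 KS])
        fix y assume y: "y \<in> ?K" and neg: "?F y < 0"
        have y0: "y \<noteq> 0" "norm y \<le> r" using y s by auto
        have Fq: "?F y = \<beta> + \<epsilon> * r + p \<bullet> y - q y + (t * ln (r\<^sup>2) - t * ln ((norm (y - 0))\<^sup>2)) - f y"
          by (simp add: q_def)
        have "norm y \<noteq> s" using inner_case[of y] neg y0 unfolding Fq by linarith
        moreover have "norm y \<noteq> r"
        proof
          assume yr: "norm y = r"
          have "q y \<le> \<bar>d \<bullet> y\<bar>" using q_le[of y] yr r by (simp add: power2_eq_square)
          then show False using ub[OF y0] neg unfolding Fq by (simp add: yr)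
        qed
        ultimately have "s < dist 0 y" "dist 0 y < r" using y by auto
        then have "y \<in> interior ?K" by (rule interior_annulus)
        moreover have "trace (((0 - ((1 / (r * D)) *\<^sub>R (2 *\<^sub>R outer d d) + (0 - (2 * \<epsilon> / r) *\<^sub>R (2 *\<^sub>R mat 1)))) - H y)
          - t *\<^sub>R ((1 / (norm (y - 0))\<^sup>2) *\<^sub>R (2 *\<^sub>R mat 1) + (- 1 / ((norm (y - 0))\<^sup>2)\<^sup>2) *\<^sub>R outer (2 *\<^sub>R (y - 0)) (2 *\<^sub>R (y - 0)))) < 0"
        proof -
          have "d \<bullet> d = D * D" by (simp add: D_def norm_eq_sqrt_inner)
          then have 1: "1 / (r * D) * (2 * (d \<bullet> d)) - 2 * \<epsilon> / r * (2 * n) = 0"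
            using r D by (simp add: eps(2) divide_simps)
          have yy: "y \<bullet> y = (norm y)\<^sup>2" by (simp add: power2_norm_eq_inner)
          have "t * (1 / (norm y)\<^sup>2 * (2 * n) + - 1 / ((norm y)\<^sup>2)\<^sup>2 * (4 * (norm y)\<^sup>2)) = t * (2 * n - 4) / (norm y)\<^sup>2"
            using y0 by (simp add: divide_simps power2_eq_square)
          also have "\<dots> \<ge> 0" using t n by simp
          finally have 2: "0 \<le> t * (1 / (norm y)\<^sup>2 * (2 * n) + - 1 / ((norm y)\<^sup>2)\<^sup>2 * (4 * (norm y)\<^sup>2))" .
          have 3: "0 < trace (H y)" using sub KS y by blast
          have 0: "trace (0 :: real^'n^'n) = 0" by (simp add: trace_def)
          show ?thesis
            using 1 2 3 unfolding trace_sub trace_add trace_scaleR trace_outer trace_mat_1 n_def[symmetric] 0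
            by (simp add: yy algebra_simps)
        qed
        ultimately show "y \<in> interior ?K \<and> trace (((0 - ((1 / (r * D)) *\<^sub>R (2 *\<^sub>R outer d d) + (0 - (2 * \<epsilon> / r) *\<^sub>R (2 *\<^sub>R mat 1)))) - H y)
          - t *\<^sub>R ((1 / (norm (y - 0))\<^sup>2) *\<^sub>R (2 *\<^sub>R mat 1) + (- 1 / ((norm (y - 0))\<^sup>2)\<^sup>2) *\<^sub>R outer (2 *\<^sub>R (y - 0)) (2 *\<^sub>R (y - 0)))) < 0"
          by blast
      qed (use y False in \<open>auto intro: compact_diff\<close>)
      then show ?thesis by (simp add: q_def)
    qed
  qed
  \<comment> \<open>For fixed \<open>y\<close> the logarithmic term tends to 0 with
    \<open>t\<close>; the value \<open>t = e / L\<close> makes it at most \<open>e\<close>.\<close>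
  have key0: "f y \<le> \<beta> + \<epsilon> * r + p \<bullet> y - q y" if y: "y \<noteq> 0" "norm y \<le> r" for y
  proof (rule field_le_epsilon)
    fix e :: real assume e: "e > 0"
    define L where "L = \<bar>ln (r\<^sup>2) - ln ((norm (y - 0))\<^sup>2)\<bar> + 1"
    have L: "L > 0" "ln (r\<^sup>2) - ln ((norm (y - 0))\<^sup>2) \<le> L" unfolding L_def by linarith+
    have "f y \<le> \<beta> + \<epsilon> * r + p \<bullet> y - q y + (e / L) * (ln (r\<^sup>2) - ln ((norm (y - 0))\<^sup>2))"
      using key[of "e / L" y] e L(1) y by (simp add: right_diff_distrib)
    also have "(e / L) * (ln (r\<^sup>2) - ln ((norm (y - 0))\<^sup>2)) \<le> (e / L) * L"
      using e L by (intro mult_left_mono) auto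
    finally show "f y \<le> \<beta> + \<epsilon> * r + p \<bullet> y - q y + e" using L by simp
  qed
  have "((\<lambda>y. \<beta> + \<epsilon> * r + p \<bullet> y - q y) \<longlongrightarrow> \<beta> + \<epsilon> * r + p \<bullet> 0 - q 0) (at 0)"
    unfolding q_def by (intro tendsto_intros)
  moreover have "\<beta> + \<epsilon> * r + p \<bullet> 0 - q 0 < \<beta> - \<epsilon> * r / 2" using eps r by (simp add: q_def)
  ultimately have "\<forall>\<^sub>F y in at 0. \<beta> + \<epsilon> * r + p \<bullet> y - q y < \<beta> - \<epsilon> * r / 2" by (rule order_tendstoD)
  then obtain \<delta> where \<delta>: "\<delta> > 0"
      "\<And>y. y \<noteq> 0 \<Longrightarrow> dist y 0 < \<delta> \<Longrightarrow> \<beta> + \<epsilon> * r + p \<bullet> y - q y < \<beta> - \<epsilon> * r / 2"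
    unfolding eventually_at by auto
  show ?thesis
  proof (rule that)
    show "\<epsilon> * r / 2 > 0" "min \<delta> r > 0" using eps r \<delta> by auto
    fix y :: "real^'n" assume "0 < norm y" "norm y < min \<delta> r"
    then show "f y \<le> \<beta> - \<epsilon> * r / 2" using key0[of y] \<delta>(2)[of y] by force
  qed
qed

subsection \<open>Elliptic operators\<close>

text \<open>With \<open>a\<close>, \<open>p\<close>, \<open>N\<close> the value, gradient and
  Hessian of \<open>v\<close>, this is the Schouten tensor of the conformally flat metric with
  factor \<open>1 / v\<^sup>2\<close>, one index being raised by that metric.\<close>

definition schouten :: "real \<Rightarrow> real^'n \<Rightarrow> real^'n^'n \<Rightarrow> real^'n^'n" where
  "schouten a p N = a *\<^sub>R N - ((norm p)\<^sup>2 / 2) *\<^sub>R mat 1"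

lemma norm_outer_self: "norm (outer x x) = (norm x)\<^sup>2"
proof -
  have "(norm (outer x x))\<^sup>2 = ((norm x)\<^sup>2)\<^sup>2"
    unfolding power2_norm_eq_inner inner_outer outer_mult_vector by (simp add: power2_eq_square)
  then show ?thesis by (rule power2_eq_imp_eq) simp_all
qed

lemma sym_mats_subspace: "subspace (sym_mats :: (real^'n^'n) set)"
  by (auto simp: subspace_def sym_mats_def transpose_def vec_eq_iff)

lemma mat_1_sym: "mat 1 \<in> sym_mats"
  by (auto simp: sym_mats_def)

lemma pos_def_coercive:
  fixes A :: "real^'n^'n"
  assumes "A \<in> pos_def_mats"
  obtains \<theta> where "\<theta> > 0" "\<And>x. \<theta> * (norm x)\<^sup>2 \<le> x \<bullet> (A *v x)"
proof -
  have "continuous_on (sphere 0 1) (\<lambda>x. x \<bullet> (A *v x))"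
    by (intro continuous_intros matrix_vector_mult_linear_continuous_on)
  moreover have "sphere (0::real^'n) 1 \<noteq> {}" by simp
  ultimately obtain z where z: "z \<in> sphere 0 1" "\<And>y. y \<in> sphere 0 1 \<Longrightarrow> z \<bullet> (A *v z) \<le> y \<bullet> (A *v y)"
    using continuous_attains_inf[OF compact_sphere] by blast
  let ?t = "z \<bullet> (A *v z)"
  have "z \<noteq> 0" using z(1) by auto
  then have "?t > 0" using assms by (simp add: pos_def_mats_def)
  moreover have "?t * (norm x)\<^sup>2 \<le> x \<bullet> (A *v x)" for x
  proof (cases "x = 0")
    case False
    then have "?t \<le> (1 / norm x)\<^sup>2 * (x \<bullet> (A *v x))"
      using z(2)[of "(1 / norm x) *\<^sub>R x"] by (simp add: matrix_vector_mult_scaleR power2_eq_square mult_ac)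
    then show ?thesis using False by (simp add: divide_simps mult_ac)
  qed simp
  ultimately show ?thesis by (rule that)
qed

locale elliptic_operator =
  fixes U :: "(real^'n^'n) set" and F :: "real^'n^'n \<Rightarrow> real"
  assumes U_open: "openin (top_of_set sym_mats) U"
    and U_convex: "\<And>M N. M \<in> sym_mats \<Longrightarrow> N \<in> pos_def_mats \<Longrightarrow> convex (U \<inter> {M + t *\<^sub>R N | t. 0 < t})"
    and F_C2: "Ck_on 2 sym_mats U F"
    and F_pos_def: "\<And>M. M \<in> U \<Longrightarrow> matrix_deriv U F M \<in> pos_def_mats"
begin

lemma U_sym: "U \<subseteq> sym_mats"
  using U_open openin_imp_subset by blast

lemma U_ball:
  assumes "M \<in> U"
  obtains \<rho> where "\<rho> > 0" "\<And>P. P \<in> sym_mats \<Longrightarrow> norm (P - M) < \<rho> \<Longrightarrow> P \<in> U"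
  using U_open assms unfolding openin_euclidean_subtopology_iff dist_norm by blast

lemma F_differentiable: "M \<in> U \<Longrightarrow> F differentiable (at M within U)"
  using F_C2 by (simp add: numeral_2_eq_2)

lemma matrix_deriv_continuous: "continuous_on U (matrix_deriv U F)"
proof -
  have "continuous_on U (\<lambda>M. frechet_derivative F (at M within U) ((1/2) *\<^sub>R (axis i (axis j 1) + axis j (axis i 1))))"
    for i j :: 'n
  proof -
    have "(1/2) *\<^sub>R (axis i (axis j 1) + axis j (axis i 1)) \<in> (sym_mats :: (real^'n^'n) set)"
      by (auto simp: sym_mats_def transpose_def vec_eq_iff axis_def)
    then have "\<forall>x\<in>U. (\<lambda>M. frechet_derivative F (at M within U) ((1/2) *\<^sub>R (axis i (axis j 1) + axis j (axis i 1)))) differentiable (at x within U)"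
      using F_C2 by (simp add: numeral_2_eq_2)
    then show ?thesis
      using differentiable_imp_continuous_on[unfolded differentiable_on_def] by blast
  qed
  then show ?thesis unfolding matrix_deriv_def[abs_def] by (intro continuous_on_vec_lambda)
qed

lemma F_mean_value:
  assumes seg: "\<And>s. 0 \<le> s \<Longrightarrow> s \<le> 1 \<Longrightarrow> M + s *\<^sub>R N \<in> U" and N: "N \<in> sym_mats"
  obtains s where "0 < s" "s < 1" "F (M + N) - F M = matrix_deriv U F (M + s *\<^sub>R N) \<bullet> N"
proof -
  let ?D = "\<lambda>s. frechet_derivative F (at (M + s *\<^sub>R N) within U)"
  have D: "(F has_derivative ?D s) (at (M + s *\<^sub>R N) within U)" if "0 \<le> s" "s \<le> 1" for s
    using F_differentiable[OF seg[OF that]] by (simp add: frechet_derivative_works)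
  have "((\<lambda>s. F (M + s *\<^sub>R N)) has_derivative (\<lambda>t. ?D s (t *\<^sub>R N))) (at s within {0..1})"
    if "0 \<le> s" "s \<le> 1" for s
  proof -
    have 1: "((\<lambda>s. M + s *\<^sub>R N) has_derivative (\<lambda>t. t *\<^sub>R N)) (at s within {0..1})"
      by (auto intro!: derivative_eq_intros)
    have "(\<lambda>s. M + s *\<^sub>R N) ` {0..1} \<subseteq> U" using seg by auto
    from has_derivative_in_compose[OF 1 has_derivative_subset[OF D[OF that] this]] show ?thesis .
  qed
  then obtain s where s: "s \<in> {0<..<1}" "F (M + 1 *\<^sub>R N) - F (M + 0 *\<^sub>R N) = ?D s ((1 - 0) *\<^sub>R N)"
    using mvt_simple[of 0 1 "\<lambda>s. F (M + s *\<^sub>R N)" "\<lambda>s t. ?D s (t *\<^sub>R N)"] by auto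
  have "?D s N = matrix_deriv U F (M + s *\<^sub>R N) \<bullet> N"
    using matrix_deriv_expansion[OF U_open seg N D] s(1) by (simp add: inner_vec_def)
  then show ?thesis using that[of s] s by simp
qed

text \<open>\<open>U_convex\<close> concerns positive definite directions, while contact of
  solutions yields semidefinite ones. As \<open>U\<close> is relatively open, the end points can be
  moved apart by small multiples of the identity, which makes the direction definite.\<close>

lemma segment_in_U:
  assumes M: "M \<in> U" "M + N \<in> U" and psd: "\<And>x. 0 \<le> x \<bullet> (N *v x)" and s: "0 \<le> s" "s \<le> 1"
  shows "M + s *\<^sub>R N \<in> U"
proof -
  have sym: "M \<in> sym_mats" "M + N \<in> sym_mats" using M U_sym by auto
  then have N: "N \<in> sym_mats" using subspace_diff[OF sym_mats_subspace, of "M + N" M] by simp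
  obtain \<rho>1 where r1: "\<rho>1 > 0" "\<And>P. P \<in> sym_mats \<Longrightarrow> norm (P - M) < \<rho>1 \<Longrightarrow> P \<in> U"
    using U_ball[OF M(1)] by blast
  obtain \<rho>2 where r2: "\<rho>2 > 0" "\<And>P. P \<in> sym_mats \<Longrightarrow> norm (P - (M + N)) < \<rho>2 \<Longrightarrow> P \<in> U"
    using U_ball[OF M(2)] by blast
  let ?I = "mat 1 :: real^'n^'n"
  define K where "K = norm ?I + 1"
  have pos: "K > 0" unfolding K_def by (rule add_nonneg_pos) auto
  define \<delta> where "\<delta> = min \<rho>1 \<rho>2 / (2 * K)"
  have d0: "\<delta> > 0" using r1 r2 pos by (simp add: \<delta>_def)
  have small: "norm ((c * \<delta>) *\<^sub>R ?I) < min \<rho>1 \<rho>2" if "\<bar>c\<bar> \<le> 1" for c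
  proof -
    have "norm ((c * \<delta>) *\<^sub>R ?I) \<le> \<delta> * norm ?I"
      using that d0 by (simp add: abs_mult mult_right_mono mult_left_le_one_le)
    also have "\<dots> \<le> \<delta> * K" using d0 by (simp add: K_def)
    also have "\<dots> = min \<rho>1 \<rho>2 / 2" using pos by (simp add: \<delta>_def)
    also have "\<dots> < min \<rho>1 \<rho>2" using r1(1) r2(1) by (simp only: min_def) simp
    finally show ?thesis .
  qed
  \<comment> \<open>The two shifts are weighted so that they cancel in the convex combination with
    weight \<open>s\<close>, which is then \<open>M + s *\<^sub>R N\<close> itself.\<close>
  define P0 where "P0 = M - (s * \<delta>) *\<^sub>R ?I"
  define P1 where "P1 = M + N + ((1 - s) * \<delta>) *\<^sub>R ?I"
  have "P0 \<in> sym_mats" "P1 \<in> sym_mats" unfolding P0_def P1_def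
    by (intro subspace_add subspace_diff subspace_scale sym_mats_subspace sym mat_1_sym)+
  then have P: "P0 \<in> U" "P1 \<in> U"
    using r1(2)[of P0] r2(2)[of P1] small[of s] small[of "1 - s"] s by (auto simp: P0_def P1_def)
  have PN: "P1 - P0 = N + \<delta> *\<^sub>R ?I" by (simp add: P0_def P1_def algebra_simps)
  have pd: "N + \<delta> *\<^sub>R ?I \<in> pos_def_mats" unfolding pos_def_mats_def
  proof (intro CollectI conjI allI impI)
    show "N + \<delta> *\<^sub>R ?I \<in> sym_mats"
      by (intro subspace_add subspace_scale sym_mats_subspace N mat_1_sym)
    fix x :: "real^'n" assume "x \<noteq> 0"
    then have "0 < \<delta> * (x \<bullet> x)" using d0 by simp
    then show "0 < x \<bullet> ((N + \<delta> *\<^sub>R ?I) *v x)" using psd[of x]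
      by (simp add: matrix_vector_mult_add_rdistrib scaleR_matrix_vector_assoc[symmetric] inner_add_right)
  qed
  \<comment> \<open>The ray starts one step before \<open>P0\<close> because the parameter 0 is
    excluded; \<open>P0\<close> and \<open>P1\<close> have the parameters 1 and 2.\<close>
  let ?C = "U \<inter> {(P0 - (P1 - P0)) + t *\<^sub>R (P1 - P0) | t. 0 < t}"
  have "convex ?C"
  proof (rule U_convex)
    show "P0 - (P1 - P0) \<in> sym_mats"
      using \<open>P0 \<in> sym_mats\<close> \<open>P1 \<in> sym_mats\<close> by (intro subspace_diff sym_mats_subspace)
    show "P1 - P0 \<in> pos_def_mats" using PN pd by simp
  qed
  moreover have "P0 \<in> ?C" using P by (auto intro!: exI[of _ 1])
  moreover have "P1 \<in> ?C" using P by (auto intro!: exI[of _ 2] simp: algebra_simps scaleR_2)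
  ultimately have "(1 - s) *\<^sub>R P0 + s *\<^sub>R P1 \<in> ?C" using s by (simp add: convex_def)
  moreover have "(1 - s) *\<^sub>R P0 + s *\<^sub>R P1 = M + s *\<^sub>R N"
    by (simp add: P0_def P1_def algebra_simps)
  ultimately show ?thesis by simp
qed

text \<open>By the mean value theorem the increment of \<open>F\<close> is a positive definite
  matrix paired with \<open>N\<close>, hence positive unless \<open>N = 0\<close>.\<close>

lemma comparable_level_points_eq:
  assumes M: "M \<in> U" "M + N \<in> U" and psd: "\<And>x. 0 \<le> x \<bullet> (N *v x)" and F: "F (M + N) = F M"
  shows "N = 0"
proof (rule ccontr)
  assume "N \<noteq> 0"
  have "N \<in> sym_mats" using subspace_diff[OF sym_mats_subspace, of "M + N" M] M U_sym by auto
  note seg = segment_in_U[OF M psd]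
  obtain s where s: "0 < s" "s < 1" "F (M + N) - F M = matrix_deriv U F (M + s *\<^sub>R N) \<bullet> N"
    using F_mean_value[OF seg \<open>N \<in> sym_mats\<close>] by blast
  have "0 < matrix_deriv U F (M + s *\<^sub>R N) \<bullet> N"
    using pos_def_inner_psd(2)[OF F_pos_def[OF seg] \<open>N \<in> sym_mats\<close> psd \<open>N \<noteq> 0\<close>] s by simp
  then show False using s F by simp
qed

text \<open>Factoring the difference of the squared gradients as
  \<open>(p + p') \<bullet> (p' - p)\<close> makes the expression linear in the differences of
  values, gradients and Hessians.\<close>

lemma schouten_diff:
  "schouten a' p' N' - schouten a p N = a' *\<^sub>R (N' - N) + (a' - a) *\<^sub>R N - (((p + p') \<bullet> (p' - p)) / 2) *\<^sub>R mat 1"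
proof -
  have "((norm p')\<^sup>2 / 2) - ((norm p)\<^sup>2 / 2) = ((p + p') \<bullet> (p' - p)) / 2"
    unfolding power2_norm_eq_inner by (simp add: inner_add_left inner_diff_right inner_commute[of p p'] diff_divide_distrib)
  then show ?thesis unfolding schouten_def
    by (simp only: scaleR_diff_left scaleR_diff_right flip: \<open>_ = ((p + p') \<bullet> (p' - p)) / 2\<close>) simp
qed

text \<open>The bounds hold on a ball of symmetric matrices, which is convex; so they apply at the
  intermediate point of the mean value theorem for any two matrices in it.\<close>

lemma local_ellipticity:
  assumes M0: "M0 \<in> U"
  obtains \<rho> \<theta> \<Lambda> where "\<rho> > 0" "\<theta> > 0" "\<Lambda> > 0"
    "\<And>P. P \<in> sym_mats \<Longrightarrow> norm (P - M0) < \<rho> \<Longrightarrow>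
       P \<in> U \<and> norm (matrix_deriv U F P) \<le> \<Lambda> \<and> (\<forall>x. \<theta> * (norm x)\<^sup>2 \<le> x \<bullet> (matrix_deriv U F P *v x))"
proof -
  let ?a = "matrix_deriv U F"
  obtain \<theta> where th: "\<theta> > 0" "\<And>x. \<theta> * (norm x)\<^sup>2 \<le> x \<bullet> (?a M0 *v x)"
    using pos_def_coercive[OF F_pos_def[OF M0]] by blast
  obtain \<rho>1 where r1: "\<rho>1 > 0" "\<And>P. P \<in> sym_mats \<Longrightarrow> norm (P - M0) < \<rho>1 \<Longrightarrow> P \<in> U"
    using U_ball[OF M0] by blast
  have "min 1 (\<theta> / 2) > 0" using th by simp
  then obtain \<rho>2 where r2: "\<rho>2 > 0" "\<And>P. P \<in> U \<Longrightarrow> norm (P - M0) < \<rho>2 \<Longrightarrow> norm (?a P - ?a M0) < min 1 (\<theta> / 2)"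
    using matrix_deriv_continuous M0 unfolding continuous_on_iff dist_norm by metis
  show ?thesis
  proof (rule that)
    show "min \<rho>1 \<rho>2 > 0" "\<theta> / 2 > 0" using r1 r2 th by auto
    show "norm (?a M0) + 1 > 0" by (rule add_nonneg_pos) auto
    fix P assume P: "P \<in> sym_mats" "norm (P - M0) < min \<rho>1 \<rho>2"
    then have PU: "P \<in> U" using r1 by simp
    have d: "norm (?a P - ?a M0) < min 1 (\<theta> / 2)" using r2(2)[OF PU] P by simp
    have "norm (?a P) \<le> norm (?a M0) + 1"
      using norm_triangle_ineq2[of "?a P" "?a M0"] d by linarith
    moreover have "\<theta> / 2 * (norm x)\<^sup>2 \<le> x \<bullet> (?a P *v x)" for x
    proof -
      have "\<bar>(?a P - ?a M0) \<bullet> outer x x\<bar> \<le> norm (?a P - ?a M0) * (norm x)\<^sup>2"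
        using Cauchy_Schwarz_ineq2[of "?a P - ?a M0" "outer x x"] by (simp add: norm_outer_self)
      also have "\<dots> \<le> \<theta> / 2 * (norm x)\<^sup>2" using d by (intro mult_right_mono) auto
      finally have "(?a P - ?a M0) \<bullet> outer x x \<ge> - (\<theta> / 2 * (norm x)\<^sup>2)" by linarith
      then have "x \<bullet> (?a P *v x) - x \<bullet> (?a M0 *v x) \<ge> - (\<theta> / 2 * (norm x)\<^sup>2)"
        by (simp only: inner_diff_left inner_outer[symmetric])
      then show ?thesis using th(2)[of x] by (simp add: field_simps)
    qed
    ultimately show "P \<in> U \<and> norm (?a P) \<le> norm (?a M0) + 1 \<and> (\<forall>x. \<theta> / 2 * (norm x)\<^sup>2 \<le> x \<bullet> (?a P *v x))"
      using PU by blast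
  qed
qed

end

definition (in elliptic_operator) solution ::
  "(real^'n) set \<Rightarrow> (real^'n \<Rightarrow> real) \<Rightarrow> (real^'n \<Rightarrow> real^'n) \<Rightarrow> (real^'n \<Rightarrow> real^'n^'n) \<Rightarrow> bool" where
  "solution S v g H \<longleftrightarrow> C2_on S v g H \<and>
     (\<forall>y\<in>S. 0 < v y \<and> schouten (v y) (g y) (H y) \<in> U \<and> F (schouten (v y) (g y) (H y)) = 1)"

section \<open>Hopf's lemma and the strong maximum principle\<close>

lemma C2_on_exp_barrier:
  "C2_on S (\<lambda>y. exp (- \<alpha> * (norm (y - c))\<^sup>2))
     (\<lambda>y. (- \<alpha> * exp (- \<alpha> * (norm (y - c))\<^sup>2)) *\<^sub>R (2 *\<^sub>R (y - c)))
     (\<lambda>y. (- \<alpha> * exp (- \<alpha> * (norm (y - c))\<^sup>2)) *\<^sub>R (2 *\<^sub>R mat 1) +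
        (\<alpha>\<^sup>2 * exp (- \<alpha> * (norm (y - c))\<^sup>2)) *\<^sub>R outer (2 *\<^sub>R (y - c)) (2 *\<^sub>R (y - c)))"
  by (rule C2_on_compose[OF C2_on_norm_sq, where \<phi> = "\<lambda>t. exp (- \<alpha> * t)" and \<phi>' = "\<lambda>t. - \<alpha> * exp (- \<alpha> * t)"
        and \<phi>'' = "\<lambda>t. \<alpha>\<^sup>2 * exp (- \<alpha> * t)"])
     (auto intro!: derivative_eq_intros continuous_intros simp: power2_eq_square)

lemma large_parameter:
  fixes P Q R :: real
  assumes "P > 0" "Q \<ge> 0" "R \<ge> 0"
  obtains \<alpha> where "\<alpha> > 0" "\<alpha>\<^sup>2 * P > \<alpha> * Q + R"
proof -
  define \<alpha> where "\<alpha> = (Q + R) / P + 1"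
  have "\<alpha> \<ge> 1" using assms by (simp add: \<alpha>_def)
  have "\<alpha> * P = Q + R + P" using assms by (simp add: \<alpha>_def field_simps)
  then have "\<alpha> * (\<alpha> * P) = \<alpha> * Q + \<alpha> * R + \<alpha> * P" by (simp add: algebra_simps)
  moreover have "\<alpha> * R \<ge> 1 * R" using \<open>\<alpha> \<ge> 1\<close> assms by (intro mult_right_mono) auto
  moreover have "\<alpha> * P > 0" using \<open>\<alpha> \<ge> 1\<close> assms by simp
  ultimately have "\<alpha>\<^sup>2 * P > \<alpha> * Q + R" by (simp add: power2_eq_square mult.assoc)
  then show ?thesis using that[of \<alpha>] \<open>\<alpha> \<ge> 1\<close> by simp
qed

context elliptic_operator
begin

lemma solutionD:
  assumes "solution S v g H"
  shows "C2_on S v g H" "y \<in> S \<Longrightarrow> 0 < v y" "y \<in> S \<Longrightarrow> schouten (v y) (g y) (H y) \<in> U"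
    "y \<in> S \<Longrightarrow> F (schouten (v y) (g y) (H y)) = 1"
  using assms by (auto simp: solution_def)

lemma solution_subset: "solution S v g H \<Longrightarrow> T \<subseteq> S \<Longrightarrow> solution T v g H"
  using C2_on_subset by (fastforce simp: solution_def)

lemma solution_hess_sym:
  assumes "solution S v g H" "y \<in> S"
  shows "H y \<in> sym_mats"
proof -
  have "schouten (v y) (g y) (H y) \<in> sym_mats" using solutionD(3)[OF assms] U_sym by blast
  then have "schouten (v y) (g y) (H y) + ((norm (g y))\<^sup>2 / 2) *\<^sub>R mat 1 \<in> sym_mats"
    by (intro subspace_add subspace_scale sym_mats_subspace mat_1_sym)
  then have "v y *\<^sub>R H y \<in> sym_mats" by (simp add: schouten_def)
  from subspace_scale[OF sym_mats_subspace this, of "1 / v y"]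
  have "(1 / v y) *\<^sub>R (v y *\<^sub>R H y) \<in> sym_mats" .
  moreover have "v y \<noteq> 0" using solutionD(2)[OF assms(1)] assms(2) by fastforce
  ultimately show ?thesis by simp
qed

lemma schouten_continuous:
  assumes "solution S v g H"
  shows "continuous_on S (\<lambda>y. schouten (v y) (g y) (H y))"
  unfolding schouten_def
  by (intro continuous_intros C2_on_continuous[OF solutionD(1)[OF assms]]) simp

text \<open>
  The difference of the two solutions satisfies a linear elliptic inequality whose
  coefficients come from the mean value theorem for \<open>F\<close>; this requires the two arguments
  of \<open>F\<close> to be close to each other, which holds near a point where they agree.
\<close>

lemma hopf:
  assumes \<Omega>: "open \<Omega>" and v: "solution \<Omega> v g H" and v': "solution \<Omega> v' g' H'"
    and y0: "y0 \<in> \<Omega>" "dist c y0 = r" "r > 0"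
    and pos: "\<And>y. y \<in> ball c r \<Longrightarrow> y \<in> \<Omega> \<and> v y < v' y"
    and eq: "v y0 = v' y0" "g y0 = g' y0" "schouten (v y0) (g y0) (H y0) = schouten (v' y0) (g' y0) (H' y0)"
  shows False
proof -
  define M where "M = (\<lambda>y. schouten (v y) (g y) (H y))"
  define M' where "M' = (\<lambda>y. schouten (v' y) (g' y) (H' y))"
  have M_U: "M y \<in> U" "M' y \<in> U" "F (M y) = 1" "F (M' y) = 1" if "y \<in> \<Omega>" for y
    using solutionD[OF v] solutionD[OF v'] that by (auto simp: M_def M'_def)
  obtain \<rho> \<theta> \<Lambda> where ell: "\<rho> > 0" "\<theta> > 0" "\<Lambda> > 0"
    "\<And>P. P \<in> sym_mats \<Longrightarrow> norm (P - M y0) < \<rho> \<Longrightarrow>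
       P \<in> U \<and> norm (matrix_deriv U F P) \<le> \<Lambda> \<and> (\<forall>x. \<theta> * (norm x)\<^sup>2 \<le> x \<bullet> (matrix_deriv U F P *v x))"
    using local_ellipticity[OF M_U(1)[OF y0(1)]] by blast
  \<comment> \<open>The closed ball of half the radius is internally tangent at \<open>y0\<close>
    and otherwise lies in the open ball, so the strict inequality holds on all of it except at
    \<open>y0\<close>.\<close>
  define b where "b = (1/2) *\<^sub>R (c + y0)"
  define s where "s = r / 2"
  have s: "s > 0" using y0 by (simp add: s_def)
  have yb: "y0 - b = (1/2) *\<^sub>R (y0 - c)" by (simp add: b_def vec_eq_iff field_simps)
  have ds: "dist b y0 = s"
    using y0(2) by (simp add: dist_norm norm_minus_commute[of b] norm_minus_commute[of c] yb s_def)
  have sub: "y \<in> ball c r" if y: "y \<in> cball b s" "y \<noteq> y0" for y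
  proof -
    define p where "p = y - c"
    define q where "q = y0 - c"
    have q: "norm q = 2 * s" using y0(2) by (simp add: q_def dist_norm norm_minus_commute s_def)
    have "p - (1/2) *\<^sub>R q = y - b" by (simp add: p_def q_def b_def vec_eq_iff field_simps)
    then have "norm (p - (1/2) *\<^sub>R q) \<le> s" using y(1) by (simp add: dist_norm norm_minus_commute)
    then have "(norm (p - (1/2) *\<^sub>R q))\<^sup>2 \<le> s\<^sup>2" by (intro power_mono) auto
    then have "p \<bullet> p - p \<bullet> q + (1/4) * (q \<bullet> q) \<le> s\<^sup>2"
      unfolding power2_norm_eq_inner by (simp add: inner_diff_left inner_diff_right inner_commute)
    moreover have qq: "q \<bullet> q = 4 * s\<^sup>2" using q by (simp add: dot_square_norm power_mult_distrib)
    ultimately have 1: "p \<bullet> p \<le> p \<bullet> q" by simp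
    have "p - q \<noteq> 0" using y(2) by (simp add: p_def q_def)
    then have "0 < (p - q) \<bullet> (p - q)" by simp
    then have "p \<bullet> p < q \<bullet> q" using 1 by (simp add: inner_diff_left inner_diff_right inner_commute)
    then have "norm p < norm q" by (simp add: norm_lt)
    then show ?thesis using q by (simp add: p_def dist_norm norm_minus_commute s_def)
  qed
  define \<kappa> where "\<kappa> = v' y0 / 2"
  have kappa: "\<kappa> > 0" using solutionD(2)[OF v' y0(1)] by (simp add: \<kappa>_def)
  define B where "B = norm (H y0) + norm (g y0 + g' y0) + 1"
  have B: "B > 0" "norm (H y0) < B" "norm (g y0 + g' y0) < B" unfolding B_def
    using norm_ge_zero[of "H y0"] norm_ge_zero[of "g y0 + g' y0"] by linarith+
  have cont: "isCont v' y0" "isCont H y0" "isCont g y0" "isCont g' y0" "isCont M y0" "isCont M' y0"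
    using C2_on_continuous[OF solutionD(1)[OF v]] C2_on_continuous[OF solutionD(1)[OF v']]
      schouten_continuous[OF v] schouten_continuous[OF v'] \<Omega> y0(1)
    unfolding M_def M'_def by (auto simp: continuous_on_eq_continuous_at)
  have "\<forall>\<^sub>F y in nhds y0. y \<in> \<Omega> \<and> norm (M y - M y0) < \<rho> \<and> norm (M' y - M y0) < \<rho> \<and> \<kappa> < v' y \<and>
     norm (H y) < B \<and> norm (g y + g' y) < B"
  proof (intro eventually_conj)
    have t: "(f \<longlongrightarrow> f y0) (nhds y0)" if "isCont f y0" for f :: "real^'n \<Rightarrow> 'b::topological_space"
      using that by (simp add: continuous_at tendsto_at_iff_tendsto_nhds)
    show "\<forall>\<^sub>F y in nhds y0. y \<in> \<Omega>" using \<Omega> y0(1) by (rule eventually_nhds_in_open)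
    have "((\<lambda>y. norm (M y - M y0)) \<longlongrightarrow> norm (M y0 - M y0)) (nhds y0)" by (intro tendsto_intros t cont)
    then show "\<forall>\<^sub>F y in nhds y0. norm (M y - M y0) < \<rho>" by (rule order_tendstoD) (use ell in simp)
    have "((\<lambda>y. norm (M' y - M y0)) \<longlongrightarrow> norm (M' y0 - M y0)) (nhds y0)" by (intro tendsto_intros t cont)
    then show "\<forall>\<^sub>F y in nhds y0. norm (M' y - M y0) < \<rho>"
      by (rule order_tendstoD) (use ell eq in \<open>simp add: M_def M'_def\<close>)
    show "\<forall>\<^sub>F y in nhds y0. \<kappa> < v' y"
      by (rule order_tendstoD(1)[OF t[OF cont(1)]]) (use kappa in \<open>simp add: \<kappa>_def\<close>)
    have "((\<lambda>y. norm (H y)) \<longlongrightarrow> norm (H y0)) (nhds y0)" by (intro tendsto_intros t cont)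
    then show "\<forall>\<^sub>F y in nhds y0. norm (H y) < B" by (rule order_tendstoD) (use B in simp)
    have "((\<lambda>y. norm (g y + g' y)) \<longlongrightarrow> norm (g y0 + g' y0)) (nhds y0)" by (intro tendsto_intros t cont)
    then show "\<forall>\<^sub>F y in nhds y0. norm (g y + g' y) < B" by (rule order_tendstoD) (use B in simp)
  qed
  then obtain \<eta>0 where e0: "\<eta>0 > 0" "\<And>y. dist y y0 < \<eta>0 \<Longrightarrow> y \<in> \<Omega> \<and> norm (M y - M y0) < \<rho> \<and>
     norm (M' y - M y0) < \<rho> \<and> \<kappa> < v' y \<and> norm (H y) < B \<and> norm (g y + g' y) < B"
    unfolding eventually_nhds_metric by blast
  define \<eta> where "\<eta> = min (\<eta>0 / 2) (s / 2)"
  have eta: "\<eta> > 0" "\<eta> < \<eta>0" "\<eta> \<le> s / 2" using e0(1) s by (auto simp: \<eta>_def)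
  have near: "y \<in> \<Omega>" "norm (M y - M y0) < \<rho>" "norm (M' y - M y0) < \<rho>" "\<kappa> < v' y" "norm (H y) < B"
      "norm (g y + g' y) < B" if "y \<in> cball y0 \<eta>" for y
    using e0(2)[of y] that eta by (auto simp: dist_commute)
  define T where "T = norm (mat 1 :: real^'n^'n)"
  have T: "T \<ge> 0" by (simp add: T_def)
  \<comment> \<open>The term quadratic in \<open>\<alpha>\<close> comes from ellipticity in the
    radial direction; it has to beat the trace and gradient terms, which are linear in
    \<open>\<alpha>\<close>, and the zeroth-order term.\<close>
  obtain \<alpha> where al: "\<alpha> > 0" "\<alpha>\<^sup>2 * (\<kappa> * \<theta> * s\<^sup>2) > \<alpha> * (2 * \<kappa> * \<Lambda> * T + B * s * \<Lambda> * T) + \<Lambda> * B"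
    using large_parameter[of "\<kappa> * \<theta> * s\<^sup>2" "2 * \<kappa> * \<Lambda> * T + B * s * \<Lambda> * T" "\<Lambda> * B"] kappa ell s B T by auto
  define E where "E = (\<lambda>y. exp (- \<alpha> * (norm (y - b))\<^sup>2))"
  define gh where "gh = (\<lambda>y. (- \<alpha> * E y) *\<^sub>R (2 *\<^sub>R (y - b)))"
  define Hh where "Hh = (\<lambda>y. (- \<alpha> * E y) *\<^sub>R (2 *\<^sub>R mat 1) + (\<alpha>\<^sup>2 * E y) *\<^sub>R outer (2 *\<^sub>R (y - b)) (2 *\<^sub>R (y - b)))"
  define e where "e = exp (- \<alpha> * s\<^sup>2)"
  define h where "h = (\<lambda>y. E y - (e + 0 \<bullet> y))"
  have C2h: "C2_on \<Omega> h gh Hh"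
    using C2_on_diff[OF C2_on_exp_barrier[of \<Omega> \<alpha> b] C2_on_linear[of \<Omega> e 0]]
    by (simp add: h_def E_def gh_def Hh_def)
  have E01: "0 < E y" "E y \<le> 1" for y using al by (auto simp: E_def)
  have h_le: "h y \<le> E y" for y by (simp add: h_def e_def)
  define D where "D = cball b s \<inter> cball y0 \<eta>"
  have cD: "compact D" "D \<subseteq> \<Omega>" using near(1) by (auto simp: D_def)
  have zD: "v y \<le> v' y" if "y \<in> D" for y
    using pos[OF sub[of y]] eq(1) that by (cases "y = y0") (auto simp: D_def)
  have cz: "continuous_on \<Omega> (\<lambda>y. v' y - v y)"
    by (intro continuous_intros C2_on_continuous[OF solutionD(1)[OF v]] C2_on_continuous[OF solutionD(1)[OF v']])
  \<comment> \<open>This cap stays away from \<open>y0\<close>, so the difference has a positive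
    lower bound on it; since \<open>h\<close> is at most 1, \<open>f\<close> is nonnegative on that
    part of the boundary.\<close>
  obtain \<epsilon> where eps: "\<epsilon> > 0" "\<And>y. y \<in> cball b s \<inter> sphere y0 \<eta> \<Longrightarrow> \<epsilon> \<le> v' y - v y"
  proof (cases "cball b s \<inter> sphere y0 \<eta> = {}")
    case True
    then show ?thesis using that[of 1] by auto
  next
    case False
    have "cball b s \<inter> sphere y0 \<eta> \<subseteq> \<Omega>" using near(1) by auto
    then have "continuous_on (cball b s \<inter> sphere y0 \<eta>) (\<lambda>y. v' y - v y)" using cz continuous_on_subset by blast
    then obtain z where z: "z \<in> cball b s \<inter> sphere y0 \<eta>"
        "\<And>y. y \<in> cball b s \<inter> sphere y0 \<eta> \<Longrightarrow> v' z - v z \<le> v' y - v y"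
      using continuous_attains_inf[of "cball b s \<inter> sphere y0 \<eta>" "\<lambda>y. v' y - v y"] False
      by (meson compact_Int compact_cball compact_sphere)
    have "v' z - v z > 0" using pos[OF sub[of z]] z(1) eta by auto
    then show ?thesis using that z(2) by blast
  qed
  define f where "f = (\<lambda>y. (v' y - v y) - \<epsilon> * h y)"
  have C2f: "C2_on \<Omega> f (\<lambda>y. (g' y - g y) - \<epsilon> *\<^sub>R gh y) (\<lambda>y. (H' y - H y) - \<epsilon> *\<^sub>R Hh y)"
    unfolding f_def
    by (intro C2_on_diff C2_on_scaleR C2h solutionD(1)[OF v] solutionD(1)[OF v'])
  \<comment> \<open>At a negative interior minimum \<open>z\<close> of \<open>f\<close>, the
    difference \<open>v' - v\<close> has the gradient of \<open>\<epsilon> * h\<close>, a Hessian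
    dominating that of \<open>\<epsilon> * h\<close>, and a smaller value. Inserted into the
    linearised equation, this contradicts the choice of \<open>\<alpha>\<close>.\<close>
  have f_nonneg: "0 \<le> f y" if yD: "y \<in> D" for y
  proof (rule ccontr)
    assume neg: "\<not> 0 \<le> f y"
    have "continuous_on D f" using C2_on_continuous(1)[OF C2f] cD continuous_on_subset by blast
    then obtain z where z: "z \<in> D" "\<And>y. y \<in> D \<Longrightarrow> f z \<le> f y"
      using continuous_attains_inf[OF cD(1), of f] yD by blast
    have fz: "f z < 0" using z(2)[OF yD] neg by simp
    have z0: "v z \<le> v' z" using zD z(1) by blast
    have "dist b z \<noteq> s"
    proof
      assume "dist b z = s"
      then have "h z = 0" by (simp add: h_def E_def e_def dist_norm norm_minus_commute)
      then show False using fz z0 by (simp add: f_def)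
    qed
    moreover have "dist y0 z \<noteq> \<eta>"
    proof
      assume "dist y0 z = \<eta>"
      then have "\<epsilon> \<le> v' z - v z" using eps(2)[of z] z(1) by (simp add: D_def)
      moreover have "\<epsilon> * h z \<le> \<epsilon> * 1" using h_le[of z] E01(2)[of z] eps(1) by (intro mult_left_mono) linarith+
      ultimately show False using fz by (simp add: f_def)
    qed
    ultimately have zi: "z \<in> ball b s \<inter> ball y0 \<eta>" using z(1) by (auto simp: D_def)
    have sD: "ball b s \<inter> ball y0 \<eta> \<subseteq> D" by (auto simp: D_def)
    have o: "open (ball b s \<inter> ball y0 \<eta>)" by auto
    have C2': "C2_on (ball b s \<inter> ball y0 \<eta>) f (\<lambda>y. (g' y - g y) - \<epsilon> *\<^sub>R gh y) (\<lambda>y. (H' y - H y) - \<epsilon> *\<^sub>R Hh y)"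
      using C2_on_subset[OF C2f] sD cD by blast
    have grad: "g' z - g z = \<epsilon> *\<^sub>R gh z"
      using second_derivative_test(1)[OF C2' o zi] z(2) sD by (simp add: subset_iff)
    have hess: "0 \<le> x \<bullet> (((H' z - H z) - \<epsilon> *\<^sub>R Hh z) *v x)" for x
      using second_derivative_test(2)[OF C2' o zi, of x] z(2) sD by (simp add: subset_iff)
    have zO: "z \<in> \<Omega>" "z \<in> cball y0 \<eta>" using z(1) cD by (auto simp: D_def)
    define N where "N = M' z - M z"
    have sym: "M z \<in> sym_mats" "M' z \<in> sym_mats" using M_U zO U_sym by auto
    have N_sym: "N \<in> sym_mats" unfolding N_def using sym by (intro subspace_diff sym_mats_subspace)
    have segm: "M z + t *\<^sub>R N \<in> sym_mats \<and> norm (M z + t *\<^sub>R N - M y0) < \<rho>" if "0 \<le> t" "t \<le> 1" for t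
    proof
      show "M z + t *\<^sub>R N \<in> sym_mats" by (intro subspace_add subspace_scale sym_mats_subspace sym N_sym)
      have "M z \<in> ball (M y0) \<rho>" "M' z \<in> ball (M y0) \<rho>"
        using near(2,3)[OF zO(2)] by (auto simp: dist_norm norm_minus_commute)
      then have "(1 - t) *\<^sub>R M z + t *\<^sub>R M' z \<in> ball (M y0) \<rho>"
        using convex_ball[of "M y0" \<rho>] that unfolding convex_alt by blast
      moreover have "(1 - t) *\<^sub>R M z + t *\<^sub>R M' z = M z + t *\<^sub>R N" by (simp add: N_def algebra_simps)
      ultimately show "norm (M z + t *\<^sub>R N - M y0) < \<rho>" by (simp add: dist_norm norm_minus_commute)
    qed
    obtain t where t: "0 < t" "t < 1" "F (M z + N) - F (M z) = matrix_deriv U F (M z + t *\<^sub>R N) \<bullet> N"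
      using F_mean_value[of "M z" N] segm ell(4) N_sym by blast
    define a where "a = matrix_deriv U F (M z + t *\<^sub>R N)"
    have aU: "M z + t *\<^sub>R N \<in> U" and a_norm: "norm a \<le> \<Lambda>" and a_ell: "\<And>x. \<theta> * (norm x)\<^sup>2 \<le> x \<bullet> (a *v x)"
      using ell(4)[of "M z + t *\<^sub>R N"] segm[of t] t by (auto simp: a_def)
    have "a \<bullet> N = 0" using t(3) M_U[OF zO(1)] by (simp add: a_def N_def)
    then have eq0: "v' z * (a \<bullet> (H' z - H z)) + (v' z - v z) * (a \<bullet> H z)
        - (((g z + g' z) \<bullet> (g' z - g z)) / 2) * (a \<bullet> mat 1) = 0"
      unfolding N_def M_def M'_def schouten_diff by (simp add: inner_diff_right inner_add_right)
    have bnd: "\<bar>a \<bullet> X\<bar> \<le> \<Lambda> * norm X" for X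
      using order_trans[OF Cauchy_Schwarz_ineq2[of a X] mult_right_mono[OF a_norm, of "norm X"]] by simp
    have W_sym: "(H' z - H z) - \<epsilon> *\<^sub>R Hh z \<in> sym_mats"
    proof -
      have "outer (2 *\<^sub>R (z - b)) (2 *\<^sub>R (z - b)) \<in> sym_mats"
        by (simp add: sym_mats_def transpose_def outer_def vec_eq_iff)
      then have "Hh z \<in> sym_mats" unfolding Hh_def
        by (intro subspace_add subspace_scale sym_mats_subspace mat_1_sym)
      then show ?thesis
        by (intro subspace_diff subspace_scale sym_mats_subspace solution_hess_sym[OF v zO(1)] solution_hess_sym[OF v' zO(1)])
    qed
    have "0 \<le> a \<bullet> ((H' z - H z) - \<epsilon> *\<^sub>R Hh z)"
      unfolding a_def by (rule pos_def_inner_psd(1)[OF F_pos_def[OF aU] W_sym hess])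
    then have 1: "\<epsilon> * (a \<bullet> Hh z) \<le> a \<bullet> (H' z - H z)" by (simp add: inner_diff_right)
    have zb: "s / 2 \<le> norm (z - b)" "norm (z - b) \<le> s"
    proof -
      have "dist b y0 \<le> dist b z + dist z y0" by (rule dist_triangle)
      moreover have "dist z y0 \<le> s / 2" using zO(2) eta by (simp add: dist_commute)
      ultimately have "s / 2 \<le> dist b z" using ds by simp
      then show "s / 2 \<le> norm (z - b)" by (simp add: dist_norm norm_minus_commute)
      show "norm (z - b) \<le> s" using zi by (simp add: dist_norm norm_minus_commute)
    qed
    \<comment> \<open>\<open>E z * A\<close> will be a lower bound for the second-order part
      \<open>a \<bullet> Hh z\<close>, because \<open>norm (z - b)\<close> is at least
      \<open>s / 2\<close>.\<close>
    define A where "A = \<alpha>\<^sup>2 * \<theta> * s\<^sup>2 - 2 * \<alpha> * \<Lambda> * T"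
    have A: "\<kappa> * A > \<alpha> * B * s * \<Lambda> * T + \<Lambda> * B"
      using al(2) by (simp add: A_def algebra_simps)
    have "0 \<le> \<alpha> * B * s * \<Lambda> * T + \<Lambda> * B" using al(1) B(1) s ell T by simp
    then have "0 < \<kappa> * A" using A by linarith
    then have A0: "0 < A" using kappa by (simp add: zero_less_mult_iff)
    have 2: "E z * A \<le> a \<bullet> Hh z"
    proof -
      have "(s / 2)\<^sup>2 \<le> (norm (z - b))\<^sup>2" using zb s by (intro power_mono) auto
      then have "\<theta> * (s / 2)\<^sup>2 \<le> \<theta> * (norm (z - b))\<^sup>2" using ell(2) by (intro mult_left_mono) auto
      also have "\<dots> \<le> (z - b) \<bullet> (a *v (z - b))" by (rule a_ell)
      finally have "\<theta> * s\<^sup>2 \<le> 4 * ((z - b) \<bullet> (a *v (z - b)))" by (simp add: power2_eq_square)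
      then have 3: "\<alpha>\<^sup>2 * (\<theta> * s\<^sup>2) \<le> \<alpha>\<^sup>2 * (4 * ((z - b) \<bullet> (a *v (z - b))))" by (intro mult_left_mono) auto
      have "2 * \<alpha> * (a \<bullet> mat 1) \<le> 2 * \<alpha> * (\<Lambda> * T)"
        using bnd[of "mat 1"] al(1) by (intro mult_left_mono) (auto simp: T_def)
      then have "A \<le> \<alpha>\<^sup>2 * (4 * ((z - b) \<bullet> (a *v (z - b)))) - 2 * \<alpha> * (a \<bullet> mat 1)"
        using 3 by (simp add: A_def)
      then have "E z * A \<le> E z * (\<alpha>\<^sup>2 * (4 * ((z - b) \<bullet> (a *v (z - b)))) - 2 * \<alpha> * (a \<bullet> mat 1))"
        using E01(1)[of z] by (intro mult_left_mono) auto
      also have "\<dots> = a \<bullet> Hh z"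
        by (simp add: Hh_def inner_add_right inner_outer matrix_vector_mult_scaleR algebra_simps)
      finally show ?thesis .
    qed
    define Y where "Y = \<epsilon> * E z"
    have Y: "Y > 0" using eps(1) E01(1) by (simp add: Y_def)
    have "\<kappa> * (Y * A) \<le> v' z * (a \<bullet> (H' z - H z))"
    proof -
      have "\<epsilon> * (E z * A) \<le> \<epsilon> * (a \<bullet> Hh z)" using 2 eps(1) by (intro mult_left_mono) auto
      then have "Y * A \<le> a \<bullet> (H' z - H z)" using 1 by (simp add: Y_def mult.assoc)
      then show ?thesis using near(4)[OF zO(2)] kappa Y A0 by (intro mult_mono) auto
    qed
    moreover have "- (Y * (\<Lambda> * B)) \<le> (v' z - v z) * (a \<bullet> H z)"
    proof -
      have "\<bar>a \<bullet> H z\<bar> \<le> \<Lambda> * B"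
        using order_trans[OF bnd[of "H z"] mult_left_mono[of "norm (H z)" B \<Lambda>]] near(5)[OF zO(2)] ell(3) by simp
      moreover have "v' z - v z \<le> Y"
      proof -
        have "v' z - v z \<le> \<epsilon> * h z" using fz by (simp add: f_def)
        also have "\<dots> \<le> \<epsilon> * E z" using h_le eps(1) by (intro mult_left_mono) auto
        finally show ?thesis by (simp add: Y_def)
      qed
      ultimately have "\<bar>(v' z - v z) * (a \<bullet> H z)\<bar> \<le> Y * (\<Lambda> * B)"
        unfolding abs_mult using z0 Y by (intro mult_mono) auto
      then show ?thesis by linarith
    qed
    moreover have "(((g z + g' z) \<bullet> (g' z - g z)) / 2) * (a \<bullet> mat 1) \<le> Y * (\<alpha> * B * s * \<Lambda> * T)"
    proof -
      have "(g z + g' z) \<bullet> (g' z - g z) / 2 = - (Y * \<alpha>) * ((g z + g' z) \<bullet> (z - b))"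
        unfolding grad gh_def by (simp add: Y_def)
      then have "\<bar>(g z + g' z) \<bullet> (g' z - g z) / 2\<bar> = (Y * \<alpha>) * \<bar>(g z + g' z) \<bullet> (z - b)\<bar>"
        using Y al(1) by (simp add: abs_mult)
      also have "\<dots> \<le> (Y * \<alpha>) * (B * s)"
      proof (rule mult_left_mono)
        have "\<bar>(g z + g' z) \<bullet> (z - b)\<bar> \<le> norm (g z + g' z) * norm (z - b)" by (rule Cauchy_Schwarz_ineq2)
        also have "\<dots> \<le> B * s" using near(6)[OF zO(2)] zb B by (intro mult_mono) auto
        finally show "\<bar>(g z + g' z) \<bullet> (z - b)\<bar> \<le> B * s" .
      qed (use Y al in auto)
      finally have "\<bar>((g z + g' z) \<bullet> (g' z - g z) / 2) * (a \<bullet> mat 1)\<bar> \<le> ((Y * \<alpha>) * (B * s)) * (\<Lambda> * T)"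
        unfolding abs_mult[of "(g z + g' z) \<bullet> (g' z - g z) / 2"] using bnd[of "mat 1"] Y al(1) B(1) s
        by (intro mult_mono) (auto simp: T_def)
      then show ?thesis by (simp add: mult_ac)
    qed
    ultimately have "\<kappa> * (Y * A) - Y * (\<Lambda> * B) - Y * (\<alpha> * B * s * \<Lambda> * T) \<le> 0" using eq0 by linarith
    then have "Y * (\<kappa> * A - (\<alpha> * B * s * \<Lambda> * T + \<Lambda> * B)) \<le> 0" by (simp add: algebra_simps)
    then show False using A Y by (simp add: mult_le_0_iff)
  qed
  \<comment> \<open>From \<open>y0\<close> towards the centre \<open>b\<close> the barrier increases
    to first order, while \<open>v' - v\<close> has derivative 0; so \<open>f\<close> would become
    negative.\<close>
  define w where "w = b - y0"
  have nw: "norm w = s" using ds by (simp add: w_def dist_norm)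
  have line: "((\<lambda>t. y0 + t *\<^sub>R w) has_derivative (\<lambda>t. t *\<^sub>R w)) (at 0)"
    by (auto intro!: derivative_eq_intros)
  have "((\<lambda>t. f (y0 + t *\<^sub>R w)) has_derivative (\<lambda>t. ((g' y0 - g y0) - \<epsilon> *\<^sub>R gh y0) \<bullet> (t *\<^sub>R w))) (at 0)"
    using has_derivative_compose[OF line, of f "\<lambda>k. ((g' y0 - g y0) - \<epsilon> *\<^sub>R gh y0) \<bullet> k"]
      C2_onD(1)[OF C2f y0(1)] by simp
  moreover have "((g' y0 - g y0) - \<epsilon> *\<^sub>R gh y0) \<bullet> (t *\<^sub>R w) = (- (2 * \<epsilon> * \<alpha> * E y0 * s\<^sup>2)) * t" for t
  proof -
    have "y0 - b = - w" by (simp add: w_def)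
    then show ?thesis using eq(2) nw[symmetric]
      by (simp add: gh_def dot_square_norm)
  qed
  ultimately have "((\<lambda>t. f (y0 + t *\<^sub>R w)) has_real_derivative (- (2 * \<epsilon> * \<alpha> * E y0 * s\<^sup>2))) (at 0)"
    unfolding has_field_derivative_def by (simp only:)
  moreover have "- (2 * \<epsilon> * \<alpha> * E y0 * s\<^sup>2) < 0" using eps(1) al(1) E01(1)[of y0] s by simp
  ultimately obtain \<tau> where tau: "\<tau> > 0" "\<And>t. 0 < t \<Longrightarrow> t < \<tau> \<Longrightarrow> f (y0 + (0 + t) *\<^sub>R w) < f (y0 + 0 *\<^sub>R w)"
    using DERIV_neg_dec_right by blast
  define t where "t = min (\<tau> / 2) (min 1 (\<eta> / s))"
  have "t \<le> \<tau> / 2" unfolding t_def by (rule min.cobounded1)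
  moreover have "t \<le> 1" "t \<le> \<eta> / s" unfolding t_def by linarith+
  moreover have "0 < t" using tau(1) eta(1) s by (simp add: t_def)
  ultimately have t: "0 < t" "t \<le> \<tau> / 2" "t \<le> 1" "t \<le> \<eta> / s" by blast+
  then have ts: "t < \<tau>" "t * s \<le> \<eta>" using s tau(1) by (simp_all add: pos_le_divide_eq)
  have "norm ((1 - t) *\<^sub>R w) \<le> s" using t nw s by (simp add: mult_left_le_one_le)
  moreover have "b - (y0 + t *\<^sub>R w) = (1 - t) *\<^sub>R w" by (simp add: w_def algebra_simps)
  moreover have "norm (t *\<^sub>R w) \<le> \<eta>" using t(1) ts(2) nw by simp
  ultimately have "y0 + t *\<^sub>R w \<in> D" by (simp add: D_def dist_norm)
  then have "0 \<le> f (y0 + t *\<^sub>R w)" by (rule f_nonneg)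
  moreover have "f y0 = 0" using eq(1) ds by (simp add: f_def h_def E_def e_def dist_norm norm_minus_commute)
  ultimately show False using tau(2)[of t] t(1) ts by simp
qed

text \<open>\<open>v' - v\<close> has the minimum 0 at \<open>y0\<close>, so the gradients agree and
  the Hessians are ordered. Both matrices lie on the level 1 of \<open>F\<close> and differ by a
  semidefinite matrix, which \<open>comparable_level_points_eq\<close> forces to be 0.\<close>

lemma touching_solutions:
  assumes \<Omega>: "open \<Omega>" and v: "solution \<Omega> v g H" and v': "solution \<Omega> v' g' H'"
    and le: "\<And>y. y \<in> \<Omega> \<Longrightarrow> v y \<le> v' y" and y0: "y0 \<in> \<Omega>" "v y0 = v' y0"
  shows "g y0 = g' y0" "schouten (v y0) (g y0) (H y0) = schouten (v' y0) (g' y0) (H' y0)"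
proof -
  note C2 = C2_on_diff[OF solutionD(1)[OF v'] solutionD(1)[OF v]]
  have min: "v' y0 - v y0 \<le> v' y - v y" if "y \<in> \<Omega>" for y using le[OF that] y0(2) by simp
  show g: "g y0 = g' y0" using second_derivative_test(1)[OF C2 \<Omega> y0(1) min] by simp
  let ?N = "v y0 *\<^sub>R (H' y0 - H y0)"
  have e: "schouten (v' y0) (g' y0) (H' y0) = schouten (v y0) (g y0) (H y0) + ?N"
    unfolding schouten_def g y0(2) by (simp add: algebra_simps)
  have psd: "0 \<le> x \<bullet> (?N *v x)" for x
    using second_derivative_test(2)[OF C2 \<Omega> y0(1) min, of x] solutionD(2)[OF v y0(1)]
    by (simp add: scaleR_matrix_vector_assoc[symmetric])
  have "?N = 0"
    by (rule comparable_level_points_eq[of "schouten (v y0) (g y0) (H y0)"])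
       (use solutionD[OF v] solutionD[OF v'] y0(1) psd in \<open>simp_all flip: e\<close>)
  with e show "schouten (v y0) (g y0) (H y0) = schouten (v' y0) (g' y0) (H' y0)" by simp
qed

text \<open>The contact set is relatively closed. It is also open: a ball about a nearby non-contact
  point, grown until it first meets the contact set, would contradict \<open>hopf\<close>.\<close>

lemma strong_maximum_principle:
  assumes \<Omega>: "open \<Omega>" "connected \<Omega>" and v: "solution \<Omega> v g H" and v': "solution \<Omega> v' g' H'"
    and le: "\<And>y. y \<in> \<Omega> \<Longrightarrow> v y \<le> v' y" and p: "p \<in> \<Omega>" "v p < v' p" and y: "y \<in> \<Omega>"
  shows "v y < v' y"
proof (rule ccontr)
  assume "\<not> v y < v' y"
  then have yz: "v y = v' y" using le[OF y] by simp
  define Z where "Z = {y \<in> \<Omega>. v' y - v y \<in> {0}}"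
  have cz: "continuous_on \<Omega> (\<lambda>y. v' y - v y)"
    by (intro continuous_intros C2_on_continuous[OF solutionD(1)[OF v]] C2_on_continuous[OF solutionD(1)[OF v']])
  then have cl: "closedin (top_of_set \<Omega>) Z" unfolding Z_def
    using continuous_closedin_preimage[OF cz, of "{0}"] by (simp add: vimage_def Int_def)
  have "\<exists>e>0. ball z e \<subseteq> Z" if z: "z \<in> Z" for z
  proof -
    have zO: "z \<in> \<Omega>" "v z = v' z" using z by (auto simp: Z_def)
    obtain R where R: "R > 0" "ball z R \<subseteq> \<Omega>" using \<Omega>(1) zO(1) openE by blast
    have "ball z (R / 4) \<subseteq> Z"
    proof
      fix c assume c: "c \<in> ball z (R / 4)"
      show "c \<in> Z"
      proof (rule ccontr)
        assume cZ: "c \<notin> Z"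
        \<comment> \<open>Restricting to a closed ball ensures that a nearest contact point exists.
          As \<open>c\<close> is within \<open>R / 4\<close> of \<open>z\<close>, the ball about
          \<open>c\<close> reaching that point stays within \<open>R / 2\<close> of
          \<open>z\<close>, so no contact point inside it is overlooked.\<close>
        define K where "K = {y \<in> cball z (3 * R / 4). v' y - v y \<in> {0}}"
        have "cball z (3 * R / 4) \<subseteq> \<Omega>" using R by (force simp: subset_iff)
        then have cK: "continuous_on (cball z (3 * R / 4)) (\<lambda>y. v' y - v y)" using cz continuous_on_subset by blast
        have "closed K" unfolding K_def
          using continuous_closed_preimage[OF cK closed_cball closed_singleton[of 0]] by (simp add: vimage_def Int_def)
        moreover have zK: "z \<in> K" using zO R(1) by (simp add: K_def)
        ultimately obtain y0 where y0: "y0 \<in> K" "\<And>y. y \<in> K \<Longrightarrow> dist c y0 \<le> dist c y"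
          using distance_attains_inf[of K c] by blast
        have KZ: "K \<subseteq> Z" using \<open>cball z (3 * R / 4) \<subseteq> \<Omega>\<close> by (auto simp: K_def Z_def)
        have y0': "y0 \<in> \<Omega>" "v y0 = v' y0" using y0(1) KZ by (auto simp: Z_def)
        note t = touching_solutions[OF \<Omega>(1) v v' le y0']
        show False
        proof (rule hopf[OF \<Omega>(1) v v' y0'(1) refl _ _ y0'(2) t])
          show "0 < dist c y0" using cZ y0(1) KZ by auto
          fix y assume y: "y \<in> ball c (dist c y0)"
          have "dist c y0 \<le> dist c z" using y0(2) zK by blast
          also have "\<dots> < R / 4" using c by (simp add: dist_commute)
          finally have "dist c y < R / 4" using y by simp
          then have "dist z y < R" using dist_triangle[of z y c] c R(1) by simp
          then have yO: "y \<in> \<Omega>" using R(2) by auto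
          moreover have "v y < v' y"
          proof (rule ccontr)
            assume "\<not> v y < v' y"
            then have "v y = v' y" using le[OF yO] by simp
            moreover have "dist z y \<le> 3 * R / 4" using dist_triangle[of z y c] c \<open>dist c y < R / 4\<close> R(1) by (simp add: field_simps)
            ultimately have "y \<in> K" by (simp add: K_def)
            then show False using y0(2)[of y] y by simp
          qed
          ultimately show "y \<in> \<Omega> \<and> v y < v' y" by simp
        qed
      qed
    qed
    then show ?thesis using R by (intro exI[of _ "R / 4"]) auto
  qed
  then have "open Z" by (simp add: open_contains_ball)
  then have "openin (top_of_set \<Omega>) Z" by (auto simp: Z_def openin_open)
  then have "Z = {} \<or> Z = \<Omega>" using \<Omega>(2) cl unfolding connected_clopen by blast
  moreover have "y \<in> Z" "p \<notin> Z" using y yz p by (auto simp: Z_def)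
  ultimately show False using p(1) by blast
qed

end

subsection \<open>The Kelvin transform\<close>

definition inversion :: "real^'n \<Rightarrow> real \<Rightarrow> real^'n \<Rightarrow> real^'n" where
  "inversion x \<mu> y = x + (\<mu>\<^sup>2 / (norm (y - x))\<^sup>2) *\<^sub>R (y - x)"

definition kelvin :: "real^'n \<Rightarrow> real \<Rightarrow> (real^'n \<Rightarrow> real) \<Rightarrow> real^'n \<Rightarrow> real" where
  "kelvin x \<mu> v y = (norm (y - x))\<^sup>2 / \<mu>\<^sup>2 * v (inversion x \<mu> y)"

definition kelvin_grad :: "real^'n \<Rightarrow> real \<Rightarrow> (real^'n \<Rightarrow> real) \<Rightarrow> (real^'n \<Rightarrow> real^'n) \<Rightarrow> real^'n \<Rightarrow> real^'n" where
  "kelvin_grad x \<mu> v g y = (2 * v (inversion x \<mu> y) / \<mu>\<^sup>2) *\<^sub>R (y - x) + refl_mat (y - x) *v g (inversion x \<mu> y)"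

text \<open>The rank-one terms of the product rule cancel, leaving a multiple of the identity and a
  conjugate of the Hessian; \<open>schouten\<close> turns this form into a pure conjugation.\<close>

definition kelvin_hess :: "real^'n \<Rightarrow> real \<Rightarrow> (real^'n \<Rightarrow> real) \<Rightarrow> (real^'n \<Rightarrow> real^'n) \<Rightarrow> (real^'n \<Rightarrow> real^'n^'n) \<Rightarrow> real^'n \<Rightarrow> real^'n^'n" where
  "kelvin_hess x \<mu> v g H y =
     (2 * v (inversion x \<mu> y) / \<mu>\<^sup>2 - 2 * ((y - x) \<bullet> g (inversion x \<mu> y)) / (norm (y - x))\<^sup>2) *\<^sub>R mat 1
     + (\<mu>\<^sup>2 / (norm (y - x))\<^sup>2) *\<^sub>R (refl_mat (y - x) ** H (inversion x \<mu> y) ** refl_mat (y - x))"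

lemma inversion_has_derivative:
  assumes "y \<noteq> x"
  shows "(inversion x \<mu> has_derivative (\<lambda>h. (\<mu>\<^sup>2 / (norm (y - x))\<^sup>2) *\<^sub>R (refl_mat (y - x) *v h))) (at y)"
proof -
  have nz: "(y - x) \<bullet> (y - x) \<noteq> 0" using assms by simp
  have "(inversion x \<mu> has_derivative
     (\<lambda>h. (\<mu>\<^sup>2 / ((y - x) \<bullet> (y - x))) *\<^sub>R h + (- (\<mu>\<^sup>2 * (2 * ((y - x) \<bullet> h))) / ((y - x) \<bullet> (y - x))\<^sup>2) *\<^sub>R (y - x))) (at y)"
    unfolding inversion_def[abs_def] power2_norm_eq_inner using nz
    by (auto intro!: derivative_eq_intros ext simp: inner_commute power2_eq_square divide_simps)
  moreover have "(\<mu>\<^sup>2 / ((y - x) \<bullet> (y - x))) *\<^sub>R h + (- (\<mu>\<^sup>2 * (2 * ((y - x) \<bullet> h))) / ((y - x) \<bullet> (y - x))\<^sup>2) *\<^sub>R (y - x)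
     = (\<mu>\<^sup>2 / (norm (y - x))\<^sup>2) *\<^sub>R (refl_mat (y - x) *v h)" for h
    unfolding refl_mat_mult power2_norm_eq_inner
    by (simp add: scaleR_diff_right power2_eq_square)
  ultimately show ?thesis by simp
qed

lemma refl_mat_inner: "(refl_mat e *v p) \<bullet> q = p \<bullet> (refl_mat e *v q)"
  unfolding refl_mat_mult by (simp add: inner_diff_left inner_diff_right inner_commute)

lemma kelvin_has_derivative:
  assumes y: "y \<noteq> x" and \<mu>: "\<mu> > 0"
    and v: "(v has_derivative (\<lambda>h. g (inversion x \<mu> y) \<bullet> h)) (at (inversion x \<mu> y))"
  shows "(kelvin x \<mu> v has_derivative (\<lambda>h. kelvin_grad x \<mu> v g y \<bullet> h)) (at y)"
proof -
  let ?T = "inversion x \<mu> y"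
  have nz: "(norm (y - x))\<^sup>2 \<noteq> 0" using y by simp
  have 1: "((\<lambda>y. v (inversion x \<mu> y)) has_derivative
      (\<lambda>h. g ?T \<bullet> ((\<mu>\<^sup>2 / (norm (y - x))\<^sup>2) *\<^sub>R (refl_mat (y - x) *v h)))) (at y)"
    using has_derivative_compose[OF inversion_has_derivative[OF y] v] .
  have 2: "((\<lambda>y. (norm (y - x))\<^sup>2 / \<mu>\<^sup>2) has_derivative (\<lambda>h. 2 * ((y - x) \<bullet> h) / \<mu>\<^sup>2)) (at y)"
    unfolding power2_norm_eq_inner
    by (rule bounded_linear.has_derivative[OF bounded_linear_divide])
       (auto intro!: derivative_eq_intros simp: inner_commute)
  show ?thesis unfolding kelvin_def[abs_def]
  proof (rule has_derivative_eq_rhs[OF has_derivative_mult[OF 2 1]], rule ext)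
    fix h
    have "(norm (y - x))\<^sup>2 / \<mu>\<^sup>2 * (g ?T \<bullet> ((\<mu>\<^sup>2 / (norm (y - x))\<^sup>2) *\<^sub>R (refl_mat (y - x) *v h)))
        = g ?T \<bullet> (refl_mat (y - x) *v h)" using nz \<mu> by simp
    then show "(norm (y - x))\<^sup>2 / \<mu>\<^sup>2 * (g ?T \<bullet> ((\<mu>\<^sup>2 / (norm (y - x))\<^sup>2) *\<^sub>R (refl_mat (y - x) *v h)))
        + 2 * ((y - x) \<bullet> h) / \<mu>\<^sup>2 * v ?T = kelvin_grad x \<mu> v g y \<bullet> h"
      by (simp add: kelvin_grad_def inner_add_left refl_mat_inner)
  qed
qed

lemma kelvin_grad_has_derivative:
  assumes y: "y \<noteq> x" and \<mu>: "\<mu> > 0"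
    and v: "(v has_derivative (\<lambda>h. g (inversion x \<mu> y) \<bullet> h)) (at (inversion x \<mu> y))"
    and g: "(g has_derivative (\<lambda>h. H (inversion x \<mu> y) *v h)) (at (inversion x \<mu> y))"
  shows "(kelvin_grad x \<mu> v g has_derivative (\<lambda>h. kelvin_hess x \<mu> v g H y *v h)) (at y)"
proof -
  let ?T = "inversion x \<mu> y"
  let ?c = "\<mu>\<^sup>2 / (norm (y - x))\<^sup>2"
  let ?R = "refl_mat (y - x)"
  define e where "e = y - x"
  have e0: "e \<bullet> e \<noteq> 0" using y by (simp add: e_def)
  have ce: "?c = \<mu>\<^sup>2 / (e \<bullet> e)" by (simp add: e_def power2_norm_eq_inner)
  have 1: "((\<lambda>y. v (inversion x \<mu> y)) has_derivative (\<lambda>h. g ?T \<bullet> (?c *\<^sub>R (?R *v h)))) (at y)"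
    using has_derivative_compose[OF inversion_has_derivative[OF y] v] .
  have 2: "((\<lambda>y. g (inversion x \<mu> y)) has_derivative (\<lambda>h. H ?T *v (?c *\<^sub>R (?R *v h)))) (at y)"
    using has_derivative_compose[OF inversion_has_derivative[OF y] g] .
  have 3: "((\<lambda>y. (2 * v (inversion x \<mu> y) / \<mu>\<^sup>2) *\<^sub>R (y - x)) has_derivative
      (\<lambda>h. (2 * v ?T / \<mu>\<^sup>2) *\<^sub>R h + (2 * (g ?T \<bullet> (?c *\<^sub>R (?R *v h))) / \<mu>\<^sup>2) *\<^sub>R e)) (at y)"
    unfolding e_def
    by (rule has_derivative_eq_rhs[OF has_derivative_scaleR[OF
          bounded_linear.has_derivative[OF bounded_linear_divide has_derivative_mult_right[OF 1]]]])
       (auto intro!: derivative_eq_intros)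
  have 4: "((\<lambda>y. 2 * ((y - x) \<bullet> g (inversion x \<mu> y)) / ((y - x) \<bullet> (y - x))) has_derivative
      (\<lambda>h. 2 * (h \<bullet> g ?T + e \<bullet> (H ?T *v (?c *\<^sub>R (?R *v h)))) / (e \<bullet> e)
        - 2 * (e \<bullet> g ?T) * (2 * (e \<bullet> h)) / (e \<bullet> e)\<^sup>2)) (at y)"
  proof -
    have q: "(2 * n * d - 2 * a * d') / (d * d) = 2 * n / d - 2 * a * d' / d\<^sup>2" if "d \<noteq> 0" for n a d d' :: real
      using that by (simp add: field_simps power2_eq_square)
    have lin: "((\<lambda>y. y - x) has_derivative (\<lambda>h. h)) (at y)" by (auto intro!: derivative_eq_intros)
    have "((\<lambda>y. 2 * ((y - x) \<bullet> g (inversion x \<mu> y))) has_derivative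
        (\<lambda>h. 2 * (h \<bullet> g ?T + e \<bullet> (H ?T *v (?c *\<^sub>R (?R *v h)))))) (at y)"
      by (rule has_derivative_mult_right[OF has_derivative_eq_rhs[OF has_derivative_inner[OF lin 2]]])
        (simp add: e_def add.commute)
    moreover have "((\<lambda>y. (y - x) \<bullet> (y - x)) has_derivative (\<lambda>h. 2 * (e \<bullet> h))) (at y)"
      by (rule has_derivative_eq_rhs[OF has_derivative_inner[OF lin lin]]) (simp add: e_def inner_commute)
    ultimately show ?thesis
      using e0 unfolding e_def by (rule has_derivative_eq_rhs[OF has_derivative_divide'])
        (rule ext, rule q[OF e0[unfolded e_def]])
  qed
  have r: "(\<lambda>y. refl_mat (y - x) *v g (inversion x \<mu> y)) = (\<lambda>y. g (inversion x \<mu> y)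
      - (2 * ((y - x) \<bullet> g (inversion x \<mu> y)) / ((y - x) \<bullet> (y - x))) *\<^sub>R (y - x))"
    by (simp only: refl_mat_mult)
  have 5: "((\<lambda>y. refl_mat (y - x) *v g (inversion x \<mu> y)) has_derivative
     (\<lambda>h. H ?T *v (?c *\<^sub>R (?R *v h)) - ((2 * (e \<bullet> g ?T) / (e \<bullet> e)) *\<^sub>R h +
       (2 * (h \<bullet> g ?T + e \<bullet> (H ?T *v (?c *\<^sub>R (?R *v h)))) / (e \<bullet> e)
        - 2 * (e \<bullet> g ?T) * (2 * (e \<bullet> h)) / (e \<bullet> e)\<^sup>2) *\<^sub>R e))) (at y)"
    unfolding r
    by (rule has_derivative_diff[OF 2 has_derivative_eq_rhs[OF has_derivative_scaleR[OF 4]]])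
       (auto intro!: derivative_eq_intros simp: e_def)
  show ?thesis unfolding kelvin_grad_def[abs_def]
  proof (rule has_derivative_eq_rhs[OF has_derivative_add[OF 3 5]], rule ext)
    fix h
    define p where "p = g ?T"
    define w where "w = ?c *\<^sub>R (H ?T *v (?R *v h))"
    have w: "H ?T *v (?c *\<^sub>R (?R *v h)) = w" by (simp add: w_def matrix_vector_mult_scaleR)
    have pR: "p \<bullet> (?R *v h) = p \<bullet> h - 2 * (e \<bullet> h) * (e \<bullet> p) / (e \<bullet> e)"
      unfolding refl_mat_mult e_def[symmetric] by (simp add: inner_diff_right inner_commute)
    have "2 * (p \<bullet> (?c *\<^sub>R (?R *v h))) / \<mu>\<^sup>2 = 2 * (p \<bullet> (?R *v h)) / (e \<bullet> e)"
      using \<mu> by (simp add: ce)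
    also have "\<dots> = 2 * (p \<bullet> h) / (e \<bullet> e) - 4 * (e \<bullet> h) * (e \<bullet> p) / (e \<bullet> e)\<^sup>2"
      unfolding pR using e0 by (simp add: power2_eq_square divide_simps)
    finally have a: "2 * (p \<bullet> (?c *\<^sub>R (?R *v h))) / \<mu>\<^sup>2 = 2 * (p \<bullet> h) / (e \<bullet> e) - 4 * (e \<bullet> h) * (e \<bullet> p) / (e \<bullet> e)\<^sup>2" .
    \<comment> \<open>The bracket is the coefficient computed in \<open>a\<close> and cancels
      against it; the remaining term completes \<open>w\<close> to its reflection.\<close>
    have b: "2 * (h \<bullet> p + e \<bullet> w) / (e \<bullet> e) - 2 * (e \<bullet> p) * (2 * (e \<bullet> h)) / (e \<bullet> e)\<^sup>2
        = (2 * (p \<bullet> h) / (e \<bullet> e) - 4 * (e \<bullet> h) * (e \<bullet> p) / (e \<bullet> e)\<^sup>2) + 2 * (e \<bullet> w) / (e \<bullet> e)"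
      by (simp add: inner_commute[of h p] add_divide_distrib mult_ac)
    have Rw: "?R *v w = w - (2 * (e \<bullet> w) / (e \<bullet> e)) *\<^sub>R e" unfolding refl_mat_mult e_def ..
    have "kelvin_hess x \<mu> v g H y *v h = (2 * v ?T / \<mu>\<^sup>2 - 2 * (e \<bullet> p) / (e \<bullet> e)) *\<^sub>R h + ?R *v w"
      unfolding kelvin_hess_def w_def p_def e_def power2_norm_eq_inner
      by (simp add: matrix_vector_mult_add_rdistrib scaleR_matrix_vector_assoc[symmetric] matrix_vector_mul_assoc[symmetric] matrix_vector_mult_scaleR)
    then show "(2 * v ?T / \<mu>\<^sup>2) *\<^sub>R h + (2 * (g ?T \<bullet> (?c *\<^sub>R (?R *v h))) / \<mu>\<^sup>2) *\<^sub>R e +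
       (H ?T *v (?c *\<^sub>R (?R *v h)) - ((2 * (e \<bullet> g ?T) / (e \<bullet> e)) *\<^sub>R h +
       (2 * (h \<bullet> g ?T + e \<bullet> (H ?T *v (?c *\<^sub>R (?R *v h)))) / (e \<bullet> e)
        - 2 * (e \<bullet> g ?T) * (2 * (e \<bullet> h)) / (e \<bullet> e)\<^sup>2) *\<^sub>R e)) = kelvin_hess x \<mu> v g H y *v h"
      unfolding p_def[symmetric] w a b Rw by (simp add: scaleR_diff_left scaleR_add_left)
  qed
qed

lemma inversion_continuous: "continuous_on (- {x}) (inversion x \<mu>)"
  unfolding inversion_def[abs_def] by (intro continuous_intros) auto

lemma continuous_on_refl_mat: "continuous_on (- {x}) (\<lambda>y. refl_mat (y - x))"
  unfolding refl_mat_def by (intro continuous_intros) auto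

lemma C2_on_kelvin:
  fixes x :: "real^'n"
  assumes "C2_on UNIV v g H" "\<mu> > 0"
  shows "C2_on (- {x}) (kelvin x \<mu> v) (kelvin_grad x \<mu> v g) (kelvin_hess x \<mu> v g H)"
  unfolding C2_on_def
proof (intro conjI ballI)
  fix y assume "y \<in> - {x}"
  then show "(kelvin x \<mu> v has_derivative (\<lambda>h. kelvin_grad x \<mu> v g y \<bullet> h)) (at y)"
    "(kelvin_grad x \<mu> v g has_derivative (\<lambda>h. kelvin_hess x \<mu> v g H y *v h)) (at y)"
    using C2_onD[OF assms(1)] assms(2) by (auto intro!: kelvin_has_derivative kelvin_grad_has_derivative)
next
  have c: "continuous_on (- {x}) (\<lambda>y. f (inversion x \<mu> y))" if "continuous_on UNIV f" for f :: "real^'n \<Rightarrow> 'b::topological_space"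
    using continuous_on_compose2[OF that inversion_continuous] by simp
  have mm: "continuous_on S (\<lambda>y. A y ** B y)" if "continuous_on S A" "continuous_on S B" for S and A B :: "real^'n \<Rightarrow> real^'n^'n"
    unfolding matrix_matrix_mult_def by (intro continuous_intros that)
  show "continuous_on (- {x}) (kelvin_hess x \<mu> v g H)"
    unfolding kelvin_hess_def[abs_def] using assms(2)
    by (intro continuous_intros mm continuous_on_refl_mat c C2_on_continuous[OF assms(1)]) auto
qed

lemma kelvin_pos: "\<mu> > 0 \<Longrightarrow> y \<noteq> x \<Longrightarrow> (\<And>z. 0 < v z) \<Longrightarrow> 0 < kelvin x \<mu> v y"
  by (simp add: kelvin_def)

lemma refl_mat_norm: "norm (refl_mat e *v p) = norm p"
proof -
  have "refl_mat e *v (refl_mat e *v p) = p"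
    using refl_mat_orthogonal[of e] by (simp add: matrix_vector_mul_assoc orthogonal_matrix_def refl_mat_sym)
  then have "(refl_mat e *v p) \<bullet> (refl_mat e *v p) = p \<bullet> p" by (simp add: refl_mat_inner)
  then show ?thesis by (simp add: norm_eq_sqrt_inner)
qed

text \<open>Conformal invariance: the scalar part of the Hessian cancels the extra terms of the
  squared gradient. What remains is an orthogonal conjugation, under which \<open>U\<close> and
  \<open>F\<close> are invariant.\<close>

lemma schouten_kelvin:
  assumes y: "y \<noteq> x" and \<mu>: "\<mu> > 0"
  shows "schouten (kelvin x \<mu> v y) (kelvin_grad x \<mu> v g y) (kelvin_hess x \<mu> v g H y)
    = refl_mat (y - x) ** schouten (v (inversion x \<mu> y)) (g (inversion x \<mu> y)) (H (inversion x \<mu> y)) ** refl_mat (y - x)"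
proof -
  let ?T = "inversion x \<mu> y"
  let ?R = "refl_mat (y - x)"
  define e where "e = y - x"
  define p where "p = g ?T"
  define a where "a = v ?T"
  define E where "E = e \<bullet> e"
  have E: "E \<noteq> 0" using y by (simp add: e_def E_def)
  have Ee: "(norm (y - x))\<^sup>2 = E" by (simp add: e_def E_def power2_norm_eq_inner)
  have RR: "?R ** ?R = mat 1" using refl_mat_orthogonal[of "y - x"] by (simp add: orthogonal_matrix_def refl_mat_sym)
  have eRp: "e \<bullet> (?R *v p) = - (e \<bullet> p)"
    unfolding refl_mat_mult e_def[symmetric] using E by (simp add: inner_diff_right E_def)
  have "(norm (kelvin_grad x \<mu> v g y))\<^sup>2 = (2 * a / \<mu>\<^sup>2)\<^sup>2 * E + 2 * (2 * a / \<mu>\<^sup>2) * (e \<bullet> (?R *v p)) + (norm (?R *v p))\<^sup>2"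
    unfolding kelvin_grad_def power2_norm_eq_inner a_def[symmetric] p_def[symmetric] e_def[symmetric]
    by (simp add: inner_add_left inner_add_right inner_commute E_def power2_eq_square)
  then have n: "(norm (kelvin_grad x \<mu> v g y))\<^sup>2 / 2 = (2 * a\<^sup>2 / \<mu>\<^sup>2 / \<mu>\<^sup>2) * E - (2 * a / \<mu>\<^sup>2) * (e \<bullet> p) + (norm p)\<^sup>2 / 2"
    unfolding eRp refl_mat_norm by (simp add: power2_eq_square)
  have k: "kelvin x \<mu> v y * (2 * a / \<mu>\<^sup>2 - 2 * (e \<bullet> p) / E) = (2 * a\<^sup>2 / \<mu>\<^sup>2 / \<mu>\<^sup>2) * E - (2 * a / \<mu>\<^sup>2) * (e \<bullet> p)"
    unfolding kelvin_def Ee a_def[symmetric] using E \<mu> by (simp add: power2_eq_square field_simps)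
  have k': "kelvin x \<mu> v y * (\<mu>\<^sup>2 / E) = a"
    unfolding kelvin_def Ee a_def[symmetric] using E \<mu> by simp
  have "kelvin x \<mu> v y *\<^sub>R kelvin_hess x \<mu> v g H y
      = ((2 * a\<^sup>2 / \<mu>\<^sup>2 / \<mu>\<^sup>2) * E - (2 * a / \<mu>\<^sup>2) * (e \<bullet> p)) *\<^sub>R mat 1 + a *\<^sub>R (?R ** H ?T ** ?R)"
    unfolding kelvin_hess_def a_def[symmetric] p_def[symmetric] e_def[symmetric] Ee[unfolded e_def[symmetric]]
    by (simp only: scaleR_add_right scaleR_scaleR k k')
  then have "schouten (kelvin x \<mu> v y) (kelvin_grad x \<mu> v g y) (kelvin_hess x \<mu> v g H y)
     = a *\<^sub>R (?R ** H ?T ** ?R) - ((norm p)\<^sup>2 / 2) *\<^sub>R mat 1"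
    unfolding schouten_def n by (simp add: scaleR_add_left scaleR_diff_left)
  moreover have "?R ** (a *\<^sub>R H ?T - ((norm p)\<^sup>2 / 2) *\<^sub>R mat 1) ** ?R = a *\<^sub>R (?R ** H ?T ** ?R) - ((norm p)\<^sup>2 / 2) *\<^sub>R (?R ** ?R)"
    unfolding matrix_eq
    by (simp add: matrix_vector_mul_assoc[symmetric] matrix_vector_mult_diff_rdistrib
      matrix_vector_mult_diff_distrib scaleR_matrix_vector_assoc[symmetric] matrix_vector_mult_scaleR)
  ultimately show ?thesis by (simp only: schouten_def RR a_def[symmetric] p_def[symmetric])
qed

subsection \<open>Moving spheres\<close>

locale conformally_invariant_operator = elliptic_operator U F
  for U :: "(real^'n::finite^'n) set" and F +
  assumes U_invariant: "\<And>Q. orthogonal_matrix Q \<Longrightarrow> (\<lambda>M. matrix_inv Q ** M ** Q) ` U = U"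
    and F_invariant: "\<And>M Q. M \<in> U \<Longrightarrow> orthogonal_matrix Q \<Longrightarrow> F (matrix_inv Q ** M ** Q) = F M"
    and trace_pos: "\<And>M. M \<in> U \<Longrightarrow> 0 < trace M"
    and F_zero: "0 \<notin> {M \<in> U. F M = 1}"
    and dim_ge_3: "CARD('n) \<ge> 3"
begin

lemma matrix_inv_refl_mat: "matrix_inv (refl_mat e) = refl_mat e"
proof -
  let ?R = "refl_mat e"
  have RR: "?R ** ?R = mat 1" using refl_mat_orthogonal[of e] by (simp add: orthogonal_matrix_def refl_mat_sym)
  then have "\<exists>A'. ?R ** A' = mat 1 \<and> A' ** ?R = mat 1" by blast
  then have "?R ** matrix_inv ?R = mat 1" unfolding matrix_inv_def by (rule someI2_ex) blast
  then have "?R ** (?R ** matrix_inv ?R) = ?R" by simp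
  then show ?thesis unfolding matrix_mul_assoc RR by simp
qed

lemma refl_mat_conjugate:
  assumes "M \<in> U"
  shows "refl_mat e ** M ** refl_mat e \<in> U" "F (refl_mat e ** M ** refl_mat e) = F M"
  using U_invariant[OF refl_mat_orthogonal[of e]] F_invariant[OF assms refl_mat_orthogonal[of e]] assms
  by (auto simp: matrix_inv_refl_mat)

lemma solution_kelvin:
  assumes v: "solution UNIV v g H" and \<mu>: "\<mu> > 0"
  shows "solution (- {x}) (kelvin x \<mu> v) (kelvin_grad x \<mu> v g) (kelvin_hess x \<mu> v g H)"
  unfolding solution_def
proof (intro conjI ballI)
  show "C2_on (- {x}) (kelvin x \<mu> v) (kelvin_grad x \<mu> v g) (kelvin_hess x \<mu> v g H)"
    by (rule C2_on_kelvin[OF solutionD(1)[OF v] \<mu>])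
  fix y assume "y \<in> - {x}"
  then have y: "y \<noteq> x" by simp
  show "0 < kelvin x \<mu> v y" using kelvin_pos[OF \<mu> y] solutionD(2)[OF v] by simp
  show "schouten (kelvin x \<mu> v y) (kelvin_grad x \<mu> v g y) (kelvin_hess x \<mu> v g H y) \<in> U"
    "F (schouten (kelvin x \<mu> v y) (kelvin_grad x \<mu> v g y) (kelvin_hess x \<mu> v g H y)) = 1"
    unfolding schouten_kelvin[OF y \<mu>]
    using refl_mat_conjugate[OF solutionD(3)[OF v UNIV_I]] solutionD(4)[OF v UNIV_I] by simp_all
qed

lemma solution_trace_hess_pos:
  assumes "solution S v g H" "y \<in> S"
  shows "0 < trace (H y)"
proof -
  have "0 < trace (schouten (v y) (g y) (H y))" using trace_pos solutionD(3)[OF assms] by blast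
  then have "0 < v y * trace (H y) - (norm (g y))\<^sup>2 / 2 * real CARD('n)"
    by (simp only: schouten_def trace_sub trace_scaleR trace_mat_1)
  moreover have "0 \<le> (norm (g y))\<^sup>2 / 2 * real CARD('n)" by simp
  ultimately have "0 < v y * trace (H y)" by linarith
  then show ?thesis using solutionD(2)[OF assms] by (simp add: zero_less_mult_iff)
qed

end

text \<open>\<open>growth\<close> is what the decay of the superharmonic function \<open>u\<close>
  says about \<open>v\<close>; it allows the sphere to start with a small radius.\<close>

locale entire_solution = conformally_invariant_operator U F
  for U :: "(real^'n::finite^'n) set" and F +
  fixes v :: "real^'n \<Rightarrow> real" and g H
  assumes sol: "solution UNIV v g H"
    and growth: "\<And>x r. r > 0 \<Longrightarrow> \<exists>C>0. \<forall>y. norm (y - x) \<ge> r \<longrightarrow> v y \<le> C * (norm (y - x))\<^sup>2"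
begin

lemma v_pos: "0 < v y"
  using solutionD(2)[OF sol] by simp

lemma v_deriv: "(v has_derivative (\<lambda>h. g y \<bullet> h)) (at y)"
  and g_deriv: "(g has_derivative (\<lambda>h. H y *v h)) (at y)"
  using C2_onD[OF solutionD(1)[OF sol]] by auto

lemma v_cont: "continuous_on S v" and g_cont: "continuous_on S g"
  using C2_on_continuous[OF solutionD(1)[OF sol]] continuous_on_subset by blast+

section \<open>Comparison of \<open>v\<close> with its Kelvin transforms near the sphere\<close>

definition radial_excess :: "real^'n \<Rightarrow> real^'n \<Rightarrow> real" where
  "radial_excess x y = v y - (y - x) \<bullet> g y"

lemma radial_excess_cont: "continuous_on S (radial_excess x)"
  unfolding radial_excess_def[abs_def] by (intro continuous_intros v_cont g_cont)

definition below_kelvin :: "real^'n \<Rightarrow> real \<Rightarrow> bool" where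
  "below_kelvin x \<mu> \<longleftrightarrow> (\<forall>y. \<mu> \<le> norm (y - x) \<longrightarrow> v y \<le> kelvin x \<mu> v y)"

lemma kelvin_on_sphere: "norm (y - x) = \<mu> \<Longrightarrow> \<mu> > 0 \<Longrightarrow> kelvin x \<mu> v y = v y"
  by (simp add: kelvin_def inversion_def)

text \<open>
  Along a ray from \<open>x\<close> the function \<open>v\<close> divided by the distance to \<open>x\<close> has the derivative
  \<open>- radial_excess x / dist\<^sup>2\<close>.
\<close>

lemma violation:
  assumes \<mu>: "\<mu> > 0" "\<mu> \<le> norm (y - x)" and viol: "kelvin x \<mu> v y < v y"
  obtains s where "\<mu>\<^sup>2 / norm (y - x) < s" "s < norm (y - x)"
    "radial_excess x (x + (s / norm (y - x)) *\<^sub>R (y - x)) < 0"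
proof -
  define R where "R = norm (y - x)"
  define \<theta> where "\<theta> = (1 / R) *\<^sub>R (y - x)"
  define r where "r = \<mu>\<^sup>2 / R"
  have "\<mu> \<noteq> R" using viol kelvin_on_sphere[of y x \<mu>] \<mu>(1) by (auto simp: R_def)
  then have R: "\<mu> < R" "R > 0" using \<mu> by (auto simp: R_def)
  have r: "0 < r" "r < R"
    using R \<mu>(1) power_strict_mono[of \<mu> R 2] by (auto simp: r_def field_simps power2_eq_square)
  define \<phi> where "\<phi> = (\<lambda>s. v (x + s *\<^sub>R \<theta>) / s)"
  have d: "(\<phi> has_real_derivative (- radial_excess x (x + s *\<^sub>R \<theta>) / s\<^sup>2)) (at s)" if "s > 0" for s
  proof -
    have "((\<lambda>s. x + s *\<^sub>R \<theta>) has_derivative (\<lambda>t. t *\<^sub>R \<theta>)) (at s)"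
      by (auto intro!: derivative_eq_intros)
    from has_derivative_compose[OF this v_deriv]
    have "((\<lambda>s. v (x + s *\<^sub>R \<theta>)) has_real_derivative (g (x + s *\<^sub>R \<theta>) \<bullet> \<theta>)) (at s)"
      unfolding has_field_derivative_def by (simp add: mult_commute_abs)
    then show ?thesis unfolding \<phi>_def using that
      by (auto intro!: derivative_eq_intros simp: radial_excess_def power2_eq_square divide_simps inner_commute)
  qed
  \<comment> \<open>\<open>\<phi>\<close> is \<open>v y / R\<close> at the outer point and
    \<open>kelvin x \<mu> v y / R\<close> at the inverted one, so a violation is an increase of
    \<open>\<phi>\<close> between them.\<close>
  obtain s where s: "r < s" "s < R" "\<phi> R - \<phi> r = (R - r) * (- radial_excess x (x + s *\<^sub>R \<theta>) / s\<^sup>2)"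
    using MVT2[OF r(2) d[OF less_le_trans[OF r(1)]]] by blast
  have "x + R *\<^sub>R \<theta> = y" using R by (simp add: \<theta>_def)
  moreover have "x + r *\<^sub>R \<theta> = inversion x \<mu> y"
    unfolding inversion_def \<theta>_def r_def R_def[symmetric] using R by (simp add: power2_eq_square)
  ultimately have "\<phi> R = v y / R" "\<phi> r = v (inversion x \<mu> y) / r" by (auto simp: \<phi>_def)
  moreover have "v (inversion x \<mu> y) / r = kelvin x \<mu> v y / R"
    unfolding kelvin_def r_def R_def[symmetric] using R \<mu>(1) by (simp add: field_simps power2_eq_square)
  ultimately have "\<phi> R - \<phi> r > 0" using viol R by (simp add: divide_strict_right_mono)
  then have "- radial_excess x (x + s *\<^sub>R \<theta>) / s\<^sup>2 > 0"
    unfolding s(3) by (rule zero_less_mult_pos) (use r in simp)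
  then have "radial_excess x (x + s *\<^sub>R \<theta>) < 0" using s(1) r(1) by (simp add: divide_less_0_iff)
  then have "radial_excess x (x + (s / R) *\<^sub>R (y - x)) < 0" by (simp add: \<theta>_def)
  then show ?thesis using that s unfolding r_def R_def by blast
qed

text \<open>Near \<open>x\<close> the radial excess is positive, whereas \<open>violation\<close>
  produces a point where it is negative. Farther out the transform is at least the minimum of
  \<open>v\<close> near \<open>x\<close> times
  \<open>(norm (y - x))\<^sup>2 / \<mu>\<^sup>2\<close>, which beats the quadratic growth of
  \<open>v\<close> for small \<open>\<mu>\<close>.\<close>

lemma below_kelvin_start: "\<exists>\<mu>0>0. \<forall>\<mu>. 0 < \<mu> \<and> \<mu> \<le> \<mu>0 \<longrightarrow> below_kelvin x \<mu>"
proof -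
  have "radial_excess x x > 0" using v_pos by (simp add: radial_excess_def)
  moreover have "isCont (radial_excess x) x"
    using radial_excess_cont[of UNIV x] by (simp add: continuous_on_eq_continuous_at)
  ultimately have "\<forall>\<^sub>F y in nhds x. 0 < radial_excess x y"
    by (intro order_tendstoD) (auto simp: continuous_at tendsto_at_iff_tendsto_nhds)
  then obtain d where d: "d > 0" "\<And>y. dist y x < d \<Longrightarrow> 0 < radial_excess x y"
    unfolding eventually_nhds_metric by blast
  define r where "r = d / 2"
  have r: "r > 0" "\<And>y. norm (y - x) \<le> r \<Longrightarrow> 0 < radial_excess x y"
    using d by (auto simp: r_def dist_norm)
  obtain C where C: "C > 0" "\<And>y. norm (y - x) \<ge> r \<Longrightarrow> v y \<le> C * (norm (y - x))\<^sup>2"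
    using growth[OF r(1)] by blast
  have "cball x r \<noteq> {}" using r(1) by simp
  then obtain z where z: "z \<in> cball x r" "\<And>y. y \<in> cball x r \<Longrightarrow> v z \<le> v y"
    using continuous_attains_inf[OF compact_cball _ v_cont] by blast
  \<comment> \<open>The square root ensures \<open>C * \<mu>\<^sup>2 \<le> v z\<close>; the bound
    \<open>r\<close> keeps the inverted points in the ball on which \<open>v z\<close> is the
    minimum.\<close>
  define \<mu>0 where "\<mu>0 = min r (sqrt (v z / C))"
  have "\<mu>0 > 0" using r(1) C(1) v_pos[of z] by (simp add: \<mu>0_def)
  moreover have "below_kelvin x \<mu>" if \<mu>: "0 < \<mu>" "\<mu> \<le> \<mu>0" for \<mu>
    unfolding below_kelvin_def
  proof (intro allI impI)
    fix y assume y: "\<mu> \<le> norm (y - x)"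
    have \<mu>r: "\<mu> \<le> r" using \<mu>(2) unfolding \<mu>0_def by linarith
    show "v y \<le> kelvin x \<mu> v y"
    proof (cases "norm (y - x) \<le> r")
      case True
      show ?thesis
      proof (rule ccontr)
        assume "\<not> v y \<le> kelvin x \<mu> v y"
        then have viol: "kelvin x \<mu> v y < v y" by simp
        obtain s where s: "\<mu>\<^sup>2 / norm (y - x) < s" "s < norm (y - x)"
            "radial_excess x (x + (s / norm (y - x)) *\<^sub>R (y - x)) < 0"
          using violation[OF \<mu>(1) y viol] by blast
        have "0 \<le> \<mu>\<^sup>2 / norm (y - x)" by simp
        then have s0: "s > 0" using s(1) by linarith
        have "norm (y - x) > 0" using y \<mu>(1) by linarith
        then have "norm ((s / norm (y - x)) *\<^sub>R (y - x)) = s" using s0 by simp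
        then have "norm ((x + (s / norm (y - x)) *\<^sub>R (y - x)) - x) \<le> r" using s(2) True by simp
        from r(2)[OF this] show False using s(3) by simp
      qed
    next
      case False
      have n0: "norm (y - x) > 0" using y \<mu>(1) by linarith
      have "norm (inversion x \<mu> y - x) = \<mu>\<^sup>2 / norm (y - x)"
        using n0 by (simp add: inversion_def power2_eq_square)
      also have "\<dots> \<le> \<mu>" using y \<mu>(1) n0 by (simp add: divide_le_eq power2_eq_square)
      finally have "inversion x \<mu> y \<in> cball x r" using \<mu>r by (simp add: dist_norm norm_minus_commute)
      then have "v z \<le> v (inversion x \<mu> y)" by (rule z(2))
      moreover have "C * \<mu>\<^sup>2 \<le> v z"
      proof -
        have "\<mu> \<le> sqrt (v z / C)" using \<mu>(2) unfolding \<mu>0_def by linarith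
        then have "\<mu>\<^sup>2 \<le> (sqrt (v z / C))\<^sup>2" using \<mu>(1) by (intro power_mono) auto
        also have "\<dots> = v z / C" using v_pos[of z] C(1) by simp
        finally show ?thesis using C(1) by (simp add: field_simps)
      qed
      ultimately have "C * \<mu>\<^sup>2 \<le> v (inversion x \<mu> y)" by simp
      then have "(norm (y - x))\<^sup>2 / \<mu>\<^sup>2 * (C * \<mu>\<^sup>2) \<le> kelvin x \<mu> v y"
        unfolding kelvin_def by (intro mult_left_mono) auto
      moreover have "v y \<le> C * (norm (y - x))\<^sup>2" using C(2) False by simp
      ultimately show ?thesis using \<mu>(1) by (simp add: mult_ac)
    qed
  qed
  ultimately show ?thesis by blast
qed

lemma kelvin_continuous_parameters:
  assumes "y \<noteq> x" "\<mu> > 0" "(f \<longlongrightarrow> \<mu>) G" "(h \<longlongrightarrow> y) G"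
  shows "((\<lambda>t. kelvin x (f t) v (h t)) \<longlongrightarrow> kelvin x \<mu> v y) G"
proof -
  have "((\<lambda>t. inversion x (f t) (h t)) \<longlongrightarrow> inversion x \<mu> y) G"
    unfolding inversion_def using assms by (intro tendsto_intros) auto
  moreover have "isCont v (inversion x \<mu> y)" using v_cont[of UNIV] by (simp add: continuous_on_eq_continuous_at)
  ultimately have "((\<lambda>t. v (inversion x (f t) (h t))) \<longlongrightarrow> v (inversion x \<mu> y)) G"
    by (rule isCont_tendsto_compose[rotated])
  then show ?thesis unfolding kelvin_def using assms by (intro tendsto_intros) auto
qed

lemma below_kelvin_closed:
  assumes \<mu>: "\<mu> > 0" and below: "\<And>\<mu>'. 0 < \<mu>' \<Longrightarrow> \<mu>' < \<mu> \<Longrightarrow> below_kelvin x \<mu>'"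
  shows "below_kelvin x \<mu>"
  unfolding below_kelvin_def
proof (intro allI impI)
  fix y assume y: "\<mu> \<le> norm (y - x)"
  have "y \<noteq> x" using y \<mu> by auto
  then have "((\<lambda>t. kelvin x t v y) \<longlongrightarrow> kelvin x \<mu> v y) (at_left \<mu>)"
    by (intro kelvin_continuous_parameters \<mu> tendsto_ident_at tendsto_const)
  moreover have "\<forall>\<^sub>F t in at_left \<mu>. v y \<le> kelvin x t v y"
  proof -
    have "\<forall>\<^sub>F t in at_left \<mu>. t \<in> {0<..<\<mu>}" by (rule eventually_at_leftI[of 0]) (use \<mu> in auto)
    then show ?thesis
    proof eventually_elim
      case (elim t)
      then show ?case using below[of t] y by (simp add: below_kelvin_def)
    qed
  qed
  ultimately show "v y \<le> kelvin x \<mu> v y" by (rule tendsto_lowerbound) simp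
qed

text \<open>On the sphere \<open>kelvin x \<mu> v - v\<close> vanishes, and its derivative in
  direction \<open>y - x\<close> is twice the radial excess; a negative value would violate
  \<open>below_kelvin\<close> just outside.\<close>

lemma radial_excess_nonneg:
  assumes \<mu>: "\<mu> > 0" and P: "below_kelvin x \<mu>" and y: "norm (y - x) = \<mu>"
  shows "0 \<le> radial_excess x y"
proof (rule ccontr)
  assume neg: "\<not> 0 \<le> radial_excess x y"
  define e where "e = y - x"
  have ne: "norm e = \<mu>" "e \<bullet> e = \<mu>\<^sup>2" using y by (simp_all add: e_def dot_square_norm)
  have yx: "y \<noteq> x" using y \<mu> by auto
  have line: "((\<lambda>t. y + t *\<^sub>R e) has_derivative (\<lambda>t. t *\<^sub>R e)) (at 0)"
    by (auto intro!: derivative_eq_intros)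
  let ?f = "\<lambda>y. kelvin x \<mu> v y - v y"
  have "(?f has_derivative (\<lambda>h. kelvin_grad x \<mu> v g y \<bullet> h - g y \<bullet> h)) (at (y + 0 *\<^sub>R e))"
    using has_derivative_diff[OF C2_onD(1)[OF C2_on_kelvin[OF solutionD(1)[OF sol] \<mu>], of y x] v_deriv[of y]] yx by simp
  from has_derivative_compose[OF line this]
  have "((\<lambda>t. ?f (y + t *\<^sub>R e)) has_real_derivative (kelvin_grad x \<mu> v g y \<bullet> e - g y \<bullet> e)) (at 0)"
    unfolding has_field_derivative_def by (simp add: mult_commute_abs right_diff_distrib[symmetric])
  moreover have "kelvin_grad x \<mu> v g y \<bullet> e - g y \<bullet> e = 2 * radial_excess x y"
  proof -
    have inv: "inversion x \<mu> y = y" using y \<mu> by (simp add: inversion_def)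
    have "(refl_mat e *v g y) \<bullet> e = - (e \<bullet> g y)"
      unfolding refl_mat_mult using ne \<mu> by (simp add: inner_diff_left inner_diff_right inner_commute)
    then show ?thesis
      unfolding kelvin_grad_def inv e_def[symmetric] radial_excess_def
      using ne \<mu> by (simp add: inner_add_left inner_add_right inner_commute)
  qed
  ultimately obtain d where d: "d > 0" "\<And>t. 0 < t \<Longrightarrow> t < d \<Longrightarrow> ?f (y + (0 + t) *\<^sub>R e) < ?f (y + 0 *\<^sub>R e)"
    using DERIV_neg_dec_right[of "\<lambda>t. ?f (y + t *\<^sub>R e)" "2 * radial_excess x y" 0] neg by auto
  have "?f (y + (d / 2) *\<^sub>R e) < ?f y" using d(2)[of "d / 2"] d(1) by simp
  also have "?f y = 0" using kelvin_on_sphere[OF y \<mu>] by simp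
  finally have "kelvin x \<mu> v (y + (d / 2) *\<^sub>R e) < v (y + (d / 2) *\<^sub>R e)" by simp
  moreover have "\<mu> \<le> norm (y + (d / 2) *\<^sub>R e - x)"
  proof -
    have "y + (d / 2) *\<^sub>R e - x = (1 + d / 2) *\<^sub>R e" by (simp add: e_def algebra_simps)
    then have "norm (y + (d / 2) *\<^sub>R e - x) = (1 + d / 2) * \<mu>" using d(1) ne(1) by simp
    then show ?thesis using d(1) \<mu> by (simp add: algebra_simps)
  qed
  ultimately show False using P unfolding below_kelvin_def by (meson not_less)
qed

lemma radial_excess_has_derivative:
  "(radial_excess x has_derivative (\<lambda>h. - ((y - x) \<bullet> (H y *v h)))) (at y)"
  unfolding radial_excess_def[abs_def]
  by (rule has_derivative_eq_rhs[OF has_derivative_diff[OF v_deriv has_derivative_inner[OF _ g_deriv]]])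
     (auto intro!: derivative_eq_intros simp: inner_commute)

lemma H_sym: "H y \<in> sym_mats"
  using solution_hess_sym[OF sol] by simp

text \<open>
  A zero \<open>y\<close> of \<open>radial_excess x\<close> on the sphere is a minimum on the sphere, which forces the Hessian of \<open>v\<close> to
  be invariant under the reflection. Then \<open>v\<close> and its Kelvin transform agree to second order at \<open>y\<close>.
\<close>

lemma radial_excess_pos:
  assumes \<mu>: "\<mu> > 0" and P: "below_kelvin x \<mu>"
    and strict: "\<And>y. \<mu> < norm (y - x) \<Longrightarrow> v y < kelvin x \<mu> v y" and y: "norm (y - x) = \<mu>"
  shows "0 < radial_excess x y"
proof (rule ccontr)
  assume "\<not> 0 < radial_excess x y"
  then have E0: "radial_excess x y = 0" using radial_excess_nonneg[OF \<mu> P y] by simp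
  define e where "e = y - x"
  have ne: "norm e = \<mu>" "e \<bullet> e = \<mu>\<^sup>2" using y by (simp_all add: e_def dot_square_norm)
  have e0: "e \<bullet> e \<noteq> 0" using ne \<mu> by simp
  have yx: "y \<noteq> x" using y \<mu> by auto
  have ye: "y = x + e" by (simp add: e_def)
  \<comment> \<open>The radial excess is nonnegative on the sphere and 0 at \<open>y\<close>, so its
    derivative along every great circle through \<open>y\<close> vanishes.\<close>
  have tang: "e \<bullet> (H y *v \<tau>) = 0" if \<tau>: "e \<bullet> \<tau> = 0" "norm \<tau> = \<mu>" for \<tau>
  proof -
    define c where "c = (\<lambda>t. x + (cos t *\<^sub>R e + sin t *\<^sub>R \<tau>))"
    have cs: "norm (c t - x) = \<mu>" for t
    proof -
      have "(c t - x) \<bullet> (c t - x) = (cos t)\<^sup>2 * (e \<bullet> e) + (sin t)\<^sup>2 * (\<tau> \<bullet> \<tau>)"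
        using \<tau>(1) by (simp add: c_def inner_add_left inner_add_right inner_commute power2_eq_square)
      also have "\<dots> = ((cos t)\<^sup>2 + (sin t)\<^sup>2) * \<mu>\<^sup>2" using ne(2) \<tau>(2) by (simp only: dot_square_norm distrib_right)
      also have "\<dots> = \<mu>\<^sup>2" by simp
      finally show ?thesis using \<mu> by (simp add: norm_eq_sqrt_inner)
    qed
    have c0: "c 0 = y" by (simp add: c_def ye)
    have dc: "(c has_derivative (\<lambda>t. t *\<^sub>R \<tau>)) (at 0)"
      unfolding c_def by (auto intro!: derivative_eq_intros)
    have D: "((\<lambda>t. radial_excess x (c t)) has_derivative (\<lambda>t. - (e \<bullet> (H y *v (t *\<^sub>R \<tau>))))) (at 0)"
      using has_derivative_compose[OF dc, of "radial_excess x" "\<lambda>h. - (e \<bullet> (H y *v h))"]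
        radial_excess_has_derivative[of x y] by (simp add: c0 e_def)
    have "radial_excess x (c 0) \<le> radial_excess x (c t)" for t
      using radial_excess_nonneg[OF \<mu> P cs, of t] E0 c0 by simp
    then have "(\<lambda>t. - (e \<bullet> (H y *v (t *\<^sub>R \<tau>)))) = (\<lambda>t. 0)"
      using differential_zero_maxmin[OF UNIV_I open_UNIV D] by blast
    from fun_cong[OF this, of 1] show ?thesis by simp
  qed
  define l where "l = (e \<bullet> (H y *v e)) / (e \<bullet> e)"
  \<comment> \<open>The tangential relations say that \<open>H y *v e\<close> has no component
    orthogonal to \<open>e\<close>.\<close>
  have eig: "H y *v e = l *\<^sub>R e"
  proof (rule ccontr)
    assume ne': "H y *v e \<noteq> l *\<^sub>R e"
    define q where "q = H y *v e - l *\<^sub>R e"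
    have q0: "q \<noteq> 0" using ne' by (simp add: q_def)
    have eq: "e \<bullet> q = 0" using e0 by (simp add: q_def l_def inner_diff_right)
    let ?t = "(\<mu> / norm q) *\<^sub>R q"
    have "e \<bullet> (H y *v ?t) = 0" by (rule tang) (use eq q0 \<mu> in auto)
    then have "e \<bullet> (H y *v q) = 0" using q0 \<mu> by (simp add: matrix_vector_mult_scaleR)
    then have "(H y *v e) \<bullet> q = 0" using sym_mats_inner[OF H_sym] by metis
    moreover have "H y *v e = q + l *\<^sub>R e" by (simp add: q_def)
    ultimately have "q \<bullet> q = 0" using eq by (simp add: inner_add_left)
    with q0 show False by simp
  qed
  have inv: "inversion x \<mu> y = y" using y \<mu> by (simp add: inversion_def)
  have eg: "e \<bullet> g y = v y" using E0 by (simp add: radial_excess_def e_def)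
  have kg: "kelvin_grad x \<mu> v g y = g y"
    unfolding kelvin_grad_def inv e_def[symmetric] refl_mat_mult eg ne(2) by simp
  have "refl_mat e ** H y ** refl_mat e = H y"
  proof -
    have "refl_mat e *v (H y *v (refl_mat e *v h)) = H y *v h" for h
    proof -
      define c where "c = 2 * (e \<bullet> h) / (e \<bullet> e)"
      have Rh: "refl_mat e *v h = h - c *\<^sub>R e" by (simp add: refl_mat_mult c_def)
      have eHh: "e \<bullet> (H y *v h) = l * (e \<bullet> h)" using sym_mats_inner[OF H_sym, of e y h] eig by simp
      have "2 * (e \<bullet> (H y *v h - (c * l) *\<^sub>R e)) / (e \<bullet> e) = - (c * l)"
        using e0 by (simp add: inner_diff_right eHh c_def field_simps)
      then have "refl_mat e *v (H y *v h - (c * l) *\<^sub>R e) = (H y *v h - (c * l) *\<^sub>R e) - (- (c * l)) *\<^sub>R e"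
        by (simp only: refl_mat_mult)
      then show ?thesis unfolding Rh
        by (simp add: matrix_vector_mult_diff_distrib matrix_vector_mult_scaleR eig)
    qed
    then show ?thesis by (simp add: matrix_eq matrix_vector_mul_assoc[symmetric])
  qed
  then have kh: "kelvin_hess x \<mu> v g H y = H y"
    unfolding kelvin_hess_def inv e_def[symmetric] eg using ne \<mu> by simp
  have kv: "kelvin x \<mu> v y = v y" by (rule kelvin_on_sphere[OF y \<mu>])
  show False
  \<comment> \<open>Hopf's lemma is applied from outside: the ball about \<open>y + e\<close>, that
    is \<open>x + 2 *\<^sub>R e\<close>, touches the sphere at \<open>y\<close>.\<close>
  proof (rule hopf[of "- {x}"])
    show "solution (- {x}) v g H" by (rule solution_subset[OF sol]) simp
    show "solution (- {x}) (kelvin x \<mu> v) (kelvin_grad x \<mu> v g) (kelvin_hess x \<mu> v g H)"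
      by (rule solution_kelvin[OF sol \<mu>])
    show "dist (y + e) y = \<mu>" using ne by (simp add: dist_norm)
    fix z assume "z \<in> ball (y + e) \<mu>"
    then have z: "norm (y + e - z) < \<mu>" by (simp add: dist_norm)
    have "2 *\<^sub>R e = (y + e - z) + (z - x)" by (simp add: ye scaleR_2)
    then have "norm (2 *\<^sub>R e) \<le> norm (y + e - z) + norm (z - x)" using norm_triangle_ineq[of "y + e - z" "z - x"] by simp
    then have "\<mu> < norm (z - x)" using z ne(1) by simp
    then show "z \<in> - {x} \<and> v z < kelvin x \<mu> v z" using strict \<mu> by auto
  qed (use yx \<mu> kg kh kv in auto)
qed

section \<open>Behaviour at infinity\<close>

definition pull :: "real^'n \<Rightarrow> real \<Rightarrow> real^'n \<Rightarrow> real" where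
  "pull x \<mu> z = (1 - 2 * (x \<bullet> z) + (x \<bullet> x) * (z \<bullet> z)) / \<mu>\<^sup>2 *
     v (x + (\<mu>\<^sup>2 / (1 - 2 * (x \<bullet> z) + (x \<bullet> x) * (z \<bullet> z))) *\<^sub>R (z - (z \<bullet> z) *\<^sub>R x))"

text \<open>\<open>pull x \<mu>\<close> is the Kelvin transform of \<open>kelvin x \<mu> v\<close>; the formula above extends it to \<open>0\<close>.\<close>

lemma pull_eq:
  assumes z: "z \<noteq> 0"
  shows "pull x \<mu> z = (norm z)\<^sup>2 * kelvin x \<mu> v (inversion 0 1 z)"
proof -
  define m where "m = 1 - 2 * (x \<bullet> z) + (x \<bullet> x) * (z \<bullet> z)"
  define Z where "Z = z \<bullet> z"
  have Z: "Z \<noteq> 0" using z by (simp add: Z_def)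
  have y: "inversion 0 1 z = (1 / Z) *\<^sub>R z" by (simp add: inversion_def Z_def power2_norm_eq_inner)
  have n: "(norm ((1 / Z) *\<^sub>R z - x))\<^sup>2 = m / Z"
  proof -
    have "(norm ((1 / Z) *\<^sub>R z - x))\<^sup>2 = (1 / Z) * ((1 / Z) * Z) - 2 * ((1 / Z) * (x \<bullet> z)) + x \<bullet> x"
      unfolding power2_norm_eq_inner by (simp add: inner_diff_left inner_diff_right inner_commute Z_def)
    also have "\<dots> = m / Z" using Z by (simp add: m_def field_simps flip: Z_def)
    finally show ?thesis .
  qed
  have "(\<mu>\<^sup>2 / (m / Z)) *\<^sub>R ((1 / Z) *\<^sub>R z - x) = (\<mu>\<^sup>2 / m) *\<^sub>R (z - Z *\<^sub>R x)"
    using Z by (simp add: scaleR_diff_right)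
  then have "inversion x \<mu> ((1 / Z) *\<^sub>R z) = x + (\<mu>\<^sup>2 / m) *\<^sub>R (z - Z *\<^sub>R x)"
    by (simp add: inversion_def n)
  moreover have "pull x \<mu> z = m / \<mu>\<^sup>2 * v (x + (\<mu>\<^sup>2 / m) *\<^sub>R (z - Z *\<^sub>R x))"
    by (simp only: pull_def m_def Z_def)
  moreover have "(norm z)\<^sup>2 = Z" by (simp add: Z_def power2_norm_eq_inner)
  ultimately show ?thesis unfolding y kelvin_def n using Z by simp
qed

lemma kelvin_origin_eq: "kelvin 0 1 v z = (norm z)\<^sup>2 * v (inversion 0 1 z)"
  by (simp add: kelvin_def)

lemma norm_inversion_origin: "norm (inversion 0 1 z) = 1 / norm z"
  by (simp add: inversion_def power2_eq_square)

text \<open>Radius and point vary together here, because the continuation argument changes the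
  radius while controlling a neighbourhood of infinity.\<close>

lemma pull_tendsto:
  assumes "\<mu> > 0" "(f \<longlongrightarrow> \<mu>) G" "(h \<longlongrightarrow> 0) G"
  shows "((\<lambda>t. pull x (f t) (h t)) \<longlongrightarrow> v x / \<mu>\<^sup>2) G"
proof -
  have m: "((\<lambda>t. 1 - 2 * (x \<bullet> h t) + (x \<bullet> x) * (h t \<bullet> h t)) \<longlongrightarrow> 1 - 2 * (x \<bullet> 0) + (x \<bullet> x) * ((0 :: real^'n) \<bullet> 0)) G"
    by (intro tendsto_intros assms)
  have "((\<lambda>t. x + ((f t)\<^sup>2 / (1 - 2 * (x \<bullet> h t) + (x \<bullet> x) * (h t \<bullet> h t))) *\<^sub>R (h t - (h t \<bullet> h t) *\<^sub>R x))
     \<longlongrightarrow> x + (\<mu>\<^sup>2 / (1 - 2 * (x \<bullet> 0) + (x \<bullet> x) * ((0 :: real^'n) \<bullet> 0))) *\<^sub>R (0 - ((0 :: real^'n) \<bullet> 0) *\<^sub>R x)) G"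
    by (rule tendsto_add[OF tendsto_const tendsto_scaleR[OF tendsto_divide[OF tendsto_power[OF assms(2)] m]
          tendsto_diff[OF assms(3) tendsto_scaleR[OF tendsto_inner[OF assms(3,3)] tendsto_const]]]]) simp
  then have "((\<lambda>t. x + ((f t)\<^sup>2 / (1 - 2 * (x \<bullet> h t) + (x \<bullet> x) * (h t \<bullet> h t))) *\<^sub>R (h t - (h t \<bullet> h t) *\<^sub>R x)) \<longlongrightarrow> x) G"
    by simp
  moreover have "isCont v x" using v_cont[of UNIV] by (simp add: continuous_on_eq_continuous_at)
  ultimately have "((\<lambda>t. v (x + ((f t)\<^sup>2 / (1 - 2 * (x \<bullet> h t) + (x \<bullet> x) * (h t \<bullet> h t))) *\<^sub>R (h t - (h t \<bullet> h t) *\<^sub>R x))) \<longlongrightarrow> v x) G"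
    by (rule isCont_tendsto_compose[rotated])
  from tendsto_mult[OF tendsto_divide[OF m tendsto_power[OF assms(2), of 2]] this]
  show ?thesis using assms(1) unfolding pull_def by simp
qed

lemma pull_0: "pull x \<mu> 0 = v x / \<mu>\<^sup>2"
  by (simp add: pull_def)

lemma pull_has_derivative:
  assumes "\<mu> > 0"
  shows "(pull x \<mu> has_derivative (\<lambda>h. (g x - (2 * v x / \<mu>\<^sup>2) *\<^sub>R x) \<bullet> h)) (at 0)"
proof -
  let ?m = "\<lambda>z. 1 - 2 * (x \<bullet> z) + (x \<bullet> x) * (z \<bullet> z)"
  have m: "(?m has_derivative (\<lambda>h. - 2 * (x \<bullet> h))) (at 0)"
    by (auto intro!: derivative_eq_intros)
  have a: "((\<lambda>z. x + (\<mu>\<^sup>2 / ?m z) *\<^sub>R (z - (z \<bullet> z) *\<^sub>R x)) has_derivative (\<lambda>h. \<mu>\<^sup>2 *\<^sub>R h)) (at 0)"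
    by (auto intro!: derivative_eq_intros)
  have "((\<lambda>z. v (x + (\<mu>\<^sup>2 / ?m z) *\<^sub>R (z - (z \<bullet> z) *\<^sub>R x))) has_derivative (\<lambda>h. g x \<bullet> (\<mu>\<^sup>2 *\<^sub>R h))) (at 0)"
    using has_derivative_compose[OF a, of v "\<lambda>h. g x \<bullet> h"] v_deriv[of x] by simp
  from has_derivative_mult[OF bounded_linear.has_derivative[OF bounded_linear_divide m, of "\<mu>\<^sup>2"] this]
  show ?thesis unfolding pull_def[abs_def]
    by (rule has_derivative_eq_rhs) (use assms in \<open>auto simp: inner_diff_left algebra_simps\<close>)
qed

text \<open>As \<open>kelvin 0 1 v z\<close> is \<open>v y / (norm y)\<^sup>2\<close> at the
  inverted point \<open>y\<close>, this says that the upper limit of that quotient at infinity is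
  below \<open>\<beta>\<close>.\<close>

definition strict_at_infinity :: "real \<Rightarrow> bool" where
  "strict_at_infinity \<beta> \<longleftrightarrow> (\<exists>\<delta>>0. \<exists>\<epsilon>>0. \<forall>z. 0 < norm z \<and> norm z < \<delta> \<longrightarrow> kelvin 0 1 v z \<le> \<beta> - \<epsilon>)"

lemma below_kelvin_imp_le_pull:
  assumes "\<mu> > 0" "below_kelvin x \<mu>" "z \<noteq> 0" "norm z \<le> 1 / (\<mu> + norm x)"
  shows "kelvin 0 1 v z \<le> pull x \<mu> z"
proof -
  have "\<mu> + norm x > 0" using assms(1) by (simp add: add_pos_nonneg)
  then have "\<mu> + norm x \<le> 1 / norm z" using assms(3,4) by (simp add: field_simps)
  then have "\<mu> \<le> norm (inversion 0 1 z) - norm x" by (simp add: norm_inversion_origin)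
  also have "\<dots> \<le> norm (inversion 0 1 z - x)" by (rule norm_triangle_ineq2)
  finally have "v (inversion 0 1 z) \<le> kelvin x \<mu> v (inversion 0 1 z)"
    using assms(2) by (simp add: below_kelvin_def)
  then show ?thesis unfolding pull_eq[OF assms(3)] kelvin_origin_eq by (intro mult_left_mono) auto
qed

text \<open>Near the origin \<open>kelvin 0 1 v\<close> lies below \<open>pull x \<mu>\<close>,
  which is continuous there with value \<open>v x / \<mu>\<^sup>2\<close>; half of the gap to
  \<open>\<beta>\<close> serves as margin.\<close>

lemma strict_at_infinity_mono:
  assumes "\<mu> > 0" "below_kelvin x \<mu>" "v x / \<mu>\<^sup>2 < \<beta>"
  shows "strict_at_infinity \<beta>"
proof -
  define \<epsilon> where "\<epsilon> = (\<beta> - v x / \<mu>\<^sup>2) / 2"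
  have half: "a < b - (b - a) / 2" if "a < b" for a b :: real using that by (simp add: field_simps)
  have eps: "\<epsilon> > 0" using assms(3) by (simp add: \<epsilon>_def)
  have "((\<lambda>z. pull x \<mu> z) \<longlongrightarrow> v x / \<mu>\<^sup>2) (at 0)"
    by (rule pull_tendsto[OF assms(1)]) (auto intro: tendsto_ident_at)
  moreover have "v x / \<mu>\<^sup>2 < \<beta> - \<epsilon>" using assms(3) unfolding \<epsilon>_def by (rule half)
  ultimately have "\<forall>\<^sub>F z in at 0. pull x \<mu> z < \<beta> - \<epsilon>" by (rule order_tendstoD)
  then obtain d where d: "d > 0" "\<And>z. z \<noteq> 0 \<Longrightarrow> norm z < d \<Longrightarrow> pull x \<mu> z < \<beta> - \<epsilon>"
    unfolding eventually_at by auto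
  have "\<mu> + norm x > 0" using assms(1) by (simp add: add_pos_nonneg)
  then have "min d (1 / (\<mu> + norm x)) > 0" using d(1) by simp
  moreover have "kelvin 0 1 v z \<le> \<beta> - \<epsilon>" if "0 < norm z" "norm z < min d (1 / (\<mu> + norm x))" for z
    using below_kelvin_imp_le_pull[OF assms(1,2), of z] d(2)[of z] that by force
  ultimately show ?thesis unfolding strict_at_infinity_def using eps by blast
qed

text \<open>Otherwise there are violating points for radii tending to \<open>\<mu>\<close>. The gap
  at infinity keeps them bounded, and the strong maximum principle keeps their limit on the sphere.
  The points of negative radial excess supplied by \<open>violation\<close> have the same limit,
  where the radial excess is positive.\<close>

lemma below_kelvin_continuation:
  assumes \<mu>: "\<mu> > 0" and P: "below_kelvin x \<mu>" and si: "strict_at_infinity (v x / \<mu>\<^sup>2)"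
  shows "\<exists>\<mu>1>\<mu>. \<forall>\<mu>'. \<mu> \<le> \<mu>' \<and> \<mu>' \<le> \<mu>1 \<longrightarrow> below_kelvin x \<mu>'"
proof (rule ccontr)
  assume neg: "\<not> ?thesis"
  obtain \<delta> \<epsilon> where de: "\<delta> > 0" "\<epsilon> > 0"
      "\<And>z. 0 < norm z \<Longrightarrow> norm z < \<delta> \<Longrightarrow> kelvin 0 1 v z \<le> v x / \<mu>\<^sup>2 - \<epsilon>"
    using si unfolding strict_at_infinity_def by blast
  have pid: "((\<lambda>p. p) \<longlongrightarrow> (\<mu>, 0 :: real^'n)) (nhds (\<mu>, 0))" by (rule filterlim_ident)
  have "((\<lambda>p. pull x (fst p) (snd p)) \<longlongrightarrow> v x / \<mu>\<^sup>2) (nhds (\<mu>, 0))"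
    using pull_tendsto[OF \<mu> tendsto_fst[OF pid, unfolded fst_conv] tendsto_snd[OF pid, unfolded snd_conv]] by simp
  then have "\<forall>\<^sub>F p in nhds (\<mu>, 0). v x / \<mu>\<^sup>2 - \<epsilon> < pull x (fst p) (snd p)"
    by (rule order_tendstoD) (use de in simp)
  then obtain d where d: "d > 0" "\<And>p. dist p (\<mu>, 0) < d \<Longrightarrow> v x / \<mu>\<^sup>2 - \<epsilon> < pull x (fst p) (snd p)"
    unfolding eventually_nhds_metric by blast
  define \<rho> where "\<rho> = min \<delta> (d / 2)"
  have rho: "\<rho> > 0" using de d by (simp add: \<rho>_def)
  \<comment> \<open>\<open>pull\<close> stays above \<open>v x / \<mu>\<^sup>2 - \<epsilon>\<close>
    for nearby radii too, so the strict inequality far out is uniform in the radius.\<close>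
  have far: "v y < kelvin x \<mu>' v y" if y: "norm y > 1 / \<rho>" and m: "\<bar>\<mu>' - \<mu>\<bar> < d / 2" for y \<mu>'
  proof -
    define z where "z = inversion 0 1 y"
    have y0: "norm y > 0" using y rho by (meson divide_pos_pos less_trans zero_less_one)
    have nz: "norm z = 1 / norm y" by (simp add: z_def norm_inversion_origin)
    have z: "norm z > 0" "norm z < \<rho>" unfolding nz using y0 y rho by (simp_all add: field_simps)
    have zy: "inversion 0 1 z = y" using y0 by (simp add: z_def inversion_def power2_eq_square)
    have zr: "norm z < \<delta>" "norm z < d / 2" using z(2) by (auto simp: \<rho>_def)
    have "dist (\<mu>', z) (\<mu>, 0) \<le> dist \<mu>' \<mu> + dist z 0" unfolding dist_Pair_Pair
      by (rule sqrt_sum_squares_le_sum) auto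
    also have "\<dots> < d" using m zr(2) by (simp add: dist_real_def)
    finally have "v x / \<mu>\<^sup>2 - \<epsilon> < pull x \<mu>' z" using d(2)[of "(\<mu>', z)"] by simp
    moreover have "kelvin 0 1 v z \<le> v x / \<mu>\<^sup>2 - \<epsilon>" using de(3) z zr by blast
    ultimately have "kelvin 0 1 v z < pull x \<mu>' z" by simp
    then have "(norm z)\<^sup>2 * v y < (norm z)\<^sup>2 * kelvin x \<mu>' v y"
      using z(1) by (simp add: kelvin_origin_eq pull_eq zy)
    then show ?thesis using z(1) by simp
  qed
  \<comment> \<open>\<open>far\<close> supplies one point of strict inequality, and the exterior of
    the ball is connected, so the strong maximum principle spreads it.\<close>
  have strict: "v y < kelvin x \<mu> v y" if "\<mu> < norm (y - x)" for y
  proof -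
    let ?\<Omega> = "- cball x \<mu>"
    have "0 \<le> 1 / \<rho> + \<mu> + norm x + 1" using rho \<mu> by simp
    then obtain p :: "real^'n" where p: "norm p = 1 / \<rho> + \<mu> + norm x + 1"
      by (rule vector_choose_size)
    have "norm p - norm x \<le> norm (p - x)" by (rule norm_triangle_ineq2)
    moreover have "0 < 1 / \<rho>" using rho by simp
    ultimately have "\<mu> < norm (p - x)" using p by linarith
    then have pO: "p \<in> ?\<Omega>" by (simp add: dist_norm norm_minus_commute)
    show ?thesis
    proof (rule strong_maximum_principle[of ?\<Omega> v g H "kelvin x \<mu> v" "kelvin_grad x \<mu> v g" "kelvin_hess x \<mu> v g H" p])
      show "connected ?\<Omega>" using dim_ge_3 by (intro connected_complement_bounded_convex) auto
      show "solution ?\<Omega> v g H" by (rule solution_subset[OF sol]) simp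
      show "solution ?\<Omega> (kelvin x \<mu> v) (kelvin_grad x \<mu> v g) (kelvin_hess x \<mu> v g H)"
        by (rule solution_subset[OF solution_kelvin[OF sol \<mu>]]) (use \<mu> in auto)
      show "v p < kelvin x \<mu> v p"
      proof (rule far)
        show "1 / \<rho> < norm p" using p \<mu> norm_ge_zero[of x] by linarith
      qed (use d in simp)
      fix y assume "y \<in> ?\<Omega>"
      then show "v y \<le> kelvin x \<mu> v y"
        using P by (simp add: below_kelvin_def dist_norm norm_minus_commute)
    qed (use that pO in \<open>auto simp: dist_norm norm_minus_commute\<close>)
  qed
  have "\<exists>m y. \<mu> \<le> m \<and> m \<le> \<mu> + (d / 4) / real (Suc k) \<and> m \<le> norm (y - x) \<and> kelvin x m v y < v y" for k
  proof -
    have "\<mu> + (d / 4) / real (Suc k) > \<mu>" using d by simp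
    then obtain m where "\<mu> \<le> m" "m \<le> \<mu> + (d / 4) / real (Suc k)" "\<not> below_kelvin x m"
      using neg by blast
    then show ?thesis unfolding below_kelvin_def by (meson not_less)
  qed
  then obtain m y where my: "\<And>k. \<mu> \<le> m k" "\<And>k. m k \<le> \<mu> + (d / 4) / real (Suc k)"
      "\<And>k. m k \<le> norm (y k - x)" "\<And>k. kelvin x (m k) v (y k) < v (y k)"
    by metis
  have m_lim: "m \<longlonglongrightarrow> \<mu>"
  proof (rule tendsto_sandwich[of "\<lambda>_. \<mu>" _ _ "\<lambda>k. \<mu> + (d / 4) / real (Suc k)"])
    show "(\<lambda>k. \<mu> + (d / 4) / real (Suc k)) \<longlonglongrightarrow> \<mu>"
      using tendsto_add[OF tendsto_const LIMSEQ_Suc[OF lim_const_over_n[of "d / 4"]], of \<mu>] by simp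
  qed (use my(1,2) in \<open>auto intro: always_eventually\<close>)
  have yb: "y k \<in> cball 0 (1 / \<rho>)" for k
  proof -
    have "(d / 4) / real (Suc k) \<le> d / 4" using d(1) by (simp add: field_simps)
    then have "\<bar>m k - \<mu>\<bar> < d / 2" using my(1,2)[of k] d(1) by linarith
    then have "\<not> 1 / \<rho> < norm (y k)" using far[of "y k" "m k"] my(4)[of k] by linarith
    then show ?thesis by simp
  qed
  have "seq_compact (cball (0 :: real^'n) (1 / \<rho>))"
    using compact_cball by (simp only: compact_eq_seq_compact_metric)
  then obtain y0 r where r: "strict_mono r" "(y \<circ> r) \<longlonglongrightarrow> y0"
    using seq_compactE[of "cball 0 (1 / \<rho>)" y] yb by blast
  have mr: "(m \<circ> r) \<longlonglongrightarrow> \<mu>" by (rule LIMSEQ_subseq_LIMSEQ[OF m_lim r(1)])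
  have nr: "(\<lambda>k. norm (y (r k) - x)) \<longlonglongrightarrow> norm (y0 - x)"
    using r(2) by (intro tendsto_intros) (simp add: comp_def)
  have y0: "\<mu> \<le> norm (y0 - x)"
    using mr nr my(3) by (intro LIMSEQ_le[of "m \<circ> r" \<mu>]) (auto simp: comp_def)
  have y0x: "y0 \<noteq> x" using y0 \<mu> by auto
  have "(\<lambda>k. kelvin x (m (r k)) v (y (r k))) \<longlonglongrightarrow> kelvin x \<mu> v y0"
    using kelvin_continuous_parameters[OF y0x \<mu> mr r(2)] by (simp add: comp_def)
  moreover have "(\<lambda>k. v (y (r k))) \<longlonglongrightarrow> v y0"
    using isCont_tendsto_compose[of y0 v "y \<circ> r"] v_cont[of UNIV] r(2)
    by (simp add: comp_def continuous_on_eq_continuous_at)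
  ultimately have "kelvin x \<mu> v y0 \<le> v y0"
    by (rule LIMSEQ_le) (use my(4) less_imp_le in blast)
  then have "norm (y0 - x) = \<mu>" using strict[of y0] y0 by linarith
  then have E: "0 < radial_excess x y0" using radial_excess_pos[OF \<mu> P strict] by blast
  have "\<exists>s. (m k)\<^sup>2 / norm (y k - x) < s \<and> s < norm (y k - x) \<and>
    radial_excess x (x + (s / norm (y k - x)) *\<^sub>R (y k - x)) < 0" for k
    using violation[OF _ my(3,4), of k] my(1)[of k] \<mu> by (metis less_le_trans)
  then obtain s where s: "\<And>k. (m k)\<^sup>2 / norm (y k - x) < s k" "\<And>k. s k < norm (y k - x)"
     "\<And>k. radial_excess x (x + (s k / norm (y k - x)) *\<^sub>R (y k - x)) < 0" by metis
  \<comment> \<open>The point given by \<open>violation\<close> lies between \<open>y k\<close> and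
    its inverse on one ray; along the subsequence the distances of both from \<open>x\<close> tend
    to \<open>\<mu>\<close>.\<close>
  have "(\<lambda>k. s (r k)) \<longlonglongrightarrow> \<mu>"
  proof (rule tendsto_sandwich[of "\<lambda>k. (m (r k))\<^sup>2 / norm (y (r k) - x)" _ _ "\<lambda>k. norm (y (r k) - x)"])
    show "(\<lambda>k. norm (y (r k) - x)) \<longlonglongrightarrow> \<mu>" using nr \<open>norm (y0 - x) = \<mu>\<close> by simp
    have "(\<lambda>k. (m (r k))\<^sup>2 / norm (y (r k) - x)) \<longlonglongrightarrow> \<mu>\<^sup>2 / norm (y0 - x)"
      by (rule tendsto_divide[OF tendsto_power[OF mr[unfolded comp_def]] nr]) (use y0x in simp)
    then show "(\<lambda>k. (m (r k))\<^sup>2 / norm (y (r k) - x)) \<longlonglongrightarrow> \<mu>"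
      using \<open>norm (y0 - x) = \<mu>\<close> \<mu> by (simp add: power2_eq_square)
  qed (use s(1,2) in \<open>auto intro!: always_eventually less_imp_le\<close>)
  then have "(\<lambda>k. x + (s (r k) / norm (y (r k) - x)) *\<^sub>R (y (r k) - x)) \<longlonglongrightarrow> x + (\<mu> / norm (y0 - x)) *\<^sub>R (y0 - x)"
    using nr y0x r(2) by (intro tendsto_intros) (auto simp: comp_def)
  then have "(\<lambda>k. x + (s (r k) / norm (y (r k) - x)) *\<^sub>R (y (r k) - x)) \<longlonglongrightarrow> y0"
    using \<open>norm (y0 - x) = \<mu>\<close> \<mu> by simp
  then have "(\<lambda>k. radial_excess x (x + (s (r k) / norm (y (r k) - x)) *\<^sub>R (y (r k) - x))) \<longlonglongrightarrow> radial_excess x y0"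
    using isCont_tendsto_compose[of y0 "radial_excess x"] radial_excess_cont[of UNIV x]
    by (simp add: continuous_on_eq_continuous_at)
  then have "radial_excess x y0 \<le> 0"
    by (rule LIMSEQ_le_const2) (use s(3) less_imp_le in blast)
  with E show False by simp
qed

text \<open>At a finite supremum of the admissible radii the comparison still holds by closedness;
  if it were strict at infinity, \<open>below_kelvin_continuation\<close> would lead past the
  supremum.\<close>

lemma moving_sphere_alternative:
  "(\<forall>\<mu>>0. below_kelvin x \<mu>) \<or> (\<exists>\<mu>>0. below_kelvin x \<mu> \<and> \<not> strict_at_infinity (v x / \<mu>\<^sup>2))"
proof (rule disjCI)
  assume neg: "\<not> (\<exists>\<mu>>0. below_kelvin x \<mu> \<and> \<not> strict_at_infinity (v x / \<mu>\<^sup>2))"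
  define S where "S = {\<mu>. 0 < \<mu> \<and> (\<forall>\<mu>'. 0 < \<mu>' \<and> \<mu>' \<le> \<mu> \<longrightarrow> below_kelvin x \<mu>')}"
  obtain \<mu>0 where m0: "\<mu>0 > 0" "\<mu>0 \<in> S" using below_kelvin_start[of x] unfolding S_def by auto
  have unbounded: "\<not> bdd_above S"
  proof
    assume bdd: "bdd_above S"
    define \<mu> where "\<mu> = Sup S"
    have "\<mu>0 \<le> \<mu>" unfolding \<mu>_def using m0 bdd by (intro cSup_upper)
    then have mpos: "\<mu> > 0" using m0 by linarith
    have below: "below_kelvin x \<mu>'" if m': "0 < \<mu>'" "\<mu>' < \<mu>" for \<mu>'
    proof -
      obtain m where "m \<in> S" "\<mu>' < m"
        using less_cSup_iff[THEN iffD1, of S \<mu>'] m'(2) m0(2) bdd unfolding \<mu>_def by blast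
      then show ?thesis using m' unfolding S_def by auto
    qed
    have P: "below_kelvin x \<mu>" by (rule below_kelvin_closed[OF mpos below])
    then have "strict_at_infinity (v x / \<mu>\<^sup>2)" using neg mpos by blast
    then obtain \<mu>1 where m1: "\<mu>1 > \<mu>" "\<And>\<mu>'. \<mu> \<le> \<mu>' \<Longrightarrow> \<mu>' \<le> \<mu>1 \<Longrightarrow> below_kelvin x \<mu>'"
      using below_kelvin_continuation[OF mpos P] by blast
    have "\<mu>1 \<in> S" unfolding S_def using m1 mpos below by (auto simp: not_less[symmetric])
    then have "\<mu>1 \<le> \<mu>" unfolding \<mu>_def using bdd by (intro cSup_upper)
    then show False using m1 by simp
  qed
  show "\<forall>\<mu>>0. below_kelvin x \<mu>"
  proof (intro allI impI)
    fix \<mu> :: real assume "\<mu> > 0"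
    obtain m where "m \<in> S" "\<mu> \<le> m" using unbounded unfolding bdd_above_def by (meson linear)
    then show "below_kelvin x \<mu>" using \<open>\<mu> > 0\<close> unfolding S_def by blast
  qed
qed

text \<open>A centre far away in direction \<open>- g y\<close> makes the radial excess at
  \<open>y\<close> negative unless \<open>g y = 0\<close>. So the gradient vanishes everywhere, and
  the zero matrix would solve the equation.\<close>

lemma not_all_below_kelvin: "\<not> (\<forall>x. \<forall>\<mu>>0. below_kelvin x \<mu>)"
proof
  assume all: "\<forall>x. \<forall>\<mu>>0. below_kelvin x \<mu>"
  have g0: "g y = 0" for y
  proof (rule ccontr)
    assume nz: "g y \<noteq> 0"
    then have gg: "g y \<bullet> g y > 0" by simp
    \<comment> \<open>With this \<open>t\<close> the radial excess at \<open>y\<close> about the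
      centre \<open>y - t *\<^sub>R g y\<close> is exactly -1.\<close>
    define t where "t = (v y + 1) / (g y \<bullet> g y)"
    have t: "t > 0" using v_pos[of y] gg by (simp add: t_def)
    have "0 \<le> radial_excess (y - t *\<^sub>R g y) y"
      by (rule radial_excess_nonneg[of "norm (t *\<^sub>R g y)"]) (use all t nz in auto)
    then have "t * (g y \<bullet> g y) \<le> v y" by (simp add: radial_excess_def)
    then show False using gg by (simp add: t_def)
  qed
  have "H y = 0" for y
  proof -
    have "g = (\<lambda>y. 0)" using g0 by auto
    then have "(g has_derivative (\<lambda>h. 0)) (at y)" by simp
    from has_derivative_unique[OF g_deriv this] have "H y *v h = 0" for h by (rule fun_cong)
    then show ?thesis by (simp add: matrix_eq)
  qed
  then have "schouten (v 0) (g 0) (H 0) = 0" by (simp add: schouten_def g0)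
  then show False using F_zero solutionD(3,4)[OF sol, of 0] by simp
qed

lemma classification:
  obtains xbar \<beta> d where "\<beta> > 0" "d > 0" "\<And>y. v y = \<beta> * (norm (y - xbar))\<^sup>2 + d"
    "(2 * \<beta> * d) *\<^sub>R mat 1 \<in> U" "F ((2 * \<beta> * d) *\<^sub>R mat 1) = 1"
proof -
  obtain x0 \<mu>0 where m0: "\<mu>0 > 0" "below_kelvin x0 \<mu>0" "\<not> strict_at_infinity (v x0 / \<mu>0\<^sup>2)"
    using not_all_below_kelvin moving_sphere_alternative by blast
  define \<beta> where "\<beta> = v x0 / \<mu>0\<^sup>2"
  have beta: "\<beta> > 0" using m0(1) v_pos by (simp add: \<beta>_def)
  \<comment> \<open>Two contact values cannot differ: the smaller one would make the larger one
    strict at infinity.\<close>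
  have ex: "\<exists>\<mu>>0. below_kelvin x \<mu> \<and> v x / \<mu>\<^sup>2 = \<beta>" for x
  proof (cases "\<forall>\<mu>>0. below_kelvin x \<mu>")
    case True
    \<comment> \<open>This radius gives \<open>v x / \<mu>\<^sup>2 = \<beta> / 2\<close>, a value
      below \<open>\<beta>\<close>.\<close>
    define \<mu> where "\<mu> = sqrt (2 * v x / \<beta>)"
    have "\<mu> > 0" using beta v_pos[of x] by (simp add: \<mu>_def)
    moreover have "v x / \<mu>\<^sup>2 < \<beta>" using beta v_pos[of x] by (simp add: \<mu>_def)
    ultimately have "strict_at_infinity \<beta>" using strict_at_infinity_mono True by blast
    then show ?thesis using m0(3) by (simp add: \<beta>_def)
  next
    case False
    then obtain \<mu> where m: "\<mu> > 0" "below_kelvin x \<mu>" "\<not> strict_at_infinity (v x / \<mu>\<^sup>2)"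
      using moving_sphere_alternative by blast
    have "\<not> v x / \<mu>\<^sup>2 < \<beta>" using strict_at_infinity_mono[OF m(1,2)] m0(3) by (auto simp: \<beta>_def)
    moreover have "\<not> \<beta> < v x / \<mu>\<^sup>2" using strict_at_infinity_mono[OF m0(1,2)] m(3) by (auto simp: \<beta>_def)
    ultimately show ?thesis using m by (intro exI[of _ \<mu>]) auto
  qed
  \<comment> \<open>The centre 0 serves as reference, since the gradient of \<open>pull 0\<close> at
    the origin is just \<open>g 0\<close>.\<close>
  have grad: "g x - (2 * \<beta>) *\<^sub>R x = g 0" for x
  proof (rule ccontr)
    assume ne: "g x - (2 * \<beta>) *\<^sub>R x \<noteq> g 0"
    obtain \<mu>1 where m1: "\<mu>1 > 0" "below_kelvin x \<mu>1" "v x / \<mu>1\<^sup>2 = \<beta>" using ex by blast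
    obtain \<mu>2 where m2: "\<mu>2 > 0" "below_kelvin 0 \<mu>2" "v 0 / \<mu>2\<^sup>2 = \<beta>" using ex by blast
    define \<rho> where "\<rho> = min (1 / (\<mu>1 + norm x)) (1 / (\<mu>2 + norm (0 :: real^'n)))"
    have rho: "\<rho> > 0" using m1(1) m2(1) by (simp add: \<rho>_def add_pos_nonneg)
    have rho': "\<rho> \<le> 1 / (\<mu>1 + norm x)" "\<rho> \<le> 1 / (\<mu>2 + norm (0 :: real^'n))"
      unfolding \<rho>_def by (rule min.cobounded1, rule min.cobounded2)
    have sub: "ball 0 \<rho> - {0} \<subseteq> - {0 :: real^'n}" by auto
    have k: "solution (- {0}) (kelvin 0 1 v) (kelvin_grad 0 1 v g) (kelvin_hess 0 1 v g H)"
      by (rule solution_kelvin[OF sol]) simp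
    have d1: "(pull x \<mu>1 has_derivative (\<lambda>h. (g x - (2 * \<beta>) *\<^sub>R x) \<bullet> h)) (at 0)"
    proof -
      have "2 * v x / \<mu>1\<^sup>2 = 2 * \<beta>" unfolding m1(3)[symmetric] by simp
      with pull_has_derivative[OF m1(1), of x] show ?thesis by (simp only:)
    qed
    have d2: "(pull 0 \<mu>2 has_derivative (\<lambda>h. g 0 \<bullet> h)) (at 0)"
      using pull_has_derivative[OF m2(1), of 0] by simp
    obtain \<epsilon> \<delta> where "\<epsilon> > 0" "\<delta> > 0" "\<And>z. 0 < norm z \<Longrightarrow> norm z < \<delta> \<Longrightarrow> kelvin 0 1 v z \<le> \<beta> - \<epsilon>"
    proof (rule touching_gradients[of \<rho> "kelvin 0 1 v" "kelvin_grad 0 1 v g" "kelvin_hess 0 1 v g H"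
          "pull x \<mu>1" "g x - (2 * \<beta>) *\<^sub>R x" \<beta> "pull 0 \<mu>2" "g 0"])
      show "2 \<le> CARD('n)" using dim_ge_3 by simp
      show "C2_on (ball 0 \<rho> - {0}) (kelvin 0 1 v) (kelvin_grad 0 1 v g) (kelvin_hess 0 1 v g H)"
        by (rule C2_on_subset[OF solutionD(1)[OF k] sub])
      show "pull x \<mu>1 0 = \<beta>" "pull 0 \<mu>2 0 = \<beta>" using m1 m2 by (simp_all add: pull_0)
      fix y :: "real^'n" assume y: "y \<in> ball 0 \<rho> - {0}"
      show "0 < trace (kelvin_hess 0 1 v g H y)" by (rule solution_trace_hess_pos[OF k]) (use y in auto)
      show "kelvin 0 1 v y \<le> pull x \<mu>1 y"
        by (rule below_kelvin_imp_le_pull[OF m1(1,2)]) (use y rho'(1) in auto)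
      show "kelvin 0 1 v y \<le> pull 0 \<mu>2 y"
        by (rule below_kelvin_imp_le_pull[OF m2(1,2)]) (use y rho'(2) in auto)
    qed (use rho d1 d2 ne in auto)
    then have "strict_at_infinity \<beta>" unfolding strict_at_infinity_def by blast
    then show False using m0(3) by (simp add: \<beta>_def)
  qed
  define xbar where "xbar = - ((1 / (2 * \<beta>)) *\<^sub>R g 0)"
  have gx: "g y = (2 * \<beta>) *\<^sub>R (y - xbar)" for y
    using grad[of y] beta by (simp add: xbar_def algebra_simps)
  define d where "d = v xbar"
  have "((\<lambda>y. v y - \<beta> * (norm (y - xbar))\<^sup>2) has_derivative (\<lambda>h. 0)) (at y within UNIV)" for y
    using has_derivative_diff[OF v_deriv C2_onD(1)[OF C2_on_scaleR[OF C2_on_norm_sq[of UNIV xbar], of \<beta>] UNIV_I], of y]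
    by (simp add: gx)
  then have "\<exists>c. \<forall>y\<in>UNIV. v y - \<beta> * (norm (y - xbar))\<^sup>2 = c"
    using has_derivative_zero_constant[of UNIV "\<lambda>y. v y - \<beta> * (norm (y - xbar))\<^sup>2"] by (simp only: convex_UNIV simp_thms)
  then obtain c where c: "\<And>y. v y - \<beta> * (norm (y - xbar))\<^sup>2 = c" by blast
  have v: "v y = \<beta> * (norm (y - xbar))\<^sup>2 + d" for y using c[of y] c[of xbar] by (simp add: d_def)
  have "H xbar = (2 * \<beta>) *\<^sub>R mat 1"
  proof -
    have "g = (\<lambda>y. (2 * \<beta>) *\<^sub>R (y - xbar))" using gx by auto
    then have "(g has_derivative (\<lambda>h. (2 * \<beta>) *\<^sub>R h)) (at xbar)"
      by (auto intro!: derivative_eq_intros)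
    from has_derivative_unique[OF g_deriv this] have "H xbar *v h = (2 * \<beta>) *\<^sub>R h" for h by (rule fun_cong)
    then show ?thesis by (simp add: matrix_eq scaleR_matrix_vector_assoc[symmetric])
  qed
  \<comment> \<open>At \<open>xbar\<close> the gradient vanishes, so the equation there reduces to
    the condition on a multiple of the identity.\<close>
  then have "schouten (v xbar) (g xbar) (H xbar) = (2 * \<beta> * d) *\<^sub>R mat 1"
    by (simp add: schouten_def gx d_def mult_ac)
  then have UF: "(2 * \<beta> * d) *\<^sub>R mat 1 \<in> U" "F ((2 * \<beta> * d) *\<^sub>R mat 1) = 1"
    using solutionD(3,4)[OF sol, of xbar] by simp_all
  have "d > 0" unfolding d_def by (rule v_pos)
  then show ?thesis by (rule that[OF beta _ v UF])
qed

end

subsection \<open>The conformal Hessian\<close>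

lemma Ck_on_Suc_UNIV:
  assumes "Ck_on (Suc k) UNIV UNIV f"
  shows "f differentiable (at x)" "Ck_on k UNIV UNIV (partial_deriv i f)"
  using assms by (auto simp: partial_deriv_def[abs_def])

lemma Ck_on_imp_continuous: "Ck_on k UNIV UNIV f \<Longrightarrow> continuous_on UNIV f"
  by (cases k) (auto intro: differentiable_imp_continuous_on simp: differentiable_on_def)

lemma has_derivative_grad:
  fixes f :: "real^'n \<Rightarrow> real"
  assumes "f differentiable (at x)"
  shows "(f has_derivative (\<lambda>h. grad f x \<bullet> h)) (at x)"
proof -
  let ?D = "frechet_derivative f (at x)"
  have D: "(f has_derivative ?D) (at x)" using assms by (simp add: frechet_derivative_works)
  then interpret D: linear ?D by (rule has_derivative_linear)
  have "?D h = grad f x \<bullet> h" for h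
  proof -
    have "h = (\<Sum>i\<in>UNIV. h $ i *\<^sub>R axis i 1)"
      using basis_expansion[of h] by (simp add: scalar_mult_eq_scaleR)
    then have "?D h = ?D (\<Sum>i\<in>UNIV. h $ i *\<^sub>R axis i 1)" by simp
    also have "\<dots> = (\<Sum>i\<in>UNIV. h $ i * ?D (axis i 1))" by (simp add: D.sum D.scaleR)
    finally show ?thesis by (simp add: inner_vec_def grad_def partial_deriv_def mult.commute)
  qed
  then have "?D = (\<lambda>h. grad f x \<bullet> h)" by (rule ext)
  with D show ?thesis by (simp only:)
qed

text \<open>The derivative of the gradient is given by the transpose of \<open>hess\<close>. Its
  symmetry is an assumption, obtained later from the fact that \<open>conf_hess\<close> takes values
  in \<open>U\<close>, a set of symmetric matrices.\<close>

lemma C2_on_grad_hess: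
  fixes u :: "real^'n \<Rightarrow> real"
  assumes u: "Ck_on (Suc (Suc k)) UNIV UNIV u" and sym: "\<And>x. hess u x \<in> sym_mats"
  shows "C2_on UNIV u (grad u) (hess u)"
  unfolding C2_on_def
proof (intro conjI ballI)
  fix x
  show "(u has_derivative (\<lambda>h. grad u x \<bullet> h)) (at x)"
    by (rule has_derivative_grad[OF Ck_on_Suc_UNIV(1)[OF u]])
  have j: "(partial_deriv j u has_derivative (\<lambda>h. (hess u x *v h) $ j)) (at x)" for j
  proof -
    have "grad (partial_deriv j u) x \<bullet> h = (hess u x *v h) $ j" for h
    proof -
      have "hess u x $ i $ j = hess u x $ j $ i" for i
        using sym[of x] by (simp add: sym_mats_def transpose_def vec_eq_iff)
      then show ?thesis
        by (simp add: inner_vec_def grad_def matrix_vector_mult_def hess_def)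
    qed
    then show ?thesis
      using has_derivative_grad[OF Ck_on_Suc_UNIV(1)[OF Ck_on_Suc_UNIV(2)[OF u]], of j x] by simp
  qed
  show "(grad u has_derivative (\<lambda>h. hess u x *v h)) (at x)"
    unfolding has_derivative_componentwise_within[of "grad u"]
  proof
    fix b :: "real^'n" assume "b \<in> Basis"
    then obtain i where b: "b = axis i 1" by (auto simp: Basis_vec_def)
    show "((\<lambda>x. grad u x \<bullet> b) has_derivative (\<lambda>h. (hess u x *v h) \<bullet> b)) (at x)"
      using j[of i] by (simp add: b inner_axis grad_def)
  qed
next
  show "continuous_on UNIV (hess u)" unfolding hess_def[abs_def]
    by (intro continuous_on_vec_lambda Ck_on_imp_continuous[of k] Ck_on_Suc_UNIV(2)[OF Ck_on_Suc_UNIV(2)[OF u]])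
qed

lemma hess_sym_if_conf_hess_sym:
  fixes u :: "real^'n \<Rightarrow> real"
  assumes n: "CARD('n) \<ge> 3" and u: "0 < u x" and sym: "conf_hess u x \<in> sym_mats"
  shows "hess u x \<in> sym_mats"
proof -
  define n where "n = real CARD('n)"
  have n2: "n > 2" using n by (simp add: n_def)
  define a where "a = - (2 / (n - 2)) * u x powr (- ((n + 2) / (n - 2)))"
  define b where "b = 2 * n / (n - 2)\<^sup>2 * u x powr (- (2 * n / (n - 2)))"
  define c where "c = 2 / (n - 2)\<^sup>2 * u x powr (- (2 * n / (n - 2))) * (norm (grad u x))\<^sup>2"
  have e: "conf_hess u x = a *\<^sub>R hess u x + b *\<^sub>R outer (grad u x) (grad u x) - c *\<^sub>R mat 1"
    by (simp add: conf_hess_def Let_def n_def a_def b_def c_def)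
  have o: "outer (grad u x) (grad u x) \<in> sym_mats"
    by (simp add: sym_mats_def transpose_def outer_def vec_eq_iff mult.commute)
  have "conf_hess u x + c *\<^sub>R mat 1 - b *\<^sub>R outer (grad u x) (grad u x) \<in> sym_mats"
    by (intro subspace_add subspace_diff subspace_scale[OF sym_mats_subspace] sym_mats_subspace sym o mat_1_sym)
  then have "a *\<^sub>R hess u x \<in> sym_mats" by (simp add: e)
  from subspace_scale[OF sym_mats_subspace this, of "1 / a"]
  have "(1 / a) *\<^sub>R a *\<^sub>R hess u x \<in> sym_mats" .
  moreover have "a \<noteq> 0" using n2 u by (simp add: a_def)
  ultimately show ?thesis by simp
qed

text \<open>The two gradient terms of \<open>conf_hess\<close> have opposite traces, so positivity
  of the trace on \<open>U\<close> says that \<open>u\<close> is superharmonic.\<close>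

lemma trace_conf_hess:
  fixes u :: "real^'n \<Rightarrow> real"
  assumes n: "CARD('n) \<ge> 3"
  shows "trace (conf_hess u x)
    = - (2 / (real CARD('n) - 2)) * u x powr (- ((real CARD('n) + 2) / (real CARD('n) - 2))) * trace (hess u x)"
proof -
  have "grad u x \<bullet> grad u x = (norm (grad u x))\<^sup>2" by (simp add: power2_norm_eq_inner)
  then show ?thesis
    unfolding conf_hess_def Let_def trace_sub trace_add trace_scaleR trace_outer trace_mat_1 by simp
qed

lemma conf_hess_eq_schouten:
  fixes u :: "real^'n \<Rightarrow> real"
  assumes n: "CARD('n) \<ge> 3" and u: "0 < u x" and c: "c = 2 / (real CARD('n) - 2)"
  shows "schouten (u x powr (- c)) ((- c * u x powr (- c - 1)) *\<^sub>R grad u x)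
     ((- c * u x powr (- c - 1)) *\<^sub>R hess u x + (- c * ((- c - 1) * u x powr (- c - 1 - 1))) *\<^sub>R outer (grad u x) (grad u x))
     = conf_hess u x"
proof -
  define n where "n = real CARD('n)"
  have n2: "n - 2 > 0" using n by (simp add: n_def)
  have cn: "c = 2 / (n - 2)" using c by (simp add: n_def)
  define p where "p = n - 2"
  have np: "n = p + 2" "p > 0" using n2 by (simp_all add: p_def)
  have e1: "- c + (- c - 1) = - ((n + 2) / (n - 2))" unfolding cn np(1) using np(2) by (simp add: field_simps)
  have e2: "- c + (- c - 1 - 1) = - (2 * n / (n - 2))" unfolding cn np(1) using np(2) by (simp add: field_simps)
  have e3: "(- c - 1) + (- c - 1) = - (2 * n / (n - 2))" unfolding cn np(1) using np(2) by (simp add: field_simps)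
  have c1: "c * (c + 1) = 2 * n / (n - 2)\<^sup>2" unfolding cn np(1) using np(2) by (simp add: field_simps power2_eq_square)
  have c2: "c\<^sup>2 / 2 = 2 / (n - 2)\<^sup>2" unfolding cn by (simp add: power2_eq_square)
  have 1: "u x powr (- c) * (- c * u x powr (- c - 1)) = - (2 / (n - 2)) * u x powr (- ((n + 2) / (n - 2)))"
    unfolding e1[symmetric] powr_add by (simp add: cn)
  have 2: "u x powr (- c) * (- c * ((- c - 1) * u x powr (- c - 1 - 1))) = 2 * n / (n - 2)\<^sup>2 * u x powr (- (2 * n / (n - 2)))"
    unfolding e2[symmetric] powr_add c1[symmetric] by (simp add: algebra_simps)
  have "(norm ((- c * u x powr (- c - 1)) *\<^sub>R grad u x))\<^sup>2 / 2
      = c\<^sup>2 / 2 * (u x powr (- c - 1) * u x powr (- c - 1)) * (norm (grad u x))\<^sup>2"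
    by (simp add: power_mult_distrib power2_eq_square)
  then have 3: "(norm ((- c * u x powr (- c - 1)) *\<^sub>R grad u x))\<^sup>2 / 2
      = 2 / (n - 2)\<^sup>2 * u x powr (- (2 * n / (n - 2))) * (norm (grad u x))\<^sup>2"
    unfolding c2 powr_add[symmetric] e3 .
  show ?thesis unfolding schouten_def scaleR_add_right scaleR_scaleR 1 2 3
    by (simp only: conf_hess_def Let_def n_def)
qed

section \<open>Reduction to the classification of entire solutions\<close>

theorem theorem1:
  fixes U :: "(real^'n^'n) set"
    and F :: "real^'n^'n \<Rightarrow> real"
    and u :: "real^'n \<Rightarrow> real"
    and k :: nat and \<gamma> :: real
  assumes "CARD('n) \<ge> 3"
    and "openin (top_of_set sym_mats) U"
    and "\<And>Q. orthogonal_matrix Q \<Longrightarrow> (\<lambda>M. matrix_inv Q ** M ** Q) ` U = U"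
    and "\<And>M N. M \<in> sym_mats \<Longrightarrow> N \<in> pos_def_mats \<Longrightarrow>
           convex (U \<inter> {M + t *\<^sub>R N | t. 0 < t})"
    and "(real CARD('n) + 1) / 2 < real k" and "k \<le> CARD('n)"
    and "eigenvalue_set U \<subseteq> Gamma_cone k"
    and "Ck_on 2 sym_mats U F"
    and "\<And>M Q. M \<in> U \<Longrightarrow> orthogonal_matrix Q \<Longrightarrow> F (matrix_inv Q ** M ** Q) = F M"
    and "0 \<notin> {M \<in> U. F M = 1}"
    and "\<And>M. M \<in> U \<Longrightarrow> matrix_deriv U F M \<in> pos_def_mats"
    and "locally_concave_on sym_mats U F"
    and "0 < \<gamma>" and "\<gamma> \<le> 1"
    and "\<And>M. M \<in> U \<Longrightarrow> F M = 1 \<Longrightarrow> norm M \<ge> 1 \<Longrightarrow>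
           (\<Sum>i\<in>UNIV. \<Sum>j\<in>UNIV. matrix_deriv U F M $ i $ j * M $ i $ j)
             \<le> 1 / \<gamma> * norm M powr (1 - \<gamma>) * (\<Sum>i\<in>UNIV. matrix_deriv U F M $ i $ i)"
    and "Ck_on 4 UNIV UNIV u"
    and "\<And>x. 0 < u x"
    and "\<And>x. conf_hess u x \<in> U"
    and "\<And>x. F (conf_hess u x) = 1"
  shows "\<exists>(xbar :: real^'n) (a :: real) (b :: real). 0 < a \<and> 0 < b
     \<and> (2 * b\<^sup>2 / a\<^sup>2) *\<^sub>R mat 1 \<in> U
     \<and> F ((2 * b\<^sup>2 / a\<^sup>2) *\<^sub>R mat 1) = 1
     \<and> (\<forall>x. u x = (a / (1 + b\<^sup>2 * (norm (x - xbar))\<^sup>2)) powr ((real CARD('n) - 2) / 2))"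
proof -
  note dim = assms(1) and u_pos = assms(17) and eq_U = assms(18) and eq_F = assms(19)
  \<comment> \<open>\<open>c\<close> is the exponent in \<open>v = u powr (- c)\<close>; its inverse
    \<open>\<nu>\<close> recovers \<open>u\<close> from \<open>v\<close> and is also the decay rate
    of \<open>u\<close> in the squared distance.\<close>
  define \<nu> where "\<nu> = (real CARD('n) - 2) / 2"
  define c where "c = 2 / (real CARD('n) - 2)"
  have nu: "\<nu> > 0" "c > 0" "c * \<nu> = 1" using dim by (auto simp: \<nu>_def c_def)
  have Usym: "U \<subseteq> sym_mats" using assms(2) openin_imp_subset by blast
  have k1: "1 \<le> k" using assms(5) by (cases "k = 0") auto
  interpret conformally_invariant_operator U F
  proof (intro conformally_invariant_operator.intro elliptic_operator.intro conformally_invariant_operator_axioms.intro)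
    show "openin (top_of_set sym_mats) U" by (rule assms(2))
    show "convex (U \<inter> {M + t *\<^sub>R N | t. 0 < t})" if "M \<in> sym_mats" "N \<in> pos_def_mats" for M N
      by (rule assms(4)[OF that])
    show "Ck_on 2 sym_mats U F" by (rule assms(8))
    show "matrix_deriv U F M \<in> pos_def_mats" if "M \<in> U" for M by (rule assms(11)[OF that])
    show "(\<lambda>M. matrix_inv Q ** M ** Q) ` U = U" if "orthogonal_matrix Q" for Q by (rule assms(3)[OF that])
    show "F (matrix_inv Q ** M ** Q) = F M" if "M \<in> U" "orthogonal_matrix Q" for M Q by (rule assms(9)[OF that])
    show "0 \<notin> {M \<in> U. F M = 1}" by (rule assms(10))
    show "CARD('n) \<ge> 3" by (rule assms(1))
    show "0 < trace M" if "M \<in> U" for M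
      using trace_pos_if_eigenvalues_Gamma[OF k1 assms(6,7) that] Usym that by blast
  qed
  have hs: "hess u x \<in> sym_mats" for x
    by (rule hess_sym_if_conf_hess_sym[OF dim u_pos subsetD[OF Usym eq_U]])
  have "Ck_on (Suc (Suc 2)) UNIV UNIV u" using assms(16) by (simp add: eval_nat_numeral)
  then have C2u: "C2_on UNIV u (grad u) (hess u)" by (rule C2_on_grad_hess[OF _ hs])
  have superharmonic: "trace (hess u x) < 0" for x
  proof -
    have "0 < trace (conf_hess u x)" by (rule trace_pos[OF eq_U])
    then have "0 < c * u x powr (- ((real CARD('n) + 2) / (real CARD('n) - 2))) * (- trace (hess u x))"
      by (simp add: trace_conf_hess[OF dim] c_def)
    moreover have "0 < c * u x powr (- ((real CARD('n) + 2) / (real CARD('n) - 2)))"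
      using nu(2) u_pos[of x] by simp
    ultimately have "0 < - trace (hess u x)" by (rule zero_less_mult_pos)
    then show ?thesis by simp
  qed
  define v where "v = (\<lambda>x. u x powr (- c))"
  define g where "g = (\<lambda>x. (- c * u x powr (- c - 1)) *\<^sub>R grad u x)"
  define H where "H = (\<lambda>x. (- c * u x powr (- c - 1)) *\<^sub>R hess u x
    + (- c * ((- c - 1) * u x powr (- c - 1 - 1))) *\<^sub>R outer (grad u x) (grad u x))"
  have C2v: "C2_on UNIV v g H" unfolding v_def g_def H_def
  proof (rule C2_on_compose[OF C2u, where \<phi> = "\<lambda>t. t powr (- c)" and \<phi>' = "\<lambda>t. - c * t powr (- c - 1)"
        and \<phi>'' = "\<lambda>t. - c * ((- c - 1) * t powr (- c - 1 - 1))"])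
    fix x
    show "((\<lambda>t. t powr (- c)) has_real_derivative - c * u x powr (- c - 1)) (at (u x))"
      using u_pos[of x] by (auto intro!: derivative_eq_intros)
    show "((\<lambda>t. - c * t powr (- c - 1)) has_real_derivative - c * ((- c - 1) * u x powr (- c - 1 - 1))) (at (u x))"
      using u_pos[of x] by (auto intro!: derivative_eq_intros)
  next
    show "continuous_on (u ` UNIV) (\<lambda>t. - c * ((- c - 1) * t powr (- c - 1 - 1)))"
      using u_pos by (intro continuous_intros) (auto simp: less_imp_neq[symmetric])
  qed
  have sch: "schouten (v x) (g x) (H x) = conf_hess u x" for x
    unfolding v_def g_def H_def by (rule conf_hess_eq_schouten[OF dim u_pos c_def])
  have sol: "solution UNIV v g H"
  proof -
    have "0 < v x" for x using u_pos[of x] by (simp add: v_def)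
    then show ?thesis unfolding solution_def sch by (intro conjI ballI C2v eq_U eq_F)
  qed
  have growth: "\<exists>C>0. \<forall>y. norm (y - x) \<ge> r \<longrightarrow> v y \<le> C * (norm (y - x))\<^sup>2" if r: "r > 0" for x r
  proof -
    obtain c0 where c0: "c0 > 0" "\<And>y. norm (y - x) \<ge> r \<Longrightarrow> c0 * ((norm (y - x))\<^sup>2) powr (- \<nu>) \<le> u y"
      using superharmonic_decay[OF dim C2u u_pos superharmonic r] unfolding \<nu>_def by blast
    have "v y \<le> c0 powr (- c) * (norm (y - x))\<^sup>2" if y: "norm (y - x) \<ge> r" for y
    proof -
      let ?s = "(norm (y - x))\<^sup>2"
      have "norm (y - x) > 0" using y r by linarith
      then have s: "?s > 0" by simp
      \<comment> \<open>The decay exponent \<open>- \<nu>\<close> of \<open>u\<close> turns into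
        \<open>c * \<nu> = 1\<close> for \<open>v\<close>, which is quadratic growth in the
        distance.\<close>
      have "v y \<le> (c0 * ?s powr (- \<nu>)) powr (- c)"
        unfolding v_def using c0 s nu(2) y by (intro powr_mono2') auto
      also have "\<dots> = c0 powr (- c) * ?s powr (c * \<nu>)"
        by (simp add: powr_mult powr_powr mult.commute)
      also have "\<dots> = c0 powr (- c) * ?s" using s by (simp add: nu(3))
      finally show ?thesis .
    qed
    then show ?thesis using c0(1) by (intro exI[of _ "c0 powr (- c)"]) auto
  qed
  interpret entire_solution U F v g H
  proof (rule entire_solution.intro[OF conformally_invariant_operator_axioms], rule entire_solution_axioms.intro)
    show "solution UNIV v g H" by (rule sol)
    show "\<exists>C>0. \<forall>y. norm (y - x) \<ge> r \<longrightarrow> v y \<le> C * (norm (y - x))\<^sup>2" if "r > 0" for x r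
      by (rule growth[OF that])
  qed
  obtain xbar \<beta> d where cl: "\<beta> > 0" "d > 0" "\<And>y. v y = \<beta> * (norm (y - xbar))\<^sup>2 + d"
    "(2 * \<beta> * d) *\<^sub>R mat 1 \<in> U" "F ((2 * \<beta> * d) *\<^sub>R mat 1) = 1"
    by (rule classification) (rule that)
  \<comment> \<open>With \<open>s\<close> the squared distance to \<open>xbar\<close>,
    \<open>1 / v = (1 / d) / (1 + (\<beta> / d) * s)\<close>; this dictates \<open>a\<close> and
    \<open>b\<^sup>2\<close>.\<close>
  define a where "a = 1 / d"
  define b where "b = sqrt (\<beta> / d)"
  have b2: "b\<^sup>2 = \<beta> / d" using cl by (simp add: b_def)
  have ab: "2 * b\<^sup>2 / a\<^sup>2 = 2 * \<beta> * d" unfolding b2 a_def using cl(2) by (simp add: power2_eq_square)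
  have u: "u x = (a / (1 + b\<^sup>2 * (norm (x - xbar))\<^sup>2)) powr ((real CARD('n) - 2) / 2)" for x
  proof -
    have "u x = v x powr (- \<nu>)"
      using u_pos[of x] nu(3) by (simp add: v_def powr_powr)
    also have "\<dots> = (1 / v x) powr \<nu>" by (simp add: powr_minus_divide powr_divide)
    also have "1 / v x = a / (1 + b\<^sup>2 * (norm (x - xbar))\<^sup>2)"
      unfolding cl(3) b2 a_def using cl(2) by (simp add: field_simps)
    finally show ?thesis by (simp only: \<nu>_def)
  qed
  have "0 < a" "0 < b" using cl(1,2) by (simp_all add: a_def b_def)
  then show ?thesis
    by (intro exI[of _ xbar] exI[of _ a] exI[of _ b] conjI allI u) (simp_all only: ab cl(4,5))
qed

end
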